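(* Let $k$ be a field, $V$ a finite-dimensional $k$-vector space such that $\dim(V)\ge2$, and $A=T(V)$ the tensor algebra of $V$ (the quadratic algebra with $R=0$). Then $$HK^0_{hi}(A)\cong 0,\qquad HK^1_{hi}(A)_0\cong V^{\ast},\qquad HK^1_{hi}(A)_1\cong Hom(V,V)/k.\mathrm{Id}_V,$$ $$HK^1_{hi}(A)_m\cong Hom(V,V^{\otimes m})/\langle v\mapsto av-va\,;\ a\in V^{\otimes m-1}\rangle\quad\text{if } m\ge2,$$ $$HK^p_{hi}(A)\cong 0\quad\text{if } p\ge2 .$$
   Context: $Hom=Hom_k$, $V^{\ast}=Hom(V,k)$. For a quadratic algebra $A=T(V)/(R)$, put $W_0=k$, $W_1=V$, $W_p=\bigcap_{i+2+j=p}V^{\otimes i}\otimes R\otimes V^{\otimes j}$ for $p\ge2$ (so $W_p=0$ for $p\ge2$ when $R=0$). Elements of $W_p$ are written $x_1\ldots x_p$ (a sum of such tensors, $x_i\in V$). Koszul cohomology $HK^\bullet(A)$ is the cohomology of $(Hom(W_\bullet,A),b_K)$, where for $f:W_p\to A$, $b_K(f)(x_1\ldots x_{p+1})=f(x_1\ldots x_p)x_{p+1}-(-1)^px_1f(x_2\ldots x_{p+1})$. It is graded by the biweight $(p,m)$, a cochain $W_p\to A_m$ having homological weight $p$ and coefficient weight $m$. Let $e_A:V\to A$, $e_A(x)=x$, and $(e_A\smile_Kf)(x_1\ldots x_{p+1})=(-1)^px_1f(x_2\ldots x_{p+1})$. This induces a differential $\partial_\smile:HK^p(A)_m\to HK^{p+1}(A)_{m+1}$.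 The higher Koszul cohomology $HK_{hi}^\bullet(A)$ is the homology of $(HK^\bullet(A),\partial_\smile)$, and $HK_{hi}^p(A)_m$ is its component of biweight $(p,m)$. $\langle v\mapsto av-va;\ a\in V^{\otimes m-1}\rangle$ denotes the subspace of $Hom(V,V^{\otimes m})$ formed by the maps $v\mapsto av-va$. *)

theory Defs
  imports "Jordan_Normal_Form.Missing_VectorSpace" "HOL-Algebra.QuotRing"
begin

section \<open>Linear algebra over a field \<open>K\<close>\<close>

text \<open>All spaces and algebras are HOL-Algebra module records over \<open>K\<close>; for a bare vector space the
  fields \<open>mult\<close> and \<open>one\<close> are meaningless.\<close>

definition quot_module :: "('k, 'a, 'm) module_scheme \<Rightarrow> 'a set \<Rightarrow> ('k, 'a set) module" where
  "quot_module M N =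
    \<lparr>carrier = a_rcosets\<^bsub>M\<^esub> N, mult = rcoset_mult M N, one = N +>\<^bsub>M\<^esub> \<one>\<^bsub>M\<^esub>,
     zero = N, add = set_add M, smult = (\<lambda>c X. \<Union>x\<in>X. N +>\<^bsub>M\<^esub> (c \<odot>\<^bsub>M\<^esub> x))\<rparr>"

definition base_module :: "('k, 'b) ring_scheme \<Rightarrow> ('k, 'k) module" where
  "base_module K = \<lparr>carrier = carrier K, mult = mult K, one = \<one>\<^bsub>K\<^esub>,
     zero = \<zero>\<^bsub>K\<^esub>, add = add K, smult = mult K\<rparr>"

text \<open>\<open>Hom_K(M, N)\<close>; maps are made \<open>extensional\<close> so that equality is equality on \<open>carrier M\<close>.\<close>
definition Hom_module :: "('k, 'b) ring_scheme \<Rightarrow> ('k, 'a, 'm) module_scheme \<Rightarrow>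
    ('k, 'c, 'n) module_scheme \<Rightarrow> ('k, 'a \<Rightarrow> 'c) module" where
  "Hom_module K M N =
    \<lparr>carrier = module_hom K M N \<inter> extensional (carrier M),
     mult = undefined, one = undefined,
     zero = (\<lambda>x\<in>carrier M. \<zero>\<^bsub>N\<^esub>),
     add = (\<lambda>f g. \<lambda>x\<in>carrier M. f x \<oplus>\<^bsub>N\<^esub> g x),
     smult = (\<lambda>c f. \<lambda>x\<in>carrier M. c \<odot>\<^bsub>N\<^esub> f x)\<rparr>"

definition lin_iso :: "('k, 'b) ring_scheme \<Rightarrow> ('k, 'a, 'm) module_scheme \<Rightarrow>
    ('k, 'c, 'n) module_scheme \<Rightarrow> bool" where
  "lin_iso K M N \<longleftrightarrow> (\<exists>f\<in>module_hom K M N. bij_betw f (carrier M) (carrier N))"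

section \<open>Tensor algebra\<close>

definition word :: "('k, 'b) ring_scheme \<Rightarrow> 'x list \<Rightarrow> 'x list \<Rightarrow> 'k" where
  "word K w = (\<lambda>u. if u = w then \<one>\<^bsub>K\<^esub> else \<zero>\<^bsub>K\<^esub>)"

text \<open>The free associative algebra on a set \<open>X\<close>: finitely supported functions on words, with
  the product that extends concatenation.\<close>
definition free_algebra :: "('k, 'b) ring_scheme \<Rightarrow> 'x set \<Rightarrow> ('k, 'x list \<Rightarrow> 'k) module" where
  "free_algebra K X =
    \<lparr>carrier = {f. (\<forall>w. f w \<in> carrier K) \<and> finite {w. f w \<noteq> \<zero>\<^bsub>K\<^esub>} \<and>
                  {w. f w \<noteq> \<zero>\<^bsub>K\<^esub>} \<subseteq> lists X},
     mult = (\<lambda>f g w. \<Oplus>\<^bsub>K\<^esub>i\<in>{..length w}. f (take i w) \<otimes>\<^bsub>K\<^esub> g (drop i w)),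
     one = word K [],
     zero = (\<lambda>w. \<zero>\<^bsub>K\<^esub>),
     add = (\<lambda>f g w. f w \<oplus>\<^bsub>K\<^esub> g w),
     smult = (\<lambda>c f w. c \<otimes>\<^bsub>K\<^esub> f w)\<rparr>"

definition tensor_ideal ::
  "('k, 'b) ring_scheme \<Rightarrow> ('k, 'v, 'c) module_scheme \<Rightarrow> ('v list \<Rightarrow> 'k) set" where
  "tensor_ideal K V =
    (let F = free_algebra K (carrier V) in
     Idl\<^bsub>F\<^esub>
      ({word K [x \<oplus>\<^bsub>V\<^esub> y] \<ominus>\<^bsub>F\<^esub> (word K [x] \<oplus>\<^bsub>F\<^esub> word K [y]) | x y. x \<in> carrier V \<and> y \<in> carrier V} \<union>
       {word K [c \<odot>\<^bsub>V\<^esub> x] \<ominus>\<^bsub>F\<^esub> (c \<odot>\<^bsub>F\<^esub> word K [x]) | c x. c \<in> carrier K \<and> x \<in> carrier V}))"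

type_synonym ('k, 'v) tensor = "('v list \<Rightarrow> 'k) set"

text \<open>\<open>T(V)\<close>: the free algebra on the set \<open>V\<close> modulo the relations making \<open>v \<mapsto> [v]\<close> linear.\<close>
definition tensor_algebra ::
  "('k, 'b) ring_scheme \<Rightarrow> ('k, 'v, 'c) module_scheme \<Rightarrow> ('k, ('k, 'v) tensor) module" where
  "tensor_algebra K V = quot_module (free_algebra K (carrier V)) (tensor_ideal K V)"

text \<open>The pure tensor \<open>x\<^sub>1 \<otimes> \<dots> \<otimes> x\<^sub>n\<close>; in particular \<open>pure_tensor K V [x]\<close> is \<open>x \<in> V\<close> inside \<open>T(V)\<close>.\<close>
definition pure_tensor ::
  "('k, 'b) ring_scheme \<Rightarrow> ('k, 'v, 'c) module_scheme \<Rightarrow> 'v list \<Rightarrow> ('k, 'v) tensor" where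
  "pure_tensor K V xs = tensor_ideal K V +>\<^bsub>free_algebra K (carrier V)\<^esub> word K xs"

text \<open>\<open>V\<^sup>\<otimes>\<^sup>n\<close> as a subspace of \<open>T(V)\<close>.\<close>
definition tensor_power ::
  "('k, 'b) ring_scheme \<Rightarrow> ('k, 'v, 'c) module_scheme \<Rightarrow> nat \<Rightarrow> ('k, 'v) tensor set" where
  "tensor_power K V n = module.span K (tensor_algebra K V)
     {pure_tensor K V xs | xs. xs \<in> lists (carrier V) \<and> length xs = n}"

text \<open>The span of all products \<open>a b\<close> with \<open>a \<in> S\<close>, \<open>b \<in> S'\<close>. For homogeneous subspaces
  \<open>S \<subseteq> V\<^sup>\<otimes>\<^sup>i\<close>, \<open>S' \<subseteq> V\<^sup>\<otimes>\<^sup>j\<close> this is \<open>S \<otimes> S'\<close> inside \<open>V\<^sup>\<otimes>\<^sup>i\<^sup>+\<^sup>j\<close>.\<close>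
definition tensor_prod :: "('k, 'b) ring_scheme \<Rightarrow> ('k, 'v, 'c) module_scheme \<Rightarrow>
    ('k, 'v) tensor set \<Rightarrow> ('k, 'v) tensor set \<Rightarrow> ('k, 'v) tensor set" where
  "tensor_prod K V S S' = module.span K (tensor_algebra K V)
     {a \<otimes>\<^bsub>tensor_algebra K V\<^esub> b | a b. a \<in> S \<and> b \<in> S'}"

section \<open>Quadratic algebras\<close>

text \<open>In the rest of this theory \<open>R\<close> is meant to be a subspace of \<open>tensor_power K V 2\<close>.\<close>

definition quadratic_algebra :: "('k, 'b) ring_scheme \<Rightarrow> ('k, 'v, 'c) module_scheme \<Rightarrow>
    ('k, 'v) tensor set \<Rightarrow> ('k, ('k, 'v) tensor set) module" where
  "quadratic_algebra K V R = quot_module (tensor_algebra K V) (Idl\<^bsub>tensor_algebra K V\<^esub> R)"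

definition quadratic_proj :: "('k, 'b) ring_scheme \<Rightarrow> ('k, 'v, 'c) module_scheme \<Rightarrow>
    ('k, 'v) tensor set \<Rightarrow> ('k, 'v) tensor \<Rightarrow> ('k, 'v) tensor set" where
  "quadratic_proj K V R t = (Idl\<^bsub>tensor_algebra K V\<^esub> R) +>\<^bsub>tensor_algebra K V\<^esub> t"

definition quadratic_component :: "('k, 'b) ring_scheme \<Rightarrow> ('k, 'v, 'c) module_scheme \<Rightarrow>
    ('k, 'v) tensor set \<Rightarrow> nat \<Rightarrow> ('k, 'v) tensor set set" where
  "quadratic_component K V R m = quadratic_proj K V R ` tensor_power K V m"

text \<open>The subspaces \<open>W\<^sub>p\<close> of \<open>V\<^sup>\<otimes>\<^sup>p\<close>. Here \<open>k\<close> and \<open>V\<close> are identified with the components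
  of degree 0 and 1 of \<open>T(V)\<close>.\<close>
definition koszul_W :: "('k, 'b) ring_scheme \<Rightarrow> ('k, 'v, 'c) module_scheme \<Rightarrow>
    ('k, 'v) tensor set \<Rightarrow> nat \<Rightarrow> ('k, 'v) tensor set" where
  "koszul_W K V R p =
    (if p < 2 then tensor_power K V p
     else \<Inter>{tensor_prod K V (tensor_prod K V (tensor_power K V i) R) (tensor_power K V j) | i j.
              i + 2 + j = p})"

section \<open>Koszul cohomology\<close>

definition koszul_cochains :: "('k, 'b) ring_scheme \<Rightarrow> ('k, 'v, 'c) module_scheme \<Rightarrow>
    ('k, 'v) tensor set \<Rightarrow> nat \<Rightarrow> ('k, ('k, 'v) tensor \<Rightarrow> ('k, 'v) tensor set) module" where
  "koszul_cochains K V R p =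
    Hom_module K ((tensor_algebra K V)\<lparr>carrier := koszul_W K V R p\<rparr>) (quadratic_algebra K V R)"

text \<open>The fundamental cochain \<open>e\<^sub>A\<close>, with \<open>V\<close> itself as domain.\<close>
definition koszul_e :: "('k, 'b) ring_scheme \<Rightarrow> ('k, 'v, 'c) module_scheme \<Rightarrow>
    ('k, 'v) tensor set \<Rightarrow> 'v \<Rightarrow> ('k, 'v) tensor set" where
  "koszul_e K V R = (\<lambda>x\<in>carrier V. quadratic_proj K V R (pure_tensor K V [x]))"

text \<open>For \<open>f : W\<^sub>p \<rightarrow> A\<close>, the unique linear map \<open>W\<^sub>p \<otimes> V \<rightarrow> A\<close> with \<open>w \<otimes> x \<mapsto> f(w) x\<close>. On the
  subspace \<open>W\<^sub>p\<^sub>+\<^sub>1 \<subseteq> W\<^sub>p \<otimes> V\<close> it is the map written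
  \<open>x\<^sub>1\<dots>x\<^sub>p\<^sub>+\<^sub>1 \<mapsto> f(x\<^sub>1\<dots>x\<^sub>p) x\<^sub>p\<^sub>+\<^sub>1\<close>.\<close>
definition right_mult :: "('k, 'b) ring_scheme \<Rightarrow> ('k, 'v, 'c) module_scheme \<Rightarrow>
    ('k, 'v) tensor set \<Rightarrow> nat \<Rightarrow> (('k, 'v) tensor \<Rightarrow> ('k, 'v) tensor set) \<Rightarrow>
    ('k, 'v) tensor \<Rightarrow> ('k, 'v) tensor set" where
  "right_mult K V R p f = (THE g.
    g \<in> carrier (Hom_module K
      ((tensor_algebra K V)\<lparr>carrier := tensor_prod K V (koszul_W K V R p) (tensor_power K V 1)\<rparr>)
      (quadratic_algebra K V R)) \<and>
    (\<forall>w\<in>koszul_W K V R p. \<forall>x\<in>carrier V.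
      g (w \<otimes>\<^bsub>tensor_algebra K V\<^esub> pure_tensor K V [x])
        = f w \<otimes>\<^bsub>quadratic_algebra K V R\<^esub> koszul_e K V R x))"

text \<open>Likewise \<open>x\<^sub>1\<dots>x\<^sub>p\<^sub>+\<^sub>1 \<mapsto> x\<^sub>1 f(x\<^sub>2\<dots>x\<^sub>p\<^sub>+\<^sub>1)\<close>, defined on \<open>V \<otimes> W\<^sub>p\<close>.\<close>
definition left_mult :: "('k, 'b) ring_scheme \<Rightarrow> ('k, 'v, 'c) module_scheme \<Rightarrow>
    ('k, 'v) tensor set \<Rightarrow> nat \<Rightarrow> (('k, 'v) tensor \<Rightarrow> ('k, 'v) tensor set) \<Rightarrow>
    ('k, 'v) tensor \<Rightarrow> ('k, 'v) tensor set" where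
  "left_mult K V R p f = (THE g.
    g \<in> carrier (Hom_module K
      ((tensor_algebra K V)\<lparr>carrier := tensor_prod K V (tensor_power K V 1) (koszul_W K V R p)\<rparr>)
      (quadratic_algebra K V R)) \<and>
    (\<forall>x\<in>carrier V. \<forall>w\<in>koszul_W K V R p.
      g (pure_tensor K V [x] \<otimes>\<^bsub>tensor_algebra K V\<^esub> w)
        = koszul_e K V R x \<otimes>\<^bsub>quadratic_algebra K V R\<^esub> f w))"

definition koszul_b :: "('k, 'b) ring_scheme \<Rightarrow> ('k, 'v, 'c) module_scheme \<Rightarrow>
    ('k, 'v) tensor set \<Rightarrow> nat \<Rightarrow> (('k, 'v) tensor \<Rightarrow> ('k, 'v) tensor set) \<Rightarrow>
    ('k, 'v) tensor \<Rightarrow> ('k, 'v) tensor set" where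
  "koszul_b K V R p f = (\<lambda>x\<in>koszul_W K V R (Suc p).
     right_mult K V R p f x \<ominus>\<^bsub>quadratic_algebra K V R\<^esub>
     ((\<ominus>\<^bsub>K\<^esub> \<one>\<^bsub>K\<^esub>) [^]\<^bsub>K\<^esub> p) \<odot>\<^bsub>quadratic_algebra K V R\<^esub> left_mult K V R p f x)"

definition cup_e :: "('k, 'b) ring_scheme \<Rightarrow> ('k, 'v, 'c) module_scheme \<Rightarrow>
    ('k, 'v) tensor set \<Rightarrow> nat \<Rightarrow> (('k, 'v) tensor \<Rightarrow> ('k, 'v) tensor set) \<Rightarrow>
    ('k, 'v) tensor \<Rightarrow> ('k, 'v) tensor set" where
  "cup_e K V R p f = (\<lambda>x\<in>koszul_W K V R (Suc p).
     ((\<ominus>\<^bsub>K\<^esub> \<one>\<^bsub>K\<^esub>) [^]\<^bsub>K\<^esub> p) \<odot>\<^bsub>quadratic_algebra K V R\<^esub> left_mult K V R p f x)"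

subsection \<open>Cohomology of a complex \<open>d p : C p \<rightarrow> C (p + 1)\<close>\<close>

definition cocycles :: "(nat \<Rightarrow> ('k, 'a) module) \<Rightarrow> (nat \<Rightarrow> 'a \<Rightarrow> 'a) \<Rightarrow> nat \<Rightarrow> 'a set" where
  "cocycles C d p = {f \<in> carrier (C p). d p f = \<zero>\<^bsub>C (Suc p)\<^esub>}"

definition coboundaries :: "(nat \<Rightarrow> ('k, 'a) module) \<Rightarrow> (nat \<Rightarrow> 'a \<Rightarrow> 'a) \<Rightarrow> nat \<Rightarrow> 'a set" where
  "coboundaries C d p = (case p of 0 \<Rightarrow> {\<zero>\<^bsub>C 0\<^esub>} | Suc q \<Rightarrow> d q ` carrier (C q))"

definition cohomology ::
  "(nat \<Rightarrow> ('k, 'a) module) \<Rightarrow> (nat \<Rightarrow> 'a \<Rightarrow> 'a) \<Rightarrow> nat \<Rightarrow> ('k, 'a set) module" where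
  "cohomology C d p =
     quot_module ((C p)\<lparr>carrier := cocycles C d p\<rparr>) (coboundaries C d p)"

definition cohomology_class ::
  "(nat \<Rightarrow> ('k, 'a) module) \<Rightarrow> (nat \<Rightarrow> 'a \<Rightarrow> 'a) \<Rightarrow> nat \<Rightarrow> 'a \<Rightarrow> 'a set" where
  "cohomology_class C d p f = coboundaries C d p +>\<^bsub>C p\<^esub> f"

text \<open>The subspace of the classes represented by a cocycle lying in the subspace \<open>G\<close> of \<open>C p\<close>. It
  is used with \<open>G\<close> the part of \<open>C p\<close> of a given weight.\<close>
definition cohomology_part ::
  "(nat \<Rightarrow> ('k, 'a) module) \<Rightarrow> (nat \<Rightarrow> 'a \<Rightarrow> 'a) \<Rightarrow> nat \<Rightarrow> 'a set \<Rightarrow> ('k, 'a set) module" where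
  "cohomology_part C d p G =
     (cohomology C d p)\<lparr>carrier := cohomology_class C d p ` (cocycles C d p \<inter> G)\<rparr>"

subsection \<open>Koszul cohomology and higher Koszul cohomology\<close>

definition HK :: "('k, 'b) ring_scheme \<Rightarrow> ('k, 'v, 'c) module_scheme \<Rightarrow>
    ('k, 'v) tensor set \<Rightarrow> nat \<Rightarrow> ('k, (('k, 'v) tensor \<Rightarrow> ('k, 'v) tensor set) set) module" where
  "HK K V R = cohomology (koszul_cochains K V R) (koszul_b K V R)"

definition HK_part :: "('k, 'b) ring_scheme \<Rightarrow> ('k, 'v, 'c) module_scheme \<Rightarrow>
    ('k, 'v) tensor set \<Rightarrow> nat \<Rightarrow> nat \<Rightarrow>
    ('k, (('k, 'v) tensor \<Rightarrow> ('k, 'v) tensor set) set) module" where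
  "HK_part K V R p m = cohomology_part (koszul_cochains K V R) (koszul_b K V R) p
     {f \<in> carrier (koszul_cochains K V R p). f ` koszul_W K V R p \<subseteq> quadratic_component K V R m}"

text \<open>The differential induced by \<open>e\<^sub>A \<smile>\<^sub>K _\<close>; the classes united below all coincide.\<close>
definition HK_diff :: "('k, 'b) ring_scheme \<Rightarrow> ('k, 'v, 'c) module_scheme \<Rightarrow>
    ('k, 'v) tensor set \<Rightarrow> nat \<Rightarrow> (('k, 'v) tensor \<Rightarrow> ('k, 'v) tensor set) set \<Rightarrow>
    (('k, 'v) tensor \<Rightarrow> ('k, 'v) tensor set) set" where
  "HK_diff K V R p X =
     (\<Union>f\<in>X. cohomology_class (koszul_cochains K V R) (koszul_b K V R) (Suc p) (cup_e K V R p f))"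

definition HKhi :: "('k, 'b) ring_scheme \<Rightarrow> ('k, 'v, 'c) module_scheme \<Rightarrow>
    ('k, 'v) tensor set \<Rightarrow> nat \<Rightarrow>
    ('k, (('k, 'v) tensor \<Rightarrow> ('k, 'v) tensor set) set set) module" where
  "HKhi K V R = cohomology (HK K V R) (HK_diff K V R)"

definition HKhi_part :: "('k, 'b) ring_scheme \<Rightarrow> ('k, 'v, 'c) module_scheme \<Rightarrow>
    ('k, 'v) tensor set \<Rightarrow> nat \<Rightarrow> nat \<Rightarrow>
    ('k, (('k, 'v) tensor \<Rightarrow> ('k, 'v) tensor set) set set) module" where
  "HKhi_part K V R p m =
     cohomology_part (HK K V R) (HK_diff K V R) p (carrier (HK_part K V R p m))"

section \<open>Subspaces of \<open>Hom(V, _)\<close>\<close>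

definition scalar_maps ::
  "('k, 'b) ring_scheme \<Rightarrow> ('k, 'v, 'c) module_scheme \<Rightarrow> ('v \<Rightarrow> 'v) set" where
  "scalar_maps K V = {c \<odot>\<^bsub>Hom_module K V V\<^esub> (\<lambda>v\<in>carrier V. v) | c. c \<in> carrier K}"

text \<open>The maps \<open>v \<mapsto> a v - v a\<close> with \<open>a \<in> V\<^sup>\<otimes>\<^sup>n\<close>; they take values in \<open>V\<^sup>\<otimes>\<^sup>n\<^sup>+\<^sup>1\<close>.\<close>
definition commutator_maps :: "('k, 'b) ring_scheme \<Rightarrow> ('k, 'v, 'c) module_scheme \<Rightarrow> nat \<Rightarrow>
    ('v \<Rightarrow> ('k, 'v) tensor) set" where
  "commutator_maps K V n = {(\<lambda>v\<in>carrier V.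
      a \<otimes>\<^bsub>tensor_algebra K V\<^esub> pure_tensor K V [v]
      \<ominus>\<^bsub>tensor_algebra K V\<^esub> pure_tensor K V [v] \<otimes>\<^bsub>tensor_algebra K V\<^esub> a) | a.
      a \<in> tensor_power K V n}"

end

theory Submission
  imports Defs
begin

text \<open>A basis \<open>B\<close> of \<open>V\<close> identifies \<open>T(V)\<close> with the free algebra on \<open>B\<close>, in which everything is read
  off from coefficients of words. Since \<open>R = 0\<close>, the spaces \<open>W\<^sub>p\<close> vanish for \<open>p \<ge> 2\<close>, so \<open>HK\<^sup>0\<close> is the
  centre of \<open>T(V)\<close> and \<open>HK\<^sup>1\<close> is \<open>Hom(V, T(V))\<close> modulo the inner derivations \<open>v \<mapsto> a v - v a\<close>. If \<open>h\<close>
  is central and \<open>w\<close> is a nonempty word, take a letter \<open>b\<close> other than the first letter of \<open>w\<close>: comparing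
  the coefficients of \<open>w b\<close> in \<open>h b = b h\<close> gives \<open>h(w) = 0\<close>. So for \<open>dim V \<ge> 2\<close> the centre is \<open>k\<close>, and the
  differential sends \<open>c\<close> to the class of \<open>c e\<^sub>A\<close>. It is injective because an inner derivation has no
  component of weight 1, and taking the component of weight \<open>m\<close> of \<open>f = c e\<^sub>A + [a, -]\<close> gives
  the cohomology in each weight.\<close>

section \<open>Quotient modules and modules of linear maps\<close>

text \<open>Three layers of quotients hide the words: \<open>tensor_algebra\<close> is a quotient of
  the free algebra on all vectors, \<open>A\<close> is its quotient by the zero ideal, and higher
  classes are cosets of cosets of cochains. Linear bijections remove the first two layers; for the
  last, \<open>Q_zero_iff\<close> says when a cochain of degree 1 becomes zero. A second obstacle is
  that the differentials use maps given by definite description on \<open>W p\<close> tensored with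
  \<open>V\<close>. Nothing is known of them until a unique linear extension has been produced;
  stripping a last or first letter recovers the factors from which it is built. The weights separate
  because multiplication by a vector raises degree by one: the weight n + 1 part of [a, -] is
  [a_n, -], with a_n the degree n part of a. So weight 0 receives no boundary. In weight 1 the part
  a_0 is a scalar and its commutator vanishes, which leaves the multiples of e_A. From weight 2 on,
  only commutators with tensors of degree m - 1 remain.\<close>

lemma (in abelian_group) minus_eq_zero_iff:
  "x \<in> carrier G \<Longrightarrow> y \<in> carrier G \<Longrightarrow> x \<ominus> y = \<zero> \<longleftrightarrow> x = y"
  by (metis a_minus_def add.inv_closed add.inv_equality minus_minus r_neg)

text \<open>Joins the module vocabulary to the theory of additive cosets, so that
  \<open>quot_module M N\<close>, which is built from raw coset operations, can be shown to be a
  module.\<close>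

locale module_submodule = M: module K M + S: submodule K N M
  for K :: "('k, 'b) ring_scheme" and M :: "('k, 'a, 'm) module_scheme" (structure) and N
begin

lemma minus_closed: "x \<in> N \<Longrightarrow> \<ominus> x \<in> N"
  using S.smult_closed[of "\<ominus>\<^bsub>K\<^esub> \<one>\<^bsub>K\<^esub>" x] S.subset M.smult_minus_1_back[of x] by auto

lemma abelian_subgroup: "abelian_subgroup N M"
proof -
  have "subgroup N (add_monoid M)"
    by (rule M.add.subgroupI) (use S.subset S.zero_closed minus_closed in blast)+
  then show ?thesis
    by (intro abelian_subgroupI3 additive_subgroupI) (simp_all add: M.abelian_group_axioms)
qed

sublocale abelian_subgroup N M by (rule abelian_subgroup)

lemma coset_add: "x \<in> carrier M \<Longrightarrow> y \<in> carrier M \<Longrightarrow> set_add M (N +> x) (N +> y) = N +> (x \<oplus> y)"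
  by (rule a_rcos_sum)

lemma coset_eq_iff:
  assumes "x \<in> carrier M" "y \<in> carrier M"
  shows "N +> x = N +> y \<longleftrightarrow> x \<ominus> y \<in> N"
proof -
  have "N +> x = N +> y \<longleftrightarrow> x \<in> N +> y"
    using assms a_repr_independence' a_rcos_self M.a_repr_independence a_subgroup by metis
  also have "\<dots> \<longleftrightarrow> x \<ominus> y \<in> N"
    using a_rcos_module_rev a_rcos_module_imp assms by (metis a_minus_def a_rcos_module)
  finally show ?thesis .
qed

lemma coset_eq_self_iff:
  assumes "x \<in> carrier M"
  shows "N +> x = N \<longleftrightarrow> x \<in> N"
proof -
  have "N +> \<zero> = N" by (rule M.a_coset_add_zero) (rule S.subset)
  moreover have "x \<ominus> \<zero> = x"
    using assms M.zero_closed M.l_zero M.r_neg M.r_zero M.a_inv_closed by (metis M.minus_eq)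
  ultimately show ?thesis using coset_eq_iff[of x \<zero>] assms by simp
qed

text \<open>The left side is the scalar action of \<open>quot_module\<close>, a union over all
  representatives. Changing \<open>x\<close> by an element of \<open>N\<close> changes
  \<open>c \<odot> x\<close> by an element of \<open>N\<close>, so the united cosets coincide; the
  coset is nonempty, so the union is not empty.\<close>

lemma coset_smult:
  assumes "c \<in> carrier K" "x \<in> carrier M"
  shows "(\<Union>z\<in>N +> x. N +> (c \<odot> z)) = N +> (c \<odot> x)"
proof -
  have "N +> (c \<odot> z) = N +> (c \<odot> x)" if z: "z \<in> N +> x" for z
  proof -
    obtain n where n: "n \<in> N" "z = n \<oplus> x" using z by (auto simp: a_r_coset_def')
    then have "c \<odot> z = c \<odot> n \<oplus> c \<odot> x" "n \<in> carrier M"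
      using assms S.subset by (auto simp: M.smult_r_distr)
    then have "c \<odot> z \<ominus> c \<odot> x = c \<odot> n" "z \<in> carrier M"
      using assms n by (simp_all add: a_minus_def M.add.m_assoc M.r_neg)
    then show ?thesis using assms n coset_eq_iff by simp
  qed
  moreover have "N +> x \<noteq> {}" using a_rcos_self assms by blast
  ultimately show ?thesis by simp
qed

lemma quot_module_add:
  "x \<in> carrier M \<Longrightarrow> y \<in> carrier M \<Longrightarrow> (N +> x) \<oplus>\<^bsub>quot_module M N\<^esub> (N +> y) = N +> (x \<oplus> y)"
  by (simp add: quot_module_def coset_add)

lemma quot_module_smult:
  "c \<in> carrier K \<Longrightarrow> x \<in> carrier M \<Longrightarrow> c \<odot>\<^bsub>quot_module M N\<^esub> (N +> x) = N +> (c \<odot> x)"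
  by (simp add: quot_module_def coset_smult)

lemma quot_module_carrier: "carrier (quot_module M N) = (+>) N ` carrier M"
  by (auto simp: quot_module_def A_RCOSETS_def')

lemma quot_module_zero: "\<zero>\<^bsub>quot_module M N\<^esub> = N"
  by (simp add: quot_module_def)

lemma quot_module_module: "module K (quot_module M N)"
proof (rule module_criteria)
  have z: "N +> \<zero> = N"
    by (rule M.a_coset_add_zero) (rule S.subset)
  have N: "N \<in> carrier (quot_module M N)"
    unfolding quot_module_carrier using z M.zero_closed by blast
  show "cring K" by (rule M.R.cring_axioms)
  show "\<zero>\<^bsub>quot_module M N\<^esub> \<in> carrier (quot_module M N)"
    using N by (simp add: quot_module_zero)
  show "\<forall>v\<in>carrier (quot_module M N). v \<oplus>\<^bsub>quot_module M N\<^esub> \<zero>\<^bsub>quot_module M N\<^esub> = v"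
    using quot_module_add[of _ \<zero>] by (auto simp: quot_module_carrier quot_module_zero z)
  show "\<forall>v\<in>carrier (quot_module M N). \<exists>w\<in>carrier (quot_module M N).
      v \<oplus>\<^bsub>quot_module M N\<^esub> w = \<zero>\<^bsub>quot_module M N\<^esub>"
    unfolding quot_module_zero
  proof
    fix v assume "v \<in> carrier (quot_module M N)"
    then obtain x where x: "v = N +> x" "x \<in> carrier M" by (auto simp: quot_module_carrier)
    then have "v \<oplus>\<^bsub>quot_module M N\<^esub> (N +> (\<ominus> x)) = N"
      by (simp add: quot_module_add M.r_neg z)
    then show "\<exists>w\<in>carrier (quot_module M N). v \<oplus>\<^bsub>quot_module M N\<^esub> w = N"
      using x by (intro bexI[of _ "N +> (\<ominus> x)"]) (auto simp: quot_module_carrier)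
  qed
qed (auto simp: quot_module_carrier quot_module_add quot_module_smult
      M.add.m_ac M.smult_l_distr M.smult_r_distr M.smult_assoc1)

lemma coset_mod_hom: "mod_hom K M (quot_module M N) ((+>) N)"
  using M.module_axioms quot_module_module
  by (auto intro!: mod_hom.intro mod_hom_axioms.intro
      simp: module_hom_def quot_module_add quot_module_smult quot_module_carrier)

end

text \<open>In \<open>cohomology\<close> the carrier is cut down to the cocycles before the quotient
  is formed. The coset operations see only the addition and scalar action of \<open>M\<close>, so
  restriction and quotient commute.\<close>

lemma quot_module_carrier_update:
  "quot_module (M\<lparr>carrier := S\<rparr>) N = (quot_module M N)\<lparr>carrier := (+>\<^bsub>M\<^esub>) N ` S\<rparr>"
  by (auto simp: quot_module_def A_RCOSETS_def' rcoset_mult_def a_r_coset_def' set_add_def'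
      fun_eq_iff)

section \<open>Modules of linear maps and inverses of linear bijections\<close>

lemma Hom_module_module:
  assumes "module K M" "module K N"
  shows "module K (Hom_module K M N)"
proof -
  interpret M: module K M by fact
  interpret N: module K N by fact
  note defs = Hom_module_def module_hom_def Pi_iff
  show ?thesis
  proof (rule module_criteria)
    show "cring K" by (rule M.R.cring_axioms)
    show "\<forall>f\<in>carrier (Hom_module K M N). \<exists>g\<in>carrier (Hom_module K M N).
        f \<oplus>\<^bsub>Hom_module K M N\<^esub> g = \<zero>\<^bsub>Hom_module K M N\<^esub>"
    proof
      fix f assume f: "f \<in> carrier (Hom_module K M N)"
      let ?g = "\<lambda>x\<in>carrier M. \<ominus>\<^bsub>N\<^esub> f x"
      have "?g \<in> carrier (Hom_module K M N)"
        using f by (auto simp: defs N.minus_add N.smult_r_minus)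
      moreover have "f \<oplus>\<^bsub>Hom_module K M N\<^esub> ?g = \<zero>\<^bsub>Hom_module K M N\<^esub>"
        using f by (auto simp: defs N.r_neg fun_eq_iff restrict_def)
      ultimately show "\<exists>g\<in>carrier (Hom_module K M N).
          f \<oplus>\<^bsub>Hom_module K M N\<^esub> g = \<zero>\<^bsub>Hom_module K M N\<^esub>"
        by blast
    qed
    show "\<forall>f g. f \<in> carrier (Hom_module K M N) \<and> g \<in> carrier (Hom_module K M N) \<longrightarrow>
        f \<oplus>\<^bsub>Hom_module K M N\<^esub> g \<in> carrier (Hom_module K M N)"
      by (auto simp: defs N.smult_r_distr N.add.m_ac)
    show "\<forall>c f. c \<in> carrier K \<and> f \<in> carrier (Hom_module K M N) \<longrightarrow>
        c \<odot>\<^bsub>Hom_module K M N\<^esub> f \<in> carrier (Hom_module K M N)"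
      by (auto simp: defs N.smult_r_distr M.R.m_comm simp flip: N.smult_assoc1)
  qed (auto simp: defs N.add.m_ac N.smult_l_distr N.smult_r_distr N.smult_assoc1
      fun_eq_iff restrict_def extensional_def)
qed

text \<open>All laws for the inverse are pulled back along \<open>f\<close>, so \<open>N\<close> may
  be a bare record, for instance a subspace given by a carrier update.\<close>

lemma module_hom_the_inv_into:
  assumes M: "module K M" and f: "f \<in> module_hom K M N" and bij: "bij_betw f (carrier M) (carrier N)"
  shows "the_inv_into (carrier M) f \<in> module_hom K N M"
proof -
  interpret M: module K M by fact
  have inj: "inj_on f (carrier M)" and im: "carrier N = f ` carrier M"
    using bij by (simp_all add: bij_betw_def)
  note inv = the_inv_into_f_f[OF inj]
  let ?g = "the_inv_into (carrier M) f"
  have "?g (y \<oplus>\<^bsub>N\<^esub> y') = ?g y \<oplus>\<^bsub>M\<^esub> ?g y'" if y: "y \<in> f ` carrier M" "y' \<in> f ` carrier M" for y y'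
  proof -
    obtain x x' where "y = f x" "x \<in> carrier M" "y' = f x'" "x' \<in> carrier M" using y by (elim imageE)
    then show ?thesis using inv[of "x \<oplus>\<^bsub>M\<^esub> x'"] module_hom_add[OF f, of x x'] by (simp add: inv)
  qed
  moreover have "?g (c \<odot>\<^bsub>N\<^esub> y) = c \<odot>\<^bsub>M\<^esub> ?g y" if y: "y \<in> f ` carrier M" "c \<in> carrier K" for y c
  proof -
    obtain x where "y = f x" "x \<in> carrier M" using y(1) by (rule imageE)
    then show ?thesis using inv[of "c \<odot>\<^bsub>M\<^esub> x"] module_hom_smult[OF f, of c x] y by (simp add: inv)
  qed
  moreover have "?g y \<in> carrier M" if y: "y \<in> f ` carrier M" for y
    using the_inv_into_into[OF inj y] by blast
  ultimately show ?thesis by (simp add: module_hom_def im)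
qed

section \<open>The first isomorphism theorem\<close>

context mod_hom
begin

lemma module_submodule_ker: "module_submodule R M {x \<in> carrier M. f x = \<zero>\<^bsub>N\<^esub>}"
  using ker_is_submodule M.module_axioms by (simp add: module_submodule_def ker_def)

lemma eq_iff_diff_ker:
  assumes "x \<in> carrier M" "y \<in> carrier M"
  shows "f x = f y \<longleftrightarrow> f (x \<ominus>\<^bsub>M\<^esub> y) = \<zero>\<^bsub>N\<^esub>"
  using assms abelian_group.minus_eq_zero_iff[OF N.M.abelian_group_axioms] by simp

text \<open>Stated from the image to the quotient because a weight component of the higher
  cohomology will appear as the image of a space of linear maps, and \<open>lin_iso\<close> has to
  start there. The isomorphism sends a value to the coset of any of its preimages.\<close>

theorem lin_iso_image_quot_ker:
  "lin_iso R (N\<lparr>carrier := f ` carrier M\<rparr>) (quot_module M {x \<in> carrier M. f x = \<zero>\<^bsub>N\<^esub>})"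
proof -
  define Z where "Z = {x \<in> carrier M. f x = \<zero>\<^bsub>N\<^esub>}"
  interpret Z: module_submodule R M Z unfolding Z_def by (rule module_submodule_ker)
  define g where "g p = Z +>\<^bsub>M\<^esub> (SOME x. x \<in> carrier M \<and> f x = p)" for p
  have g: "g (f x) = Z +>\<^bsub>M\<^esub> x" if x: "x \<in> carrier M" for x
  proof -
    \<comment> \<open>The chosen preimage \<open>y\<close> of \<open>f x\<close> need not be
      \<open>x\<close>, but the two differ by an element of the kernel.\<close>
    define y where "y = (SOME y. y \<in> carrier M \<and> f y = f x)"
    have y: "y \<in> carrier M \<and> f y = f x" unfolding y_def by (rule someI) (use x in blast)
    then have "y \<ominus>\<^bsub>M\<^esub> x \<in> Z"
      using x iffD1[OF eq_iff_diff_ker, of y x] M.M.minus_closed[of y x] unfolding Z_def by blast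
    then have "Z +>\<^bsub>M\<^esub> y = Z +>\<^bsub>M\<^esub> x"
      using x y by (intro iffD2[OF Z.coset_eq_iff]) blast+
    then show ?thesis by (simp only: g_def y_def)
  qed
  have "g \<in> module_hom R (N\<lparr>carrier := f ` carrier M\<rparr>) (quot_module M Z)"
  proof -
    have "g p \<oplus>\<^bsub>quot_module M Z\<^esub> g p' = g (p \<oplus>\<^bsub>N\<^esub> p')"
      if p: "p \<in> f ` carrier M" "p' \<in> f ` carrier M" for p p'
    proof -
      obtain x x' where "p = f x" "x \<in> carrier M" "p' = f x'" "x' \<in> carrier M"
        using p by (elim imageE)
      then show ?thesis using g[of "x \<oplus>\<^bsub>M\<^esub> x'"] by (simp add: g Z.quot_module_add)
    qed
    moreover have "c \<odot>\<^bsub>quot_module M Z\<^esub> g p = g (c \<odot>\<^bsub>N\<^esub> p)"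
      if p: "p \<in> f ` carrier M" "c \<in> carrier R" for p c
    proof -
      obtain x where "p = f x" "x \<in> carrier M" using p(1) by (rule imageE)
      then show ?thesis using g[of "c \<odot>\<^bsub>M\<^esub> x"] p by (simp add: g Z.quot_module_smult)
    qed
    moreover have "g p \<in> carrier (quot_module M Z)" if "p \<in> f ` carrier M" for p
      using that g by (force simp: Z.quot_module_carrier)
    ultimately show ?thesis by (simp add: module_hom_def)
  qed
  moreover have "bij_betw g (f ` carrier M) (carrier (quot_module M Z))"
    unfolding bij_betw_def
  proof
    have "f x = f y" if "x \<in> carrier M" "y \<in> carrier M" "g (f x) = g (f y)" for x y
    proof (rule iffD2[OF eq_iff_diff_ker])
      have "x \<ominus>\<^bsub>M\<^esub> y \<in> Z"
        using that by (intro iffD1[OF Z.coset_eq_iff]) (simp_all only: g)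
      then show "f (x \<ominus>\<^bsub>M\<^esub> y) = \<zero>\<^bsub>N\<^esub>" by (simp only: Z_def mem_Collect_eq)
    qed (use that in auto)
    then show "inj_on g (f ` carrier M)" by (auto simp: inj_on_def)
    show "g ` f ` carrier M = carrier (quot_module M Z)"
      by (simp add: image_image g Z.quot_module_carrier)
  qed
  ultimately show ?thesis unfolding Z_def lin_iso_def by auto
qed

text \<open>The case of zero kernel, with \<open>M\<close> itself as target instead of a quotient by
  zero; weight 0 needs this form.\<close>

lemma lin_iso_image:
  assumes "{x \<in> carrier M. f x = \<zero>\<^bsub>N\<^esub>} = {\<zero>\<^bsub>M\<^esub>}"
  shows "lin_iso R (N\<lparr>carrier := f ` carrier M\<rparr>) M"
proof -
  have inj: "inj_on f (carrier M)"
  proof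
    fix x y assume xy: "x \<in> carrier M" "y \<in> carrier M" "f x = f y"
    then have "x \<ominus>\<^bsub>M\<^esub> y \<in> {x \<in> carrier M. f x = \<zero>\<^bsub>N\<^esub>}"
      using iffD1[OF eq_iff_diff_ker, of x y] M.M.minus_closed[of x y] by blast
    then have "x \<ominus>\<^bsub>M\<^esub> y = \<zero>\<^bsub>M\<^esub>" unfolding assms by simp
    then show "x = y" using xy abelian_group.minus_eq_zero_iff[OF M.M.abelian_group_axioms] by blast
  qed
  have "the_inv_into (carrier M) f \<in> module_hom R (N\<lparr>carrier := f ` carrier M\<rparr>) M"
    by (rule module_hom_the_inv_into[OF M.module_axioms])
      (use f_hom inj in \<open>auto simp: module_hom_def bij_betw_def simp del: f_add f_smult\<close>)
  moreover have "bij_betw (the_inv_into (carrier M) f) (f ` carrier M) (carrier M)"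
    using inj by (simp add: bij_betw_the_inv_into inj_on_imp_bij_betw)
  ultimately show ?thesis by (auto simp: lin_iso_def)
qed

end

section \<open>Free algebras\<close>

text \<open>Without commutativity the two compatibility laws for scalars are independent, so both
  are required.\<close>

locale assoc_algebra = ring A + scal: module K A
  for K :: "('k, 'b) ring_scheme" and A :: "('k, 'a, 'm) module_scheme" (structure) +
  assumes smult_mult_left: "c \<in> carrier K \<Longrightarrow> x \<in> carrier A \<Longrightarrow> y \<in> carrier A \<Longrightarrow>
      (c \<odot> x) \<otimes> y = c \<odot> (x \<otimes> y)"
    and smult_mult_right: "c \<in> carrier K \<Longrightarrow> x \<in> carrier A \<Longrightarrow> y \<in> carrier A \<Longrightarrow>
      x \<otimes> (c \<odot> y) = c \<odot> (x \<otimes> y)"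

lemma free_algebra_simps:
  "carrier (free_algebra K X) = {f. (\<forall>w. f w \<in> carrier K) \<and> finite {w. f w \<noteq> \<zero>\<^bsub>K\<^esub>} \<and>
                  {w. f w \<noteq> \<zero>\<^bsub>K\<^esub>} \<subseteq> lists X}"
  "\<one>\<^bsub>free_algebra K X\<^esub> = word K []"
  "\<zero>\<^bsub>free_algebra K X\<^esub> = (\<lambda>w. \<zero>\<^bsub>K\<^esub>)"
  "f \<oplus>\<^bsub>free_algebra K X\<^esub> g = (\<lambda>w. f w \<oplus>\<^bsub>K\<^esub> g w)"
  "c \<odot>\<^bsub>free_algebra K X\<^esub> f = (\<lambda>w. c \<otimes>\<^bsub>K\<^esub> f w)"
  by (simp_all add: free_algebra_def)

text \<open>The alphabet enters only through the carrier, so every product can be computed over the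
  alphabet \<open>UNIV\<close>.\<close>

lemma free_algebra_mult_eq: "mult (free_algebra K X) = mult (free_algebra K Y)"
  by (simp add: free_algebra_def)

text \<open>The product formula makes sense for functions of arbitrary support; splitting off the first
  letter of a word turns the ring axioms into inductions on words.\<close>

context cring
begin

abbreviation conv :: "('x list \<Rightarrow> 'a) \<Rightarrow> ('x list \<Rightarrow> 'a) \<Rightarrow> 'x list \<Rightarrow> 'a" (infixl \<open>\<star>\<close> 70)
  where "f \<star> g \<equiv> f \<otimes>\<^bsub>free_algebra R UNIV\<^esub> g"

lemma conv_Nil: "f [] \<in> carrier R \<Longrightarrow> g [] \<in> carrier R \<Longrightarrow> (f \<star> g) [] = f [] \<otimes> g []"
  by (simp add: free_algebra_def)

text \<open>The cut before the first letter gives the first summand; every other cut leaves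
  \<open>x\<close> at the front of the left factor. The left factor therefore changes in the
  recursion, and the inductions below generalize over it.\<close>

lemma conv_Cons:
  assumes "\<And>w. f w \<in> carrier R" "\<And>w. g w \<in> carrier R"
  shows "(f \<star> g) (x # w) = f [] \<otimes> g (x # w) \<oplus> ((\<lambda>u. f (x # u)) \<star> g) w"
  using assms finsum_Suc2[of "\<lambda>i. f (take i (x # w)) \<otimes> g (drop i (x # w))" "length w"]
  by (simp add: free_algebra_def a_comm)

lemma conv_closed:
  assumes "\<And>w. f w \<in> carrier R" "\<And>w. g w \<in> carrier R"
  shows "(f \<star> g) w \<in> carrier R"
  using assms by (auto simp: free_algebra_def)

lemma conv_add_left:
  assumes "\<And>w. f w \<in> carrier R" "\<And>w. f' w \<in> carrier R" "\<And>w. g w \<in> carrier R"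
  shows "((\<lambda>u. f u \<oplus> f' u) \<star> g) w = (f \<star> g) w \<oplus> (f' \<star> g) w"
  using assms
  by (induction w arbitrary: f f') (simp_all add: conv_Nil conv_Cons conv_closed l_distr a_ac)

lemma conv_add_right:
  assumes "\<And>w. f w \<in> carrier R" "\<And>w. g w \<in> carrier R" "\<And>w. g' w \<in> carrier R"
  shows "(f \<star> (\<lambda>u. g u \<oplus> g' u)) w = (f \<star> g) w \<oplus> (f \<star> g') w"
  using assms
  by (induction w arbitrary: f) (simp_all add: conv_Nil conv_Cons conv_closed r_distr a_ac)

lemma conv_smult_left:
  assumes "c \<in> carrier R" "\<And>w. f w \<in> carrier R" "\<And>w. g w \<in> carrier R"
  shows "((\<lambda>u. c \<otimes> f u) \<star> g) w = c \<otimes> (f \<star> g) w"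
  using assms
  by (induction w arbitrary: f) (simp_all add: conv_Nil conv_Cons conv_closed r_distr m_assoc)

lemma conv_smult_right:
  assumes "c \<in> carrier R" "\<And>w. f w \<in> carrier R" "\<And>w. g w \<in> carrier R"
  shows "(f \<star> (\<lambda>u. c \<otimes> g u)) w = c \<otimes> (f \<star> g) w"
  using assms
  by (induction w arbitrary: f) (simp_all add: conv_Nil conv_Cons conv_closed r_distr m_lcomm)

lemma zero_conv:
  assumes "\<And>w. g w \<in> carrier R"
  shows "((\<lambda>u. \<zero>) \<star> g) w = \<zero>"
  using assms by (induction w) (simp_all add: conv_Nil conv_Cons)

lemma conv_assoc:
  assumes "\<And>w. f w \<in> carrier R" "\<And>w. g w \<in> carrier R" "\<And>w. h w \<in> carrier R"
  shows "((f \<star> g) \<star> h) w = (f \<star> (g \<star> h)) w"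
  using assms
proof (induction w arbitrary: f g)
  case Nil then show ?case by (simp add: conv_Nil conv_closed m_assoc)
next
  case (Cons x w)
  have "(\<lambda>u. (f \<star> g) (x # u)) = (\<lambda>u. f [] \<otimes> g (x # u) \<oplus> ((\<lambda>u. f (x # u)) \<star> g) u)"
    using Cons.prems by (simp add: conv_Cons)
  moreover have "((\<lambda>u. f [] \<otimes> g (x # u) \<oplus> ((\<lambda>u. f (x # u)) \<star> g) u) \<star> h) w
    = f [] \<otimes> ((\<lambda>u. g (x # u)) \<star> h) w \<oplus> ((\<lambda>u. f (x # u)) \<star> (g \<star> h)) w"
    using Cons.prems
    by (subst conv_add_left) (simp_all add: conv_closed conv_smult_left Cons.IH)
  ultimately show ?case
    using Cons.prems by (simp add: conv_Cons conv_Nil conv_closed r_distr m_assoc a_assoc)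
qed

lemma word_closed: "word R u w \<in> carrier R"
  by (simp add: word_def)

lemma word_Cons: "word R (x # u) (y # w) = (if x = y then word R u w else \<zero>)"
  by (simp add: word_def)

lemma word_Nil_conv:
  assumes "\<And>w. g w \<in> carrier R"
  shows "(word R [] \<star> g) w = g w"
proof (cases w)
  case Nil then show ?thesis using assms by (simp add: conv_Nil word_def)
next
  case (Cons x v)
  have "(\<lambda>u. word R [] (x # u)) = (\<lambda>u. \<zero>)" by (simp add: word_def)
  then show ?thesis using assms Cons by (simp add: conv_Cons zero_conv word_closed) (simp add: word_def)
qed

lemma conv_word_Nil:
  assumes "\<And>w. f w \<in> carrier R"
  shows "(f \<star> word R []) w = f w"
  using assms
  by (induction w arbitrary: f) (simp_all add: conv_Nil conv_Cons word_closed, simp_all add: word_def)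

lemma word_conv_word: "word R u \<star> word R v = word R (u @ v)"
proof
  fix w
  show "(word R u \<star> word R v) w = word R (u @ v) w"
  proof (induction u arbitrary: w)
    case Nil then show ?case by (simp add: word_Nil_conv word_closed)
  next
    case (Cons x u)
    show ?case
    proof (cases w)
      case Nil then show ?thesis by (simp add: conv_Nil word_closed) (simp add: word_def)
    next
      case w: (Cons y t)
      have "word R (x # u) [] = \<zero>" by (simp add: word_def)
      then show ?thesis using w Cons.IH[of t]
        by (simp add: conv_Cons word_closed word_Cons zero_conv)
    qed
  qed
qed

lemma letter_conv:
  assumes "\<And>w. f w \<in> carrier R"
  shows "(word R [b] \<star> f) w = (case w of [] \<Rightarrow> \<zero> | x # u \<Rightarrow> if x = b then f u else \<zero>)"
proof (cases w)
  case Nil then show ?thesis using assms by (simp add: conv_Nil word_closed) (simp add: word_def)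
next
  case (Cons x u)
  have "word R [b] [] = \<zero>" by (simp add: word_def)
  then show ?thesis using Cons assms
    by (simp add: conv_Cons word_closed word_Cons zero_conv word_Nil_conv)
qed

lemma conv_letter:
  assumes "\<And>w. f w \<in> carrier R"
  shows "(f \<star> word R [b]) w = (if w \<noteq> [] \<and> last w = b then f (butlast w) else \<zero>)"
  using assms
proof (induction w arbitrary: f)
  case Nil then show ?case by (simp add: conv_Nil word_closed) (simp add: word_def)
next
  case (Cons x w)
  \<comment> \<open>The recursion peels letters from the front, while \<open>b\<close> sits at the
    end: the first summand of \<open>conv_Cons\<close> contributes only when \<open>w\<close> is
    empty.\<close>
  have "word R [b] (x # w) = (if x = b \<and> w = [] then \<one> else \<zero>)" by (simp add: word_def)
  then show ?case using Cons by (simp add: conv_Cons word_closed)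
qed

text \<open>A nonzero sum has a nonzero summand, and a nonzero product has nonzero factors. This
  gives both the finite support of a product and the additivity of degrees.\<close>

lemma conv_support:
  assumes "\<And>w. f w \<in> carrier R" "\<And>w. g w \<in> carrier R" "(f \<star> g) w \<noteq> \<zero>"
  shows "\<exists>u v. w = u @ v \<and> f u \<noteq> \<zero> \<and> g v \<noteq> \<zero>"
  using assms
proof (induction w arbitrary: f)
  case Nil then show ?case by (force simp: conv_Nil)
next
  case (Cons x w)
  then have "f [] \<otimes> g (x # w) \<noteq> \<zero> \<or> ((\<lambda>u. f (x # u)) \<star> g) w \<noteq> \<zero>"
    by (auto simp: conv_Cons)
  then show ?case
  proof
    assume "f [] \<otimes> g (x # w) \<noteq> \<zero>"
    then have "f [] \<noteq> \<zero>" "g (x # w) \<noteq> \<zero>" using Cons.prems by auto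
    then show ?thesis by force
  next
    assume "((\<lambda>u. f (x # u)) \<star> g) w \<noteq> \<zero>"
    then obtain u v where "w = u @ v" "f (x # u) \<noteq> \<zero>" "g v \<noteq> \<zero>"
      using Cons.IH[of "\<lambda>u. f (x # u)"] Cons.prems(1,2) by blast
    then have "x # w = (x # u) @ v \<and> f (x # u) \<noteq> \<zero> \<and> g v \<noteq> \<zero>" by simp
    then show ?thesis by blast
  qed
qed

lemma free_algebra_carrierD:
  "f \<in> carrier (free_algebra R X) \<Longrightarrow> f w \<in> carrier R"
  "f \<in> carrier (free_algebra R X) \<Longrightarrow> finite {w. f w \<noteq> \<zero>}"
  "f \<in> carrier (free_algebra R X) \<Longrightarrow> f w \<noteq> \<zero> \<Longrightarrow> w \<in> lists X"
  by (auto simp: free_algebra_simps)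

lemma free_algebra_mult: "(\<otimes>\<^bsub>free_algebra R X\<^esub>) = (\<star>)"
  by (rule free_algebra_mult_eq)

lemma free_algebra_add_closed:
  assumes "f \<in> carrier (free_algebra R X)" "g \<in> carrier (free_algebra R X)"
  shows "(\<lambda>w. f w \<oplus> g w) \<in> carrier (free_algebra R X)"
proof -
  have "{w. f w \<oplus> g w \<noteq> \<zero>} \<subseteq> {w. f w \<noteq> \<zero>} \<union> {w. g w \<noteq> \<zero>}" using assms by auto
  moreover have "finite ({w. f w \<noteq> \<zero>} \<union> {w. g w \<noteq> \<zero>})"
    and "{w. f w \<noteq> \<zero>} \<union> {w. g w \<noteq> \<zero>} \<subseteq> lists X"
    using assms by (simp_all add: free_algebra_simps)
  ultimately have "finite {w. f w \<oplus> g w \<noteq> \<zero>}" "{w. f w \<oplus> g w \<noteq> \<zero>} \<subseteq> lists X"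
    by (blast intro: finite_subset)+
  then show ?thesis using assms by (simp add: free_algebra_simps)
qed

lemma free_algebra_smult_closed:
  assumes "c \<in> carrier R" "f \<in> carrier (free_algebra R X)"
  shows "(\<lambda>w. c \<otimes> f w) \<in> carrier (free_algebra R X)"
proof -
  have "{w. c \<otimes> f w \<noteq> \<zero>} \<subseteq> {w. f w \<noteq> \<zero>}" using assms by auto
  then show ?thesis using assms by (auto simp: free_algebra_simps intro: finite_subset)
qed

lemma free_algebra_conv_closed:
  assumes f: "f \<in> carrier (free_algebra R X)" and g: "g \<in> carrier (free_algebra R X)"
  shows "f \<star> g \<in> carrier (free_algebra R X)"
proof -
  have sub: "{w. (f \<star> g) w \<noteq> \<zero>} \<subseteq> (\<lambda>(u, v). u @ v) ` ({w. f w \<noteq> \<zero>} \<times> {w. g w \<noteq> \<zero>})"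
    using conv_support[of f g] free_algebra_carrierD(1)[OF f] free_algebra_carrierD(1)[OF g]
    by fastforce
  then have "finite {w. (f \<star> g) w \<noteq> \<zero>}"
    using free_algebra_carrierD(2)[OF f] free_algebra_carrierD(2)[OF g]
    by (meson finite_SigmaI finite_imageI finite_subset)
  moreover have "{w. (f \<star> g) w \<noteq> \<zero>} \<subseteq> lists X"
    using sub free_algebra_carrierD(3)[OF f] free_algebra_carrierD(3)[OF g] by fastforce
  ultimately show ?thesis
    using conv_closed[of f g] free_algebra_carrierD(1)[OF f] free_algebra_carrierD(1)[OF g]
    by (subst free_algebra_simps) blast
qed

lemma word_mem: "u \<in> lists X \<Longrightarrow> word R u \<in> carrier (free_algebra R X)"
  by (auto simp: free_algebra_simps word_def)

lemma free_algebra_assoc_algebra: "assoc_algebra R (free_algebra R X)"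
proof -
  let ?F = "free_algebra R X"
  note C = free_algebra_carrierD(1)[of _ X]
  have m: "module R ?F"
  proof (rule module_criteria)
    show "\<forall>v\<in>carrier ?F. \<exists>w\<in>carrier ?F. v \<oplus>\<^bsub>?F\<^esub> w = \<zero>\<^bsub>?F\<^esub>"
    proof
      fix f assume f: "f \<in> carrier ?F"
      have "{w. \<ominus> f w \<noteq> \<zero>} \<subseteq> {w. f w \<noteq> \<zero>}" using C[OF f] by (auto simp: minus_zero)
      then have "(\<lambda>w. \<ominus> f w) \<in> carrier ?F"
        using f by (auto simp: free_algebra_simps intro: finite_subset)
      moreover have "f \<oplus>\<^bsub>?F\<^esub> (\<lambda>w. \<ominus> f w) = \<zero>\<^bsub>?F\<^esub>"
        using C[OF f] by (simp add: free_algebra_simps r_neg)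
      ultimately show "\<exists>w\<in>carrier ?F. f \<oplus>\<^bsub>?F\<^esub> w = \<zero>\<^bsub>?F\<^esub>" by blast
    qed
    show "\<zero>\<^bsub>?F\<^esub> \<in> carrier ?F" by (simp add: free_algebra_simps)
  next
    show "cring R" by (rule is_cring)
  qed (simp_all add: free_algebra_simps(3-5) C free_algebra_add_closed free_algebra_smult_closed
      l_distr r_distr m_assoc a_ac)
  interpret m: module R ?F by (rule m)
  have "ring ?F"
  proof (rule ringI)
    show "abelian_group ?F" by (rule m.M.abelian_group_axioms)
    show "monoid ?F"
      by (rule monoidI)
        (auto simp: free_algebra_mult[of X] free_algebra_conv_closed free_algebra_simps(2) word_mem
          fun_eq_iff C conv_assoc word_Nil_conv conv_word_Nil)
  qed (auto simp: free_algebra_mult[of X] free_algebra_simps(4) C conv_add_left conv_add_right fun_eq_iff)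
  then show ?thesis using m
    by (auto intro!: assoc_algebra.intro assoc_algebra_axioms.intro
        simp: free_algebra_mult[of X] free_algebra_simps(5) C conv_smult_left conv_smult_right fun_eq_iff)
qed

text \<open>Induction on the finite support: one word is erased by setting its coefficient to zero,
  and is then added back with that coefficient.\<close>

lemma free_algebra_induct [consumes 1, case_names zero add_word]:
  assumes "f \<in> carrier (free_algebra R X)"
    and zero: "P (\<lambda>w. \<zero>)"
    and step: "\<And>f c u. f \<in> carrier (free_algebra R X) \<Longrightarrow> P f \<Longrightarrow> c \<in> carrier R \<Longrightarrow> u \<in> lists X \<Longrightarrow>
      P (\<lambda>w. f w \<oplus> c \<otimes> word R u w)"
  shows "P f"
proof -
  have "P f" if "finite S" "f \<in> carrier (free_algebra R X)" "{w. f w \<noteq> \<zero>} = S" for S f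
    using that
  proof (induction S arbitrary: f)
    case empty
    then have "f = (\<lambda>w. \<zero>)" by auto
    then show ?case using zero by simp
  next
    case (insert u S)
    let ?g = "\<lambda>w. if w = u then \<zero> else f w"
    have "{w. ?g w \<noteq> \<zero>} = S" using insert by auto
    moreover have g: "?g \<in> carrier (free_algebra R X)"
      using insert.prems(1) by (auto simp: free_algebra_simps elim: rev_finite_subset)
    ultimately have "P ?g" using insert.IH by blast
    moreover have "u \<in> lists X" "f u \<in> carrier R"
      using insert.prems by (auto simp: free_algebra_simps)
    ultimately have "P (\<lambda>w. ?g w \<oplus> f u \<otimes> word R u w)" using g step by blast
    moreover have "(\<lambda>w. ?g w \<oplus> f u \<otimes> word R u w) = f"
      using insert.prems(1) by (auto simp: fun_eq_iff word_def free_algebra_simps)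
    ultimately show ?case by simp
  qed
  then show ?thesis using assms(1) free_algebra_carrierD(2) by blast
qed

end

section \<open>Linear maps out of a free algebra\<close>

definition lin_ext :: "('k, 'b) ring_scheme \<Rightarrow> ('k, 'a, 'm) module_scheme \<Rightarrow> ('x list \<Rightarrow> 'a) \<Rightarrow>
    ('x list \<Rightarrow> 'k) \<Rightarrow> 'a" where
  "lin_ext K M g f = (\<Oplus>\<^bsub>M\<^esub>u\<in>{u. f u \<noteq> \<zero>\<^bsub>K\<^esub>}. f u \<odot>\<^bsub>M\<^esub> g u)"

context module
begin

lemma smult_word_coeff_closed:
  "f \<in> carrier (free_algebra R X) \<Longrightarrow> g \<in> lists X \<rightarrow> carrier M \<Longrightarrow> u \<in> lists X \<Longrightarrow> f u \<odot>\<^bsub>M\<^esub> g u \<in> carrier M"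
  by (blast intro: smult_closed free_algebra_carrierD(1) funcset_mem)

text \<open>Elements with different supports can be compared only after their sums have been
  extended to a common finite index set; the extra summands have coefficient zero.\<close>

lemma lin_ext_superset:
  assumes "f \<in> carrier (free_algebra R X)" "g \<in> lists X \<rightarrow> carrier M"
    and "finite S" "{u. f u \<noteq> \<zero>} \<subseteq> S" "S \<subseteq> lists X"
  shows "lin_ext R M g f = (\<Oplus>\<^bsub>M\<^esub>u\<in>S. f u \<odot>\<^bsub>M\<^esub> g u)"
  unfolding lin_ext_def
proof (intro M.add.finprod_mono_neutral_cong_left)
  show "(\<lambda>u. f u \<odot>\<^bsub>M\<^esub> g u) \<in> S \<rightarrow> carrier M"
    using assms smult_word_coeff_closed[of f X g] by blast
  fix u assume u: "u \<in> S - {u. f u \<noteq> \<zero>}"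
  then have "g u \<in> carrier M" using assms(2,5) by blast
  then show "f u \<odot>\<^bsub>M\<^esub> g u = \<zero>\<^bsub>M\<^esub>" using u by simp
qed (use assms in auto)

lemma lin_ext_hom:
  assumes g: "g \<in> lists X \<rightarrow> carrier M"
  shows "lin_ext R M g \<in> module_hom R (free_algebra R X) M"
proof -
  interpret F: assoc_algebra R "free_algebra R X" by (rule free_algebra_assoc_algebra)
  have "lin_ext R M g f \<in> carrier M" if f: "f \<in> carrier (free_algebra R X)" for f
    unfolding lin_ext_def
    using smult_word_coeff_closed[OF f g] free_algebra_carrierD(3)[OF f] by (intro M.finsum_closed) blast
  moreover have "lin_ext R M g (f \<oplus>\<^bsub>free_algebra R X\<^esub> f') = lin_ext R M g f \<oplus>\<^bsub>M\<^esub> lin_ext R M g f'"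
    if f: "f \<in> carrier (free_algebra R X)" and f': "f' \<in> carrier (free_algebra R X)" for f f'
  proof -
    \<comment> \<open>The support of the sum may be smaller than this union because of cancellation,
      so all three sums are taken over the union.\<close>
    let ?S = "{u. f u \<noteq> \<zero>} \<union> {u. f' u \<noteq> \<zero>}"
    have S: "finite ?S" "?S \<subseteq> lists X" using f f' by (simp_all add: free_algebra_simps)
    have gS: "\<And>u. u \<in> ?S \<Longrightarrow> g u \<in> carrier M" using g S(2) by blast
    have K: "\<And>u. f u \<in> carrier R" "\<And>u. f' u \<in> carrier R"
      using f f' by (simp_all add: free_algebra_simps)
    have sub: "{u. (f \<oplus>\<^bsub>free_algebra R X\<^esub> f') u \<noteq> \<zero>} \<subseteq> ?S"
      using f f' by (auto simp: free_algebra_simps)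
    have "(\<Oplus>\<^bsub>M\<^esub>u\<in>?S. (f \<oplus>\<^bsub>free_algebra R X\<^esub> f') u \<odot>\<^bsub>M\<^esub> g u)
        = (\<Oplus>\<^bsub>M\<^esub>u\<in>?S. f u \<odot>\<^bsub>M\<^esub> g u \<oplus>\<^bsub>M\<^esub> f' u \<odot>\<^bsub>M\<^esub> g u)"
      by (intro M.add.finprod_cong' refl)
        (simp_all add: Pi_iff free_algebra_simps(4) gS[simplified] K smult_l_distr)
    also have "\<dots> = (\<Oplus>\<^bsub>M\<^esub>u\<in>?S. f u \<odot>\<^bsub>M\<^esub> g u) \<oplus>\<^bsub>M\<^esub> (\<Oplus>\<^bsub>M\<^esub>u\<in>?S. f' u \<odot>\<^bsub>M\<^esub> g u)"
      by (intro M.finsum_addf) (simp_all add: Pi_iff gS[simplified] K)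
    finally show ?thesis
      using lin_ext_superset[OF f g S(1) _ S(2)] lin_ext_superset[OF f' g S(1) _ S(2)]
        lin_ext_superset[OF F.a_closed[OF f f'] g S(1) sub S(2)] by simp
  qed
  moreover have "lin_ext R M g (c \<odot>\<^bsub>free_algebra R X\<^esub> f) = c \<odot>\<^bsub>M\<^esub> lin_ext R M g f"
    if c: "c \<in> carrier R" and f: "f \<in> carrier (free_algebra R X)" for c f
  proof -
    let ?S = "{u. f u \<noteq> \<zero>}"
    have S: "finite ?S" "?S \<subseteq> lists X" using f by (simp_all add: free_algebra_simps)
    have gS: "\<And>u. u \<in> ?S \<Longrightarrow> g u \<in> carrier M" using g S(2) by blast
    have K: "\<And>u. f u \<in> carrier R" using f by (simp add: free_algebra_simps)
    have sub: "{u. (c \<odot>\<^bsub>free_algebra R X\<^esub> f) u \<noteq> \<zero>} \<subseteq> ?S"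
      using c f by (auto simp: free_algebra_simps)
    have "(\<Oplus>\<^bsub>M\<^esub>u\<in>?S. (c \<odot>\<^bsub>free_algebra R X\<^esub> f) u \<odot>\<^bsub>M\<^esub> g u)
        = (\<Oplus>\<^bsub>M\<^esub>u\<in>?S. c \<odot>\<^bsub>M\<^esub> (f u \<odot>\<^bsub>M\<^esub> g u))"
      by (intro M.add.finprod_cong' refl)
        (simp_all add: Pi_iff free_algebra_simps(5) gS[simplified] K c smult_assoc1)
    also have "\<dots> = c \<odot>\<^bsub>M\<^esub> (\<Oplus>\<^bsub>M\<^esub>u\<in>?S. f u \<odot>\<^bsub>M\<^esub> g u)"
      by (intro finsum_smult_ldistr[symmetric] S c) (simp add: Pi_iff gS[simplified] K)
    finally show ?thesis
      using lin_ext_superset[OF F.scal.smult_closed[OF c f] g S(1) sub S(2)]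
      by (simp add: lin_ext_def)
  qed
  ultimately show ?thesis by (auto simp: module_hom_def)
qed

lemma lin_ext_word:
  assumes "g \<in> lists X \<rightarrow> carrier M" "u \<in> lists X"
  shows "lin_ext R M g (word R u) = g u"
proof -
  have "lin_ext R M g (word R u) = (\<Oplus>\<^bsub>M\<^esub>v\<in>{u}. word R u v \<odot>\<^bsub>M\<^esub> g v)"
    using assms by (intro lin_ext_superset[of _ X]) (auto simp: word_mem simp del: in_lists_conv_set, auto simp: word_def split: if_splits)
  also have "\<dots> = g u" using assms by (simp add: word_def Pi_iff)
  finally show ?thesis .
qed

text \<open>Words span, so linear identities on a free algebra, including multiplicativity with one
  factor fixed, reduce to words.\<close>

lemma free_algebra_hom_eqI:
  assumes h: "h \<in> module_hom R (free_algebra R X) M" and h': "h' \<in> module_hom R (free_algebra R X) M"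
    and eq: "\<And>u. u \<in> lists X \<Longrightarrow> h (word R u) = h' (word R u)"
    and f: "f \<in> carrier (free_algebra R X)"
  shows "h f = h' f"
proof -
  interpret F: assoc_algebra R "free_algebra R X" by (rule free_algebra_assoc_algebra)
  have z: "h (\<lambda>w. \<zero>) = \<zero>\<^bsub>M\<^esub>" if "h \<in> module_hom R (free_algebra R X) M" for h
    using mod_hom.f0_is_0[of R "free_algebra R X" M h] that module_axioms F.scal.module_axioms
    by (simp add: mod_hom_def mod_hom_axioms_def free_algebra_simps)
  show ?thesis using f
  proof (induction rule: free_algebra_induct)
    case zero show ?case using z[OF h] z[OF h'] by simp
  next
    case (add_word f c u)
    have "k (\<lambda>w. f w \<oplus> c \<otimes> word R u w) = k f \<oplus>\<^bsub>M\<^esub> c \<odot>\<^bsub>M\<^esub> k (word R u)"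
      if k: "k \<in> module_hom R (free_algebra R X) M" for k
      using module_hom_add[OF k, of f "c \<odot>\<^bsub>free_algebra R X\<^esub> word R u"]
        module_hom_smult[OF k, of c "word R u"] add_word word_mem[of u X]
      by (simp add: free_algebra_simps(4,5)) (simp add: free_algebra_smult_closed)
    from this[OF h] this[OF h'] show ?case using add_word eq by simp
  qed
qed

end

section \<open>Tensor algebras\<close>

lemma module_hom_comp:
  "f \<in> module_hom K M N \<Longrightarrow> g \<in> module_hom K N P \<Longrightarrow> (\<lambda>x. g (f x)) \<in> module_hom K M P"
  by (auto simp: module_hom_def Pi_iff)

lemma (in module) span_induct [consumes 2, case_names base zero add smult]:
  assumes S: "S \<subseteq> carrier M" and x: "x \<in> span S"
    and "\<And>x. x \<in> S \<Longrightarrow> P x" "P \<zero>\<^bsub>M\<^esub>"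
    and "\<And>x y. x \<in> span S \<Longrightarrow> y \<in> span S \<Longrightarrow> P x \<Longrightarrow> P y \<Longrightarrow> P (x \<oplus>\<^bsub>M\<^esub> y)"
    and "\<And>c x. c \<in> carrier R \<Longrightarrow> x \<in> span S \<Longrightarrow> P x \<Longrightarrow> P (c \<odot>\<^bsub>M\<^esub> x)"
  shows "P x"
proof -
  interpret s: submodule R "span S" M using S by (rule span_is_submodule)
  have "submodule R {x \<in> span S. P x} M"
    using assms s.subset by (auto intro!: submodule.intro module_axioms)
  then have "span S \<subseteq> {x \<in> span S. P x}"
    using in_own_span[OF S] assms(3) by (intro span_is_subset) auto
  then show ?thesis using x by blast
qed

text \<open>The maps are linear on the span only. This is the situation of \<open>right_mult\<close>
  and \<open>left_mult\<close>, whose domains are subspaces of the tensor algebra.\<close>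

lemma module_hom_eq_on_span:
  assumes M: "module K M" and N: "module K N" and S: "S \<subseteq> carrier M"
    and f: "f \<in> module_hom K (M\<lparr>carrier := module.span K M S\<rparr>) N"
    and g: "g \<in> module_hom K (M\<lparr>carrier := module.span K M S\<rparr>) N"
    and eq: "\<And>x. x \<in> S \<Longrightarrow> f x = g x" and x: "x \<in> module.span K M S"
  shows "f x = g x"
proof -
  interpret M: module K M by fact
  have s: "module K (M\<lparr>carrier := M.span S\<rparr>)"
    using S by (intro M.submodule_is_module M.span_is_submodule)
  have z: "h \<zero>\<^bsub>M\<^esub> = \<zero>\<^bsub>N\<^esub>" if "h \<in> module_hom K (M\<lparr>carrier := M.span S\<rparr>) N" for h
    using mod_hom.f0_is_0[of K "M\<lparr>carrier := M.span S\<rparr>" N h] that s N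
    by (simp add: mod_hom_def mod_hom_axioms_def)
  show ?thesis
    using S x
  proof (induction rule: M.span_induct)
    case base then show ?case by (rule eq)
  next
    case zero show ?case using z[OF f] z[OF g] by simp
  next
    case (add x y) then show ?case using module_hom_add[OF f] module_hom_add[OF g] by simp
  next
    case (smult c x) then show ?case using module_hom_smult[OF f] module_hom_smult[OF g] by simp
  qed
qed

section \<open>Quotients of algebras by two-sided ideals\<close>

context assoc_algebra
begin

lemma mult_right_hom: "a \<in> carrier A \<Longrightarrow> (\<lambda>x. x \<otimes> a) \<in> module_hom K A A"
  by (auto simp: module_hom_def l_distr smult_mult_left)

lemma mult_left_hom: "a \<in> carrier A \<Longrightarrow> (\<lambda>x. a \<otimes> x) \<in> module_hom K A A"
  by (auto simp: module_hom_def r_distr smult_mult_right)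

text \<open>Ring ideals absorb scalars because \<open>c \<odot> x\<close> is the product of
  \<open>c \<odot> \<one>\<close> with \<open>x\<close>.\<close>

lemma ideal_module_submodule:
  assumes "ideal I A" shows "module_submodule K A I"
proof -
  interpret I: ideal I A by fact
  have "c \<odot> x \<in> I" if "c \<in> carrier K" "x \<in> I" for c x
    using that I.I_l_closed[of x "c \<odot> \<one>"] I.a_Hcarr smult_mult_left[of c \<one> x] by simp
  then show ?thesis
    using I.a_subset by (auto intro!: module_submodule.intro submodule.intro scal.module_axioms)
qed

lemma quot_module_mult:
  assumes "ideal I A" "x \<in> carrier A" "y \<in> carrier A"
  shows "(I +> x) \<otimes>\<^bsub>quot_module A I\<^esub> (I +> y) = I +> (x \<otimes> y)"
  using assms ideal.rcoset_mult_add by (simp add: quot_module_def)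

lemma quot_module_assoc_algebra:
  assumes I: "ideal I A" shows "assoc_algebra K (quot_module A I)"
proof -
  interpret I: module_submodule K A I using I by (rule ideal_module_submodule)
  interpret Q: module K "quot_module A I" by (rule I.quot_module_module)
  note q = I.quot_module_carrier I.quot_module_add I.quot_module_smult quot_module_mult[OF I]
  have o: "\<one>\<^bsub>quot_module A I\<^esub> = I +> \<one>" by (simp add: quot_module_def)
  have "ring (quot_module A I)"
  proof (rule ringI)
    show "abelian_group (quot_module A I)" by (rule Q.abelian_group_axioms)
    show "monoid (quot_module A I)" by (rule monoidI) (auto simp: q o m_assoc)
  qed (auto simp: q l_distr r_distr)
  then show ?thesis
    using Q.module_axioms
    by (auto intro!: assoc_algebra.intro assoc_algebra_axioms.intro
        simp: q smult_mult_left smult_mult_right)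
qed

end

lemma (in cring) base_module_module: "module R (base_module R)"
  by (rule module_criteria)
    (auto simp: base_module_def l_distr r_distr m_assoc a_ac is_cring intro: a_inv_closed r_neg)

locale based_space = vectorspace K V
  for K :: "('k, 'b) ring_scheme" and V :: "('k, 'v, 'c) module_scheme" +
  fixes B :: "'v set"
  assumes basis_B: "basis B" and finite_B: "finite B"
begin

text \<open>\<open>F\<close> has every vector of \<open>V\<close> as a letter, and \<open>T\<close>
  is its quotient by the linearity relations. \<open>G\<close> has only the basis vectors as
  letters; it will turn out to be a set of unique representatives for \<open>T\<close>.\<close>

abbreviation "F \<equiv> free_algebra K (carrier V)"
abbreviation "G \<equiv> free_algebra K B"
abbreviation "T \<equiv> tensor_algebra K V"
abbreviation "I \<equiv> tensor_ideal K V"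

lemma B_subset: "B \<subseteq> carrier V"
  using basis_B by (simp add: basis_def)

lemma B_closed: "b \<in> B \<Longrightarrow> b \<in> carrier V"
  using B_subset by blast

sublocale FF: assoc_algebra K F by (rule R.free_algebra_assoc_algebra)
sublocale GG: assoc_algebra K G by (rule R.free_algebra_assoc_algebra)

lemma G_subset_F: "carrier G \<subseteq> carrier F"
  using B_subset by (auto simp: free_algebra_simps)

text \<open>\<open>G\<close> is literally a subset of \<open>F\<close> with the same operations, so
  no embedding map is required.\<close>

lemma F_ops: "add F = add G" "smult F = smult G" "mult F = mult G" "zero F = zero G" "one F = one G"
  by (simp_all add: free_algebra_def)

subsection \<open>Coordinates\<close>

definition coord :: "'v \<Rightarrow> 'v \<Rightarrow> 'k" where
  "coord v = (THE a. a \<in> B \<rightarrow>\<^sub>E carrier K \<and> lincomb a B = v)"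

lemma coord_unique: "v \<in> carrier V \<Longrightarrow> \<exists>!a. a \<in> B \<rightarrow>\<^sub>E carrier K \<and> lincomb a B = v"
  using basis_criterion[OF finite_B B_subset] basis_B by blast

lemma coord: "v \<in> carrier V \<Longrightarrow> coord v \<in> B \<rightarrow>\<^sub>E carrier K \<and> lincomb (coord v) B = v"
  unfolding coord_def by (rule theI'[OF coord_unique])

lemma coord_closed: "v \<in> carrier V \<Longrightarrow> b \<in> B \<Longrightarrow> coord v b \<in> carrier K"
  using coord by blast

lemma coord_eqI:
  assumes "v \<in> carrier V" "\<And>b. b \<in> B \<Longrightarrow> a b \<in> carrier K" "lincomb a B = v" "b \<in> B"
  shows "coord v b = a b"
proof -
  \<comment> \<open>Coordinates are unique only among functions that are extensional on
    \<open>B\<close>, hence the restriction.\<close>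
  have "lincomb (restrict a B) B = lincomb a B"
    using assms B_closed unfolding lincomb_def
    by (intro M.add.finprod_cong') auto
  then have "coord v = restrict a B"
    using coord[OF assms(1)] coord_unique[OF assms(1)] assms by (metis (no_types, lifting) restrict_PiE_iff)
  then show ?thesis using assms by simp
qed

lemma coord_add:
  assumes "v \<in> carrier V" "w \<in> carrier V" "b \<in> B"
  shows "coord (v \<oplus>\<^bsub>V\<^esub> w) b = coord v b \<oplus>\<^bsub>K\<^esub> coord w b"
proof (rule coord_eqI)
  have "lincomb (\<lambda>b. coord v b \<oplus>\<^bsub>K\<^esub> coord w b) B = lincomb (coord v) B \<oplus>\<^bsub>V\<^esub> lincomb (coord w) B"
    using coord assms by (intro lincomb_sum finite_B B_subset) blast+
  then show "lincomb (\<lambda>b. coord v b \<oplus>\<^bsub>K\<^esub> coord w b) B = v \<oplus>\<^bsub>V\<^esub> w" using coord assms by simp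
qed (use assms coord_closed in auto)

lemma coord_smult:
  assumes "c \<in> carrier K" "v \<in> carrier V" "b \<in> B"
  shows "coord (c \<odot>\<^bsub>V\<^esub> v) b = c \<otimes>\<^bsub>K\<^esub> coord v b"
proof (rule coord_eqI)
  have "lincomb (\<lambda>b. c \<otimes>\<^bsub>K\<^esub> coord v b) B = c \<odot>\<^bsub>V\<^esub> lincomb (coord v) B"
    using coord assms by (intro lincomb_smult B_subset) blast+
  then show "lincomb (\<lambda>b. c \<otimes>\<^bsub>K\<^esub> coord v b) B = c \<odot>\<^bsub>V\<^esub> v" using coord assms by simp
qed (use assms coord_closed in auto)

lemma coord_basis:
  assumes "b \<in> B" "b' \<in> B"
  shows "coord b b' = (if b' = b then \<one>\<^bsub>K\<^esub> else \<zero>\<^bsub>K\<^esub>)"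
proof (rule coord_eqI)
  have "lincomb (\<lambda>b'. if b' = b then \<one>\<^bsub>K\<^esub> else \<zero>\<^bsub>K\<^esub>) B
      = finsum V (\<lambda>b'. if b = b' then b else \<zero>\<^bsub>V\<^esub>) B"
    unfolding lincomb_def using assms B_closed by (intro M.add.finprod_cong') auto
  also have "\<dots> = b" using assms B_closed by (simp add: M.add.finprod_singleton finite_B)
  finally show "lincomb (\<lambda>b'. if b' = b then \<one>\<^bsub>K\<^esub> else \<zero>\<^bsub>K\<^esub>) B = b" .
qed (use assms B_closed in auto)

lemma coord_inject:
  assumes "v \<in> carrier V" "w \<in> carrier V" "\<And>b. b \<in> B \<Longrightarrow> coord v b = coord w b"
  shows "v = w"
proof -
  have "coord v = coord w" using coord assms by (metis PiE_ext)
  then show ?thesis using coord assms by metis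
qed

lemma hom_eq_on_basis:
  assumes M: "module K M" and f: "f \<in> module_hom K V M" and g: "g \<in> module_hom K V M"
    and eq: "\<And>b. b \<in> B \<Longrightarrow> f b = g b" and v: "v \<in> carrier V"
  shows "f v = g v"
proof -
  have s: "span B = carrier V" using basis_B by (simp add: basis_def)
  show ?thesis
    using module_hom_eq_on_span[OF module_axioms M B_subset, of f g v] assms s by simp
qed

subsection \<open>The isomorphism with the free algebra on a basis\<close>

text \<open>The linear embedding of \<open>V\<close> into \<open>G\<close> as its part of degree
  one: a vector becomes the combination of one-letter words given by its coordinates.\<close>

definition lin_word :: "'v \<Rightarrow> 'v list \<Rightarrow> 'k" where
  "lin_word v w = (case w of [b] \<Rightarrow> if b \<in> B then coord v b else \<zero>\<^bsub>K\<^esub> | _ \<Rightarrow> \<zero>\<^bsub>K\<^esub>)"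

lemma lin_word_simps: "lin_word v [] = \<zero>\<^bsub>K\<^esub>" "lin_word v [b] = (if b \<in> B then coord v b else \<zero>\<^bsub>K\<^esub>)"
    "lin_word v (b # b' # w) = \<zero>\<^bsub>K\<^esub>"
  by (simp_all add: lin_word_def)

lemma lin_word_length: "lin_word v w \<noteq> \<zero>\<^bsub>K\<^esub> \<Longrightarrow> length w = 1"
  by (auto simp: lin_word_def split: list.splits if_splits)

lemma lin_word_closed:
  assumes v: "v \<in> carrier V" shows "lin_word v \<in> carrier G"
proof -
  have sub: "{w. lin_word v w \<noteq> \<zero>\<^bsub>K\<^esub>} \<subseteq> (\<lambda>b. [b]) ` B"
  proof
    fix w assume w: "w \<in> {w. lin_word v w \<noteq> \<zero>\<^bsub>K\<^esub>}"
    then obtain b where "w = [b]" using lin_word_length[of v w] by (auto simp: length_Suc_conv)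
    then show "w \<in> (\<lambda>b. [b]) ` B" using w by (auto simp: lin_word_simps split: if_splits)
  qed
  then have "finite {w. lin_word v w \<noteq> \<zero>\<^bsub>K\<^esub>}" using finite_B finite_surj by blast
  moreover have "{w. lin_word v w \<noteq> \<zero>\<^bsub>K\<^esub>} \<subseteq> lists B" using sub by auto
  moreover have "lin_word v w \<in> carrier K" for w
    using v by (auto simp: lin_word_def coord_closed split: list.splits)
  ultimately show ?thesis by (simp add: free_algebra_simps)
qed

lemma lin_word_hom: "lin_word \<in> module_hom K V G"
  by (auto simp: module_hom_def lin_word_closed free_algebra_simps(4,5) fun_eq_iff lin_word_def
      coord_add coord_smult split: list.splits)

lemma lin_word_basis: "b \<in> B \<Longrightarrow> lin_word b = word K [b]"
  by (auto simp: fun_eq_iff lin_word_def word_def coord_basis split: list.splits)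

lemma lin_word_inject:
  assumes "v \<in> carrier V" "w \<in> carrier V" "lin_word v = lin_word w"
  shows "v = w"
proof (rule coord_inject)
  show "coord v b = coord w b" if "b \<in> B" for b
    using that assms(3) lin_word_simps(2)[of _ b] by metis
qed (use assms in auto)

primrec mult_word :: "'v list \<Rightarrow> 'v list \<Rightarrow> 'k" where
  "mult_word [] = \<one>\<^bsub>G\<^esub>"
| "mult_word (x # u) = lin_word x \<otimes>\<^bsub>G\<^esub> mult_word u"

lemma mult_word_closed: "u \<in> lists (carrier V) \<Longrightarrow> mult_word u \<in> carrier G"
  by (induction u) (simp_all add: lin_word_closed)

lemma mult_word_append:
  "u \<in> lists (carrier V) \<Longrightarrow> v \<in> lists (carrier V) \<Longrightarrow> mult_word (u @ v) = mult_word u \<otimes>\<^bsub>G\<^esub> mult_word v"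
  by (induction u) (simp_all add: GG.m_assoc lin_word_closed mult_word_closed)

lemma mult_word_basis: "u \<in> lists B \<Longrightarrow> mult_word u = word K u"
proof (induction u)
  case Nil show ?case by (simp add: free_algebra_simps)
next
  case (Cons b u)
  then show ?case
    using R.word_conv_word[of "[b]" u] by (simp add: lin_word_basis R.free_algebra_mult[of B])
qed

text \<open>The algebra map from \<open>F\<close> to \<open>G\<close> that expands each letter in
  the basis and multiplies out. It is a retraction onto \<open>G\<close> that respects the quotient
  map \<open>q\<close>.\<close>

definition eval :: "('v list \<Rightarrow> 'k) \<Rightarrow> 'v list \<Rightarrow> 'k" where
  "eval = lin_ext K G mult_word"

lemma mult_word_Pi: "mult_word \<in> lists (carrier V) \<rightarrow> carrier G"
  using mult_word_closed by blast

lemma eval_hom: "eval \<in> module_hom K F G"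
  unfolding eval_def by (rule GG.scal.lin_ext_hom[OF mult_word_Pi])

lemma eval_word: "u \<in> lists (carrier V) \<Longrightarrow> eval (word K u) = mult_word u"
  unfolding eval_def by (rule GG.scal.lin_ext_word[OF mult_word_Pi])

lemma eval_closed: "f \<in> carrier F \<Longrightarrow> eval f \<in> carrier G"
  using module_hom_closed[OF eval_hom] by blast

lemma word_mult_word: "word K u \<otimes>\<^bsub>F\<^esub> word K v = word K (u @ v)"
  by (simp only: R.free_algebra_mult[of "carrier V"] R.word_conv_word)

text \<open>Multiplicativity holds on pairs of words by concatenation and is spread by linearity, to
  the left factor while the right one is a word, and then to the right factor.\<close>

lemma eval_mult:
  assumes f: "f \<in> carrier F" and g: "g \<in> carrier F"
  shows "eval (f \<otimes>\<^bsub>F\<^esub> g) = eval f \<otimes>\<^bsub>G\<^esub> eval g"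
proof -
  have words: "eval (word K u \<otimes>\<^bsub>F\<^esub> word K v) = eval (word K u) \<otimes>\<^bsub>G\<^esub> eval (word K v)"
    if "u \<in> lists (carrier V)" "v \<in> lists (carrier V)" for u v
    using that eval_word[of "u @ v"] by (simp only: word_mult_word eval_word mult_word_append append_in_lists_conv simp_thms)
  have "eval (h \<otimes>\<^bsub>F\<^esub> word K v) = eval h \<otimes>\<^bsub>G\<^esub> eval (word K v)"
    if h: "h \<in> carrier F" and v: "v \<in> lists (carrier V)" for h v
  proof (rule GG.scal.free_algebra_hom_eqI[OF _ _ _ h])
    show "(\<lambda>h. eval (h \<otimes>\<^bsub>F\<^esub> word K v)) \<in> module_hom K F G"
      by (rule module_hom_comp[OF FF.mult_right_hom eval_hom]) (rule R.word_mem[OF v])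
    show "(\<lambda>h. eval h \<otimes>\<^bsub>G\<^esub> eval (word K v)) \<in> module_hom K F G"
      by (rule module_hom_comp[OF eval_hom GG.mult_right_hom]) (intro eval_closed R.word_mem[OF v])
  qed (rule words[OF _ v])
  then show ?thesis
    using f by (intro GG.scal.free_algebra_hom_eqI[OF
        module_hom_comp[OF FF.mult_left_hom eval_hom] module_hom_comp[OF eval_hom GG.mult_left_hom] _ g])
      (simp_all add: eval_closed del: in_lists_conv_set)
qed

lemma eval_ring_hom: "ring_hom_ring F G eval"
  using eval_word[of "[]"] module_hom_add[OF eval_hom]
  by (intro ring_hom_ringI) (simp_all add: FF.ring_axioms GG.ring_axioms eval_closed eval_mult free_algebra_simps(2))

lemma letter_closed: "v \<in> carrier V \<Longrightarrow> word K [v] \<in> carrier F"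
  by (rule R.word_mem) simp

lemma eval_letter: "v \<in> carrier V \<Longrightarrow> eval (word K [v]) = lin_word v"
  by (simp add: eval_word lin_word_closed)

definition relations :: "('v list \<Rightarrow> 'k) set" where
  "relations = {word K [x \<oplus>\<^bsub>V\<^esub> y] \<ominus>\<^bsub>F\<^esub> (word K [x] \<oplus>\<^bsub>F\<^esub> word K [y]) | x y. x \<in> carrier V \<and> y \<in> carrier V} \<union>
       {word K [c \<odot>\<^bsub>V\<^esub> x] \<ominus>\<^bsub>F\<^esub> (c \<odot>\<^bsub>F\<^esub> word K [x]) | c x. c \<in> carrier K \<and> x \<in> carrier V}"

lemma relations_subset: "relations \<subseteq> carrier F"
  by (auto simp: relations_def letter_closed)

lemma tensor_ideal_eq: "I = genideal F relations"
  by (simp add: tensor_ideal_def relations_def Let_def)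

lemma tensor_ideal: "ideal I F"
  unfolding tensor_ideal_eq by (rule FF.genideal_ideal[OF relations_subset])

text \<open>The generators of \<open>I\<close> express additivity and homogeneity of the letters,
  and \<open>lin_word\<close> is linear. Since the kernel of a ring homomorphism is an ideal, it
  contains the ideal that they generate.\<close>

lemma eval_tensor_ideal:
  assumes "f \<in> I" shows "eval f = \<zero>\<^bsub>G\<^esub>"
proof -
  interpret E: ring_hom_ring F G eval by (rule eval_ring_hom)
  interpret EM: mod_hom K F G eval
    using eval_hom by (auto intro!: mod_hom.intro mod_hom_axioms.intro FF.scal.module_axioms GG.scal.module_axioms)
  have "eval r = \<zero>\<^bsub>G\<^esub>" if "r \<in> relations" for r
    using that unfolding relations_def
  proof (elim UnE CollectE exE conjE)
    fix x y assume r: "r = word K [x \<oplus>\<^bsub>V\<^esub> y] \<ominus>\<^bsub>F\<^esub> (word K [x] \<oplus>\<^bsub>F\<^esub> word K [y])" and xy: "x \<in> carrier V" "y \<in> carrier V"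
    then have "eval r = eval (word K [x \<oplus>\<^bsub>V\<^esub> y]) \<ominus>\<^bsub>G\<^esub> (eval (word K [x]) \<oplus>\<^bsub>G\<^esub> eval (word K [y]))"
      by (simp only: EM.f_minus letter_closed M.a_closed FF.a_closed module_hom_add[OF eval_hom])
    then show ?thesis using xy
      by (simp add: eval_letter module_hom_add[OF lin_word_hom] lin_word_closed GG.minus_eq GG.r_neg)
  next
    fix c x assume r: "r = word K [c \<odot>\<^bsub>V\<^esub> x] \<ominus>\<^bsub>F\<^esub> (c \<odot>\<^bsub>F\<^esub> word K [x])" and cx: "c \<in> carrier K" "x \<in> carrier V"
    then have "eval r = eval (word K [c \<odot>\<^bsub>V\<^esub> x]) \<ominus>\<^bsub>G\<^esub> (c \<odot>\<^bsub>G\<^esub> eval (word K [x]))"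
      by (simp only: EM.f_minus letter_closed smult_closed FF.scal.smult_closed module_hom_smult[OF eval_hom])
    then show ?thesis using cx
      by (simp add: eval_letter module_hom_smult[OF lin_word_hom] lin_word_closed GG.minus_eq GG.r_neg)
  qed
  then have "relations \<subseteq> a_kernel F G eval"
    using relations_subset unfolding a_kernel_def' by blast
  then have "I \<subseteq> a_kernel F G eval"
    unfolding tensor_ideal_eq by (intro FF.genideal_minimal E.kernel_is_ideal)
  then show ?thesis using assms unfolding a_kernel_def' by blast
qed

sublocale II: module_submodule K F I
  by (rule FF.ideal_module_submodule[OF tensor_ideal])

sublocale TT: assoc_algebra K T
  unfolding tensor_algebra_def by (rule FF.quot_module_assoc_algebra[OF tensor_ideal])

abbreviation q :: "('v list \<Rightarrow> 'k) \<Rightarrow> ('k, 'v) tensor" where "q \<equiv> (\<lambda>f. I +>\<^bsub>F\<^esub> f)"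

lemma q_hom_F: "q \<in> module_hom K F T"
  using II.coset_mod_hom mod_hom.f_hom unfolding tensor_algebra_def by blast

lemma q_mult_F: "f \<in> carrier F \<Longrightarrow> g \<in> carrier F \<Longrightarrow> q (f \<otimes>\<^bsub>F\<^esub> g) = q f \<otimes>\<^bsub>T\<^esub> q g"
  unfolding tensor_algebra_def by (simp add: FF.quot_module_mult[OF tensor_ideal])

lemma one_T: "\<one>\<^bsub>T\<^esub> = q \<one>\<^bsub>G\<^esub>"
  by (simp add: tensor_algebra_def quot_module_def F_ops)

lemma pure_tensor_eq: "pure_tensor K V u = q (word K u)"
  by (simp add: pure_tensor_def)

lemma letter_hom: "(\<lambda>v. q (word K [v])) \<in> module_hom K V T"
proof -
  have rel: "r \<in> relations \<Longrightarrow> r \<in> I" for r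
    unfolding tensor_ideal_eq using FF.genideal_self[OF relations_subset] by blast
  have "q (word K [x \<oplus>\<^bsub>V\<^esub> y]) = q (word K [x] \<oplus>\<^bsub>F\<^esub> word K [y])" if "x \<in> carrier V" "y \<in> carrier V" for x y
    using that
    by (intro iffD2[OF II.coset_eq_iff] rel) (auto simp: letter_closed relations_def)
  moreover have "q (word K [c \<odot>\<^bsub>V\<^esub> x]) = q (c \<odot>\<^bsub>F\<^esub> word K [x])" if "c \<in> carrier K" "x \<in> carrier V" for c x
    using that
    by (intro iffD2[OF II.coset_eq_iff] rel) (auto simp: letter_closed relations_def)
  ultimately show ?thesis
    using module_hom_add[OF q_hom_F] module_hom_smult[OF q_hom_F] module_hom_closed[OF q_hom_F]
    by (auto simp: module_hom_def letter_closed)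
qed

lemma q_hom: "q \<in> module_hom K G T"
  using q_hom_F G_subset_F by (auto simp: module_hom_def F_ops subset_iff)

lemma q_zero: "q \<zero>\<^bsub>G\<^esub> = \<zero>\<^bsub>T\<^esub>"
  using II.coset_eq_self_iff[OF FF.zero_closed] II.S.zero_closed
  by (simp add: tensor_algebra_def quot_module_def F_ops)

lemma q_mult: "f \<in> carrier G \<Longrightarrow> g \<in> carrier G \<Longrightarrow> q (f \<otimes>\<^bsub>G\<^esub> g) = q f \<otimes>\<^bsub>T\<^esub> q g"
  using q_mult_F G_subset_F by (auto simp: F_ops subset_iff)

text \<open>Modulo \<open>I\<close> the letter of a vector depends linearly on the vector, so the
  two sides need to be compared on \<open>B\<close> only, where \<open>lin_word\<close> is the
  letter itself.\<close>

lemma q_lin_word: "v \<in> carrier V \<Longrightarrow> q (lin_word v) = q (word K [v])"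
  by (rule hom_eq_on_basis[OF TT.scal.module_axioms module_hom_comp[OF lin_word_hom q_hom] letter_hom])
    (simp_all add: lin_word_basis)

lemma q_eval: "f \<in> carrier F \<Longrightarrow> q (eval f) = q f"
proof (rule TT.scal.free_algebra_hom_eqI[OF module_hom_comp[OF eval_hom q_hom] q_hom_F])
  fix u assume "u \<in> lists (carrier V)"
  then have "q (mult_word u) = q (word K u)"
  proof (induction u)
    case Nil show ?case by (simp add: free_algebra_simps)
  next
    case (Cons x u)
    then have "q (mult_word (x # u)) = q (word K [x]) \<otimes>\<^bsub>T\<^esub> q (word K u)"
      by (simp add: q_mult lin_word_closed mult_word_closed q_lin_word)
    also have "\<dots> = q (word K (x # u))"
      using Cons.hyps q_mult_F[of "word K [x]" "word K u"] word_mult_word[of "[x]" u]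
      by (simp add: letter_closed R.word_mem)
    finally show ?case .
  qed
  then show "q (eval (word K u)) = q (word K u)"
    using \<open>u \<in> lists (carrier V)\<close> by (simp only: eval_word)
qed

lemma eval_G: "g \<in> carrier G \<Longrightarrow> eval g = g"
proof (rule GG.scal.free_algebra_hom_eqI[of eval _ "\<lambda>g. g"])
  show "eval \<in> module_hom K G G"
    using eval_hom G_subset_F by (auto simp: module_hom_def F_ops subset_iff)
  show "(\<lambda>g. g) \<in> module_hom K G G" by (simp add: module_hom_def)
  show "eval (word K u) = word K u" if "u \<in> lists B" for u
    using that B_subset lists_mono[OF B_subset] by (metis eval_word mult_word_basis subsetD)
qed

text \<open>Injective, because \<open>eval\<close> kills \<open>I\<close> and fixes
  \<open>G\<close>; surjective, because \<open>eval f\<close> lies in \<open>G\<close> and has the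
  same class as \<open>f\<close>.\<close>

lemma q_bij: "bij_betw q (carrier G) (carrier T)"
  unfolding bij_betw_def
proof
  show "inj_on q (carrier G)"
  proof
    fix g h assume gh: "g \<in> carrier G" "h \<in> carrier G" "q g = q h"
    then have gh': "g \<in> carrier F" "h \<in> carrier F" using G_subset_F by auto
    interpret EM: mod_hom K F G eval
      using eval_hom by (auto intro!: mod_hom.intro mod_hom_axioms.intro FF.scal.module_axioms GG.scal.module_axioms)
    have "g \<ominus>\<^bsub>F\<^esub> h \<in> I" using gh gh' II.coset_eq_iff by blast
    then have "eval g \<ominus>\<^bsub>G\<^esub> eval h = \<zero>\<^bsub>G\<^esub>" using eval_tensor_ideal EM.f_minus[OF gh'] by simp
    then show "g = h" using gh GG.minus_eq_zero_iff by (simp add: eval_G)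
  qed
  show "q ` carrier G = carrier T"
  proof
    show "q ` carrier G \<subseteq> carrier T" using module_hom_closed[OF q_hom] by blast
    have "carrier T = q ` carrier F"
      unfolding tensor_algebra_def by (rule II.quot_module_carrier)
    then show "carrier T \<subseteq> q ` carrier G" using q_eval eval_closed by (auto simp: image_iff) metis
  qed
qed

subsection \<open>Grading\<close>

definition proj :: "nat \<Rightarrow> ('v list \<Rightarrow> 'k) \<Rightarrow> 'v list \<Rightarrow> 'k" where
  "proj n g = (\<lambda>w. if length w = n then g w else \<zero>\<^bsub>K\<^esub>)"

definition homog :: "nat \<Rightarrow> ('v list \<Rightarrow> 'k) set" where
  "homog n = {g \<in> carrier G. \<forall>w. g w \<noteq> \<zero>\<^bsub>K\<^esub> \<longrightarrow> length w = n}"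

lemma proj_closed: "g \<in> carrier G \<Longrightarrow> proj n g \<in> carrier G"
  by (auto simp: proj_def free_algebra_simps elim: rev_finite_subset)

lemma proj_homog: "g \<in> carrier G \<Longrightarrow> proj n g \<in> homog n"
  by (auto simp: homog_def proj_closed) (auto simp: proj_def split: if_splits)

lemma proj_id: "g \<in> homog n \<Longrightarrow> proj n g = g"
  unfolding homog_def proj_def by (rule ext) (metis (mono_tags, lifting) mem_Collect_eq)

lemma proj_other: "g \<in> homog n \<Longrightarrow> m \<noteq> n \<Longrightarrow> proj m g = \<zero>\<^bsub>G\<^esub>"
  by (auto simp: homog_def proj_def free_algebra_simps fun_eq_iff)

lemma proj_hom: "proj n \<in> module_hom K G G"
  by (auto simp: module_hom_def proj_closed) (auto simp: proj_def free_algebra_simps)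

lemma homog_submodule: "submodule K (homog n) G"
proof (rule submodule.intro)
  show "f \<oplus>\<^bsub>G\<^esub> g \<in> homog n" if "f \<in> homog n" "g \<in> homog n" for f g
    using that GG.a_closed[of f g] by (auto simp: homog_def free_algebra_simps(4)) (metis R.l_zero R.zero_closed)
  show "c \<odot>\<^bsub>G\<^esub> f \<in> homog n" if "c \<in> carrier K" "f \<in> homog n" for c f
    using that GG.scal.smult_closed[of c f] by (auto simp: homog_def free_algebra_simps(5)) (metis R.r_null)
  show "\<zero>\<^bsub>G\<^esub> \<in> homog n" using GG.zero_closed by (auto simp: homog_def) (simp add: free_algebra_simps)
qed (auto simp: homog_def GG.scal.module_axioms)

lemma lin_word_homog: "v \<in> carrier V \<Longrightarrow> lin_word v \<in> homog 1"
  using lin_word_length by (auto simp: homog_def lin_word_closed)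

lemma homog_mult:
  assumes "f \<in> homog m" "g \<in> homog n" shows "f \<otimes>\<^bsub>G\<^esub> g \<in> homog (m + n)"
proof -
  have c: "f \<in> carrier G" "g \<in> carrier G" using assms by (auto simp: homog_def)
  have "length w = m + n" if w: "(f \<otimes>\<^bsub>G\<^esub> g) w \<noteq> \<zero>\<^bsub>K\<^esub>" for w
  proof -
    obtain u v where "w = u @ v" "f u \<noteq> \<zero>\<^bsub>K\<^esub>" "g v \<noteq> \<zero>\<^bsub>K\<^esub>"
      using R.conv_support[OF R.free_algebra_carrierD(1)[OF c(1)] R.free_algebra_carrierD(1)[OF c(2)]
          w[unfolded R.free_algebra_mult[of B]]] by blast
    then show ?thesis using assms by (simp add: homog_def)
  qed
  then show ?thesis using GG.m_closed[OF c] by (simp add: homog_def)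
qed

lemma mult_word_homog: "u \<in> lists (carrier V) \<Longrightarrow> mult_word u \<in> homog (length u)"
proof (induction u)
  case Nil
  have "length w = 0" if "\<one>\<^bsub>G\<^esub> w \<noteq> \<zero>\<^bsub>K\<^esub>" for w
    using that by (simp add: free_algebra_simps(2) word_def split: if_splits)
  then show ?case using GG.one_closed by (simp add: homog_def)
next
  case (Cons x u)
  then show ?case using homog_mult[OF lin_word_homog, of x "mult_word u"] by simp
qed

text \<open>Products of n vectors expand into words of length n, and each basis word of length n is
  itself a pure tensor. This lets degrees in \<open>T\<close> be read off from word lengths.\<close>

lemma tensor_power_eq: "tensor_power K V n = q ` homog n"
proof
  let ?S = "{pure_tensor K V xs | xs. xs \<in> lists (carrier V) \<and> length xs = n}"
  have pure: "pure_tensor K V u = q (mult_word u)" if "u \<in> lists (carrier V)" for u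
    using that q_eval[of "word K u"] by (simp only: pure_tensor_eq eval_word R.word_mem)
  have S: "?S \<subseteq> carrier T"
    using pure mult_word_closed module_hom_closed[OF q_hom] by fastforce
  have "submodule K (q ` homog n) T"
  proof -
    interpret h: submodule K "homog n" G by (rule homog_submodule)
    have "mod_hom K (G\<lparr>carrier := homog n\<rparr>) T q"
      using q_hom h.subset
      by (auto intro!: mod_hom.intro mod_hom_axioms.intro GG.scal.submodule_is_module homog_submodule
          TT.scal.module_axioms simp: module_hom_def Pi_iff subset_iff)
    from mod_hom.im_is_submodule[OF this] show ?thesis by (simp add: mod_hom.im_def[OF \<open>mod_hom K (G\<lparr>carrier := homog n\<rparr>) T q\<close>])
  qed
  moreover have "?S \<subseteq> q ` homog n" using pure mult_word_homog by fastforce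
  ultimately show "tensor_power K V n \<subseteq> q ` homog n"
    unfolding tensor_power_def by (intro TT.scal.span_is_subset)
  interpret s: submodule K "tensor_power K V n" T
    unfolding tensor_power_def using S by (rule TT.scal.span_is_submodule)
  \<comment> \<open>The induction adds words of any length, so the claim is made for the projection
    of an arbitrary element; on \<open>homog n\<close> the projection is the identity.\<close>
  have "q (proj n g) \<in> tensor_power K V n" if "g \<in> carrier G" for g
    using that
  proof (induction rule: R.free_algebra_induct)
    case zero
    have "proj n (\<lambda>w. \<zero>\<^bsub>K\<^esub>) = \<zero>\<^bsub>G\<^esub>" by (auto simp: proj_def free_algebra_simps)
    then show ?case using q_zero s.zero_closed by simp
  next
    case (add_word f c u)
    have u: "word K u \<in> carrier G" "u \<in> lists (carrier V)"
      by (rule R.word_mem[OF add_word(3)], rule subsetD[OF lists_mono[OF B_subset] add_word(3)])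
    have cu: "c \<odot>\<^bsub>G\<^esub> word K u \<in> carrier G" using add_word(2) u(1) by simp
    have "q (proj n (f \<oplus>\<^bsub>G\<^esub> c \<odot>\<^bsub>G\<^esub> word K u)) = q (proj n f) \<oplus>\<^bsub>T\<^esub> c \<odot>\<^bsub>T\<^esub> q (proj n (word K u))"
      by (simp only: module_hom_add[OF proj_hom add_word(1) cu] module_hom_smult[OF proj_hom add_word(2) u(1)]
          module_hom_add[OF q_hom proj_closed[OF add_word(1)] GG.scal.smult_closed[OF add_word(2) proj_closed[OF u(1)]]]
          module_hom_smult[OF q_hom add_word(2) proj_closed[OF u(1)]])
    moreover have "q (proj n (word K u)) \<in> tensor_power K V n"
    proof (cases "length u = n")
      case True
      then have "proj n (word K u) = word K u" by (auto simp: proj_def word_def)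
      then have "q (proj n (word K u)) \<in> ?S" using True u by (auto simp: pure_tensor_eq simp del: in_lists_conv_set)
      then show ?thesis unfolding tensor_power_def using TT.scal.in_own_span[OF S] by blast
    next
      case False
      then have "proj n (word K u) = \<zero>\<^bsub>G\<^esub>" by (auto simp: proj_def word_def free_algebra_simps)
      then show ?thesis using q_zero s.zero_closed by simp
    qed
    ultimately show ?case using add_word by (simp add: free_algebra_simps(4,5))
  qed
  then show "q ` homog n \<subseteq> tensor_power K V n" using proj_id by (auto simp: homog_def) (metis (no_types, lifting) homog_def mem_Collect_eq proj_id)
qed

end

section \<open>Koszul cochains of the tensor algebra\<close>

lemma (in module) submodule_zero: "submodule R {\<zero>\<^bsub>M\<^esub>} M"
  by (auto intro!: submodule.intro module_axioms)

lemma (in module) span_zero_set: "span {\<zero>\<^bsub>M\<^esub>} = {\<zero>\<^bsub>M\<^esub>}"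
  using span_is_subset[OF _ submodule_zero, of "{\<zero>\<^bsub>M\<^esub>}"] in_own_span[of "{\<zero>\<^bsub>M\<^esub>}"] by auto

context based_space
begin

text \<open>The maps \<open>D b\<close> recover \<open>w\<close>, weighted by the coordinates of \<open>x\<close>, from the tensor
  \<open>\<mu> w x\<close>; this replaces the universal property of the tensor product.\<close>

lemma bilinear_extension:
  fixes M :: "('k, 'm, 'm') module_scheme" and N :: "('k, 'n, 'n') module_scheme"
  assumes M: "module K M" and N: "module K N" and W: "submodule K W M"
    and \<mu>: "\<And>w x. w \<in> W \<Longrightarrow> x \<in> carrier V \<Longrightarrow> \<mu> w x \<in> carrier M"
    and D: "\<And>b. b \<in> B \<Longrightarrow> D b \<in> module_hom K M M"
    and D\<mu>: "\<And>b w x. b \<in> B \<Longrightarrow> w \<in> W \<Longrightarrow> x \<in> carrier V \<Longrightarrow> D b (\<mu> w x) = coord x b \<odot>\<^bsub>M\<^esub> w"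
    and f: "f \<in> module_hom K (M\<lparr>carrier := W\<rparr>) N"
    and \<nu>1: "\<And>x. x \<in> carrier V \<Longrightarrow> (\<lambda>a. \<nu> a x) \<in> module_hom K N N"
    and \<nu>2: "\<And>a. a \<in> carrier N \<Longrightarrow> (\<lambda>x. \<nu> a x) \<in> module_hom K V N"
  defines "S \<equiv> {\<mu> w x | w x. w \<in> W \<and> x \<in> carrier V}"
  shows "\<exists>!g. g \<in> carrier (Hom_module K (M\<lparr>carrier := LinearCombinations.module.span K M S\<rparr>) N) \<and>
      (\<forall>w\<in>W. \<forall>x\<in>carrier V. g (\<mu> w x) = \<nu> (f w) x)"
proof -
  interpret M: module K M by fact
  interpret N: module K N by fact
  interpret W: submodule K W M by fact
  have S: "S \<subseteq> carrier M" using \<mu> by (auto simp: S_def)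
  interpret sp: submodule K "M.span S" M using S by (rule M.span_is_submodule)
  \<comment> \<open>\<open>f\<close> is linear on \<open>W\<close> only, while \<open>D b\<close>
    acts on all of \<open>M\<close>; on the generators \<open>D b\<close> returns a multiple of
    \<open>w\<close>, so on their span it stays in \<open>W\<close>.\<close>
  have DW: "D b t \<in> W" if b: "b \<in> B" and t: "t \<in> M.span S" for b t
    using S t
  proof (induction rule: M.span_induct)
    case (base x) then show ?case using D\<mu>[OF b] coord_closed b by (auto simp: S_def)
  next
    case zero
    have "mod_hom K M M (D b)" using D[OF b] M by (simp add: mod_hom_def mod_hom_axioms_def)
    then show ?case using mod_hom.f0_is_0 W.zero_closed by metis
  next
    case (add x y)
    then have "x \<in> carrier M" "y \<in> carrier M" using sp.subset by auto
    then show ?case using add module_hom_add[OF D[OF b], of x y] by simp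
  next
    case (smult c x)
    then have "x \<in> carrier M" using sp.subset by auto
    then show ?case using smult module_hom_smult[OF D[OF b], of c x] by simp
  qed
  have fc: "f w \<in> carrier N" if "w \<in> W" for w using module_hom_closed[OF f] that by auto
  have \<nu>c: "\<nu> a x \<in> carrier N" if "a \<in> carrier N" "x \<in> carrier V" for a x
    using module_hom_closed[OF \<nu>1] that by auto
  have summand: "\<nu> (f (D b t)) b \<in> carrier N" if "b \<in> B" "t \<in> M.span S" for b t
    using that by (intro \<nu>c fc DW B_closed)
  \<comment> \<open>A tensor t is the sum over \<open>B\<close> of the
    \<open>\<mu> (D b t) b\<close>, which leaves this as the only possible value of a linear
    extension.\<close>
  define g where "g = (\<lambda>t\<in>M.span S. \<Oplus>\<^bsub>N\<^esub>b\<in>B. \<nu> (f (D b t)) b)"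
  have "g \<in> carrier (Hom_module K (M\<lparr>carrier := M.span S\<rparr>) N)"
  proof -
    have "g (t \<oplus>\<^bsub>M\<^esub> t') = g t \<oplus>\<^bsub>N\<^esub> g t'" if t: "t \<in> M.span S" "t' \<in> M.span S" for t t'
    proof -
      have tc: "t \<in> carrier M" "t' \<in> carrier M" using t sp.subset by auto
      have "\<nu> (f (D b (t \<oplus>\<^bsub>M\<^esub> t'))) b = \<nu> (f (D b t)) b \<oplus>\<^bsub>N\<^esub> \<nu> (f (D b t')) b" if b: "b \<in> B" for b
        using module_hom_add[OF D[OF b], of t t'] module_hom_add[OF f, of "D b t" "D b t'"]
          module_hom_add[OF \<nu>1[OF B_closed[OF b]], of "f (D b t)" "f (D b t')"] tc t b
        by (simp add: DW fc)
      then have "(\<Oplus>\<^bsub>N\<^esub>b\<in>B. \<nu> (f (D b (t \<oplus>\<^bsub>M\<^esub> t'))) b) = (\<Oplus>\<^bsub>N\<^esub>b\<in>B. \<nu> (f (D b t)) b \<oplus>\<^bsub>N\<^esub> \<nu> (f (D b t')) b)"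
        using summand t by (intro N.add.finprod_cong') auto
      also have "\<dots> = (\<Oplus>\<^bsub>N\<^esub>b\<in>B. \<nu> (f (D b t)) b) \<oplus>\<^bsub>N\<^esub> (\<Oplus>\<^bsub>N\<^esub>b\<in>B. \<nu> (f (D b t')) b)"
        using summand t by (intro N.finsum_addf) auto
      finally show ?thesis using t by (simp add: g_def)
    qed
    moreover have "g (c \<odot>\<^bsub>M\<^esub> t) = c \<odot>\<^bsub>N\<^esub> g t" if c: "c \<in> carrier K" and t: "t \<in> M.span S" for c t
    proof -
      have tc: "t \<in> carrier M" using t sp.subset by auto
      have "\<nu> (f (D b (c \<odot>\<^bsub>M\<^esub> t))) b = c \<odot>\<^bsub>N\<^esub> \<nu> (f (D b t)) b" if b: "b \<in> B" for b
        using module_hom_smult[OF D[OF b], of c t] module_hom_smult[OF f, of c "D b t"]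
          module_hom_smult[OF \<nu>1[OF B_closed[OF b]], of c "f (D b t)"] tc t b c
        by (simp add: DW fc)
      then have "(\<Oplus>\<^bsub>N\<^esub>b\<in>B. \<nu> (f (D b (c \<odot>\<^bsub>M\<^esub> t))) b) = (\<Oplus>\<^bsub>N\<^esub>b\<in>B. c \<odot>\<^bsub>N\<^esub> \<nu> (f (D b t)) b)"
        using summand t c by (intro N.add.finprod_cong') auto
      also have "\<dots> = c \<odot>\<^bsub>N\<^esub> (\<Oplus>\<^bsub>N\<^esub>b\<in>B. \<nu> (f (D b t)) b)"
        using summand t c by (intro N.finsum_smult_ldistr[symmetric] finite_B) auto
      finally show ?thesis using t c by (simp add: g_def)
    qed
    moreover have "g t \<in> carrier N" if "t \<in> M.span S" for t
      using that summand by (simp add: g_def N.finsum_closed Pi_iff)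
    ultimately show ?thesis
      by (auto simp: Hom_module_def module_hom_def) (simp add: g_def)
  qed
  moreover have "g (\<mu> w x) = \<nu> (f w) x" if w: "w \<in> W" and x: "x \<in> carrier V" for w x
  proof -
    have s: "\<mu> w x \<in> M.span S" using M.in_own_span[OF S] w x by (auto simp: S_def)
    have wc: "w \<in> carrier M" using w W.subset by auto
    have "g (\<mu> w x) = (\<Oplus>\<^bsub>N\<^esub>b\<in>B. coord x b \<odot>\<^bsub>N\<^esub> \<nu> (f w) b)"
    proof -
      have "\<nu> (f (D b (\<mu> w x))) b = coord x b \<odot>\<^bsub>N\<^esub> \<nu> (f w) b" if b: "b \<in> B" for b
        using module_hom_smult[OF f, of "coord x b" w]
          module_hom_smult[OF \<nu>1[OF B_closed[OF b]], of "coord x b" "f w"]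
        by (simp add: D\<mu>[OF b w x] coord_closed[OF x b] w fc)
      then have "(\<Oplus>\<^bsub>N\<^esub>b\<in>B. \<nu> (f (D b (\<mu> w x))) b) = (\<Oplus>\<^bsub>N\<^esub>b\<in>B. coord x b \<odot>\<^bsub>N\<^esub> \<nu> (f w) b)"
        using coord_closed[OF x] \<nu>c fc[OF w] B_closed by (intro N.add.finprod_cong') auto
      then show ?thesis using s by (simp add: g_def)
    qed
    also have "\<dots> = \<nu> (f w) (lincomb (coord x) B)"
    proof -
      interpret n: mod_hom K V N "\<nu> (f w)"
        using \<nu>2[OF fc[OF w]] N module_axioms by (simp add: mod_hom_def mod_hom_axioms_def)
      have "\<nu> (f w) (lincomb (coord x) B) = (\<Oplus>\<^bsub>N\<^esub>b\<in>B. \<nu> (f w) (coord x b \<odot>\<^bsub>V\<^esub> b))"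
        unfolding lincomb_def
        using coord_closed[OF x] B_closed by (intro n.hom_sum B_subset) auto
      also have "\<dots> = (\<Oplus>\<^bsub>N\<^esub>b\<in>B. coord x b \<odot>\<^bsub>N\<^esub> \<nu> (f w) b)"
        using coord_closed[OF x] B_closed \<nu>c fc[OF w]
        by (intro N.add.finprod_cong') auto
      finally show ?thesis by simp
    qed
    finally show ?thesis using coord[OF x] by simp
  qed
  \<comment> \<open>Uniqueness: both maps are prescribed on the generators of the span and are
    undefined outside it.\<close>
  moreover have "g1 = g2"
    if g1: "g1 \<in> carrier (Hom_module K (M\<lparr>carrier := M.span S\<rparr>) N)" "\<forall>w\<in>W. \<forall>x\<in>carrier V. g1 (\<mu> w x) = \<nu> (f w) x"
      and g2: "g2 \<in> carrier (Hom_module K (M\<lparr>carrier := M.span S\<rparr>) N)" "\<forall>w\<in>W. \<forall>x\<in>carrier V. g2 (\<mu> w x) = \<nu> (f w) x"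
    for g1 g2
  proof (rule extensionalityI)
    show "g1 \<in> extensional (M.span S)" "g2 \<in> extensional (M.span S)"
      using g1 g2 by (auto simp: Hom_module_def)
    show "g1 x = g2 x" if "x \<in> M.span S" for x
    proof (rule module_hom_eq_on_span[OF M N S _ _ _ that])
      show "g1 \<in> module_hom K (M\<lparr>carrier := M.span S\<rparr>) N" "g2 \<in> module_hom K (M\<lparr>carrier := M.span S\<rparr>) N"
        using g1(1) g2(1) by (simp_all add: Hom_module_def)
      show "g1 y = g2 y" if "y \<in> S" for y
        using that g1(2) g2(2) unfolding S_def by force
    qed
  qed
  ultimately show ?thesis by blast
qed

subsection \<open>Removing the last or the first letter\<close>

definition rstrip :: "'v \<Rightarrow> ('v list \<Rightarrow> 'k) \<Rightarrow> 'v list \<Rightarrow> 'k" where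
  "rstrip b g = (\<lambda>w. g (w @ [b]))"

definition lstrip :: "'v \<Rightarrow> ('v list \<Rightarrow> 'k) \<Rightarrow> 'v list \<Rightarrow> 'k" where
  "lstrip b g = (\<lambda>w. g (b # w))"

text \<open>The new support is the preimage of a finite set under an injective map on words, hence
  finite.\<close>

lemma strip_closed:
  assumes "inj h" "\<And>w. h w \<in> lists B \<Longrightarrow> w \<in> lists B" "g \<in> carrier G"
  shows "(\<lambda>w. g (h w)) \<in> carrier G"
proof -
  have "finite (h -` {w. g w \<noteq> \<zero>\<^bsub>K\<^esub>})"
    using assms by (intro finite_vimageI) (auto simp: free_algebra_simps)
  then have "finite {w. g (h w) \<noteq> \<zero>\<^bsub>K\<^esub>}" by (simp add: vimage_def)
  moreover have "{w. g (h w) \<noteq> \<zero>\<^bsub>K\<^esub>} \<subseteq> lists B"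
    using assms(2) R.free_algebra_carrierD(3)[OF assms(3)] by blast
  ultimately show ?thesis using assms(3) by (simp add: free_algebra_simps)
qed

lemma rstrip_closed: "g \<in> carrier G \<Longrightarrow> rstrip b g \<in> carrier G"
  unfolding rstrip_def by (rule strip_closed) (auto simp: inj_def)

lemma lstrip_closed: "g \<in> carrier G \<Longrightarrow> lstrip b g \<in> carrier G"
  unfolding lstrip_def by (rule strip_closed) (auto simp: inj_def)

lemma rstrip_hom: "rstrip b \<in> module_hom K G G"
  by (auto simp: module_hom_def rstrip_closed) (auto simp: rstrip_def free_algebra_simps(4,5))

lemma lstrip_hom: "lstrip b \<in> module_hom K G G"
  by (auto simp: module_hom_def lstrip_closed) (auto simp: lstrip_def free_algebra_simps(4,5))

lemma coord_smult_hom: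
  assumes "h \<in> carrier G" "b \<in> B"
  shows "(\<lambda>x. coord x b \<odot>\<^bsub>G\<^esub> h) \<in> module_hom K V G"
  using assms by (auto simp: module_hom_def coord_closed coord_add coord_smult GG.scal.smult_l_distr
      GG.scal.smult_assoc1)

lemma conv_letter_G: "h \<in> carrier G \<Longrightarrow> (h \<otimes>\<^bsub>G\<^esub> word K [b]) w = (if w \<noteq> [] \<and> last w = b then h (butlast w) else \<zero>\<^bsub>K\<^esub>)"
  unfolding R.free_algebra_mult[of B] by (intro R.conv_letter R.free_algebra_carrierD(1))

lemma letter_conv_G: "h \<in> carrier G \<Longrightarrow> (word K [b] \<otimes>\<^bsub>G\<^esub> h) w = (case w of [] \<Rightarrow> \<zero>\<^bsub>K\<^esub> | x # u \<Rightarrow> if x = b then h u else \<zero>\<^bsub>K\<^esub>)"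
  unfolding R.free_algebra_mult[of B] by (intro R.letter_conv R.free_algebra_carrierD(1))

text \<open>This makes \<open>rstrip\<close>, carried over to \<open>T\<close>, a family
  \<open>D\<close> as \<open>bilinear_extension\<close> demands. Both sides are linear in
  \<open>x\<close>, so only basis vectors are compared.\<close>

lemma rstrip_mult:
  assumes h: "h \<in> carrier G" and b: "b \<in> B" and x: "x \<in> carrier V"
  shows "rstrip b (h \<otimes>\<^bsub>G\<^esub> lin_word x) = coord x b \<odot>\<^bsub>G\<^esub> h"
proof (rule hom_eq_on_basis[OF GG.scal.module_axioms _ coord_smult_hom[OF h b] _ x])
  show "(\<lambda>x. rstrip b (h \<otimes>\<^bsub>G\<^esub> lin_word x)) \<in> module_hom K V G"
    by (rule module_hom_comp[OF lin_word_hom module_hom_comp[OF GG.mult_left_hom[OF h] rstrip_hom]])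
  show "rstrip b (h \<otimes>\<^bsub>G\<^esub> lin_word b') = coord b' b \<odot>\<^bsub>G\<^esub> h" if "b' \<in> B" for b'
    using that b h R.free_algebra_carrierD(1)[OF h]
    by (auto simp: lin_word_basis coord_basis rstrip_def conv_letter_G free_algebra_simps(5) fun_eq_iff)
qed

lemma lstrip_mult:
  assumes h: "h \<in> carrier G" and b: "b \<in> B" and x: "x \<in> carrier V"
  shows "lstrip b (lin_word x \<otimes>\<^bsub>G\<^esub> h) = coord x b \<odot>\<^bsub>G\<^esub> h"
proof (rule hom_eq_on_basis[OF GG.scal.module_axioms _ coord_smult_hom[OF h b] _ x])
  show "(\<lambda>x. lstrip b (lin_word x \<otimes>\<^bsub>G\<^esub> h)) \<in> module_hom K V G"
    by (rule module_hom_comp[OF lin_word_hom module_hom_comp[OF GG.mult_right_hom[OF h] lstrip_hom]])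
  show "lstrip b (lin_word b' \<otimes>\<^bsub>G\<^esub> h) = coord b' b \<odot>\<^bsub>G\<^esub> h" if "b' \<in> B" for b'
    using that b h R.free_algebra_carrierD(1)[OF h]
    by (auto simp: lin_word_basis coord_basis lstrip_def letter_conv_G free_algebra_simps(5) fun_eq_iff)
qed

section \<open>The inverse identification, and tensors of degree zero and one\<close>

definition qinv :: "('k, 'v) tensor \<Rightarrow> 'v list \<Rightarrow> 'k" where
  "qinv = the_inv_into (carrier G) q"

lemma qinv_hom: "qinv \<in> module_hom K T G"
  unfolding qinv_def by (rule module_hom_the_inv_into[OF GG.scal.module_axioms q_hom q_bij])

lemma qinv_q: "g \<in> carrier G \<Longrightarrow> qinv (q g) = g"
  unfolding qinv_def by (rule the_inv_into_f_f) (use q_bij in \<open>auto simp: bij_betw_def\<close>)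

lemma q_qinv: "t \<in> carrier T \<Longrightarrow> q (qinv t) = t"
  unfolding qinv_def by (rule f_the_inv_into_f_bij_betw[OF q_bij])

lemma qinv_closed: "t \<in> carrier T \<Longrightarrow> qinv t \<in> carrier G"
  using module_hom_closed[OF qinv_hom] by blast

lemma q_closed: "g \<in> carrier G \<Longrightarrow> q g \<in> carrier T"
  using module_hom_closed[OF q_hom] by blast

lemma pure_letter: "v \<in> carrier V \<Longrightarrow> pure_tensor K V [v] = q (lin_word v)"
  by (simp add: pure_tensor_eq q_lin_word)

lemma homog_1: "homog 1 = lin_word ` carrier V"
proof
  show "homog 1 \<subseteq> lin_word ` carrier V"
  proof
    fix g assume g: "g \<in> homog 1"
    then have gc: "g \<in> carrier G" by (simp add: homog_def)
    \<comment> \<open>The coefficients of the one-letter words serve as coordinates; letters outside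
      \<open>B\<close> have coefficient zero because the support of \<open>g\<close> lies in words
      over \<open>B\<close>.\<close>
    let ?v = "lincomb (\<lambda>b. g [b]) B"
    have K: "g w \<in> carrier K" for w using gc by (simp add: free_algebra_simps)
    have v: "?v \<in> carrier V" using K by (intro lincomb_closed B_subset) auto
    have "coord ?v b = g [b]" if "b \<in> B" for b
      using that K v by (intro coord_eqI) auto
    moreover have "g [b] = \<zero>\<^bsub>K\<^esub>" if "b \<notin> B" for b
      using R.free_algebra_carrierD(3)[OF gc, of "[b]"] that by auto
    moreover have "g w = \<zero>\<^bsub>K\<^esub>" if "length w \<noteq> 1" for w using g that by (auto simp: homog_def)
    ultimately have "g = lin_word ?v" by (auto simp: lin_word_def fun_eq_iff split: list.splits)
    then show "g \<in> lin_word ` carrier V" using v by blast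
  qed
qed (use lin_word_homog in auto)

lemma homog_0: "homog 0 = {c \<odot>\<^bsub>G\<^esub> \<one>\<^bsub>G\<^esub> | c. c \<in> carrier K}"
proof
  show "homog 0 \<subseteq> {c \<odot>\<^bsub>G\<^esub> \<one>\<^bsub>G\<^esub> | c. c \<in> carrier K}"
  proof
    fix g assume g: "g \<in> homog 0"
    then have K: "g w \<in> carrier K" for w by (auto simp: homog_def free_algebra_simps)
    have "g w = \<zero>\<^bsub>K\<^esub>" if "w \<noteq> []" for w using g that by (auto simp: homog_def)
    then have "g = g [] \<odot>\<^bsub>G\<^esub> \<one>\<^bsub>G\<^esub>" using K by (auto simp: free_algebra_simps(2,5) word_def fun_eq_iff)
    then show "g \<in> {c \<odot>\<^bsub>G\<^esub> \<one>\<^bsub>G\<^esub> | c. c \<in> carrier K}" using K by blast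
  qed
  show "{c \<odot>\<^bsub>G\<^esub> \<one>\<^bsub>G\<^esub> | c. c \<in> carrier K} \<subseteq> homog 0"
    using submodule.smult_closed[OF homog_submodule[of 0]] mult_word_homog[of "[]"] by auto
qed

text \<open>In degree one no sums are needed, each element being a single vector. Hence the products
  \<open>w x\<close> with \<open>x\<close> a vector already form the generating sets of the tensor
  products below.\<close>

lemma tensor_power_1: "tensor_power K V 1 = {pure_tensor K V [v] | v. v \<in> carrier V}"
  unfolding tensor_power_eq homog_1 using pure_letter by (auto simp: image_iff)

lemma tensor_power_0: "tensor_power K V 0 = {c \<odot>\<^bsub>T\<^esub> \<one>\<^bsub>T\<^esub> | c. c \<in> carrier K}"
  unfolding tensor_power_eq homog_0 one_T
  by (auto simp: module_hom_smult[OF q_hom] image_iff) (metis GG.one_closed module_hom_smult q_hom)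

lemma tensor_power_submodule: "submodule K (tensor_power K V n) T"
  unfolding tensor_power_def
proof (rule TT.scal.span_is_submodule)
  have "pure_tensor K V xs \<in> carrier T" if "xs \<in> lists (carrier V)" for xs
    unfolding pure_tensor_eq using that
    by (intro module_hom_closed[OF q_hom_F, THEN funcset_mem] R.word_mem)
  then show "{pure_tensor K V xs | xs. xs \<in> lists (carrier V) \<and> length xs = n} \<subseteq> carrier T" by blast
qed

lemma tensor_power_subset: "tensor_power K V n \<subseteq> carrier T"
  using tensor_power_submodule by (rule submodule.subset)

subsection \<open>The quadratic algebra without relations\<close>

text \<open>Without relations \<open>A\<close> is \<open>T\<close> modulo the zero ideal. Its
  elements are singleton cosets, of a type different from that of \<open>T\<close>, so
  \<open>pr\<close> is a bijection and not the identity.\<close>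

abbreviation "R0 \<equiv> {\<zero>\<^bsub>T\<^esub>}"
abbreviation "A \<equiv> quadratic_algebra K V R0"
abbreviation "pr \<equiv> quadratic_proj K V R0"

lemma R0_ideal: "ideal R0 T" by (rule TT.zeroideal)

lemma A_eq: "A = quot_module T R0"
  by (simp add: quadratic_algebra_def TT.genideal_zero)

lemma pr_eq: "pr = (\<lambda>t. R0 +>\<^bsub>T\<^esub> t)"
  by (simp add: quadratic_proj_def TT.genideal_zero fun_eq_iff)

sublocale AA: assoc_algebra K A
  unfolding A_eq by (rule TT.quot_module_assoc_algebra[OF R0_ideal])

sublocale RR: module_submodule K T R0
  by (rule TT.ideal_module_submodule[OF R0_ideal])

lemma pr_hom: "pr \<in> module_hom K T A"
  unfolding pr_eq A_eq using RR.coset_mod_hom by (rule mod_hom.f_hom)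

lemma pr_mult: "s \<in> carrier T \<Longrightarrow> t \<in> carrier T \<Longrightarrow> pr (s \<otimes>\<^bsub>T\<^esub> t) = pr s \<otimes>\<^bsub>A\<^esub> pr t"
  unfolding pr_eq A_eq by (simp only: TT.quot_module_mult[OF R0_ideal])

lemma pr_one: "pr \<one>\<^bsub>T\<^esub> = \<one>\<^bsub>A\<^esub>"
  by (simp only: pr_eq A_eq) (simp add: quot_module_def)

lemma pr_bij: "bij_betw pr (carrier T) (carrier A)"
  unfolding bij_betw_def
proof
  show "inj_on pr (carrier T)"
    unfolding pr_eq
    by (rule inj_onI) (simp only: RR.coset_eq_iff TT.minus_eq_zero_iff singleton_iff)
  show "pr ` carrier T = carrier A"
    unfolding pr_eq A_eq by (rule RR.quot_module_carrier[symmetric])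
qed

lemma pr_closed: "t \<in> carrier T \<Longrightarrow> pr t \<in> carrier A"
  using module_hom_closed[OF pr_hom] by blast

lemma koszul_e_eq: "v \<in> carrier V \<Longrightarrow> koszul_e K V R0 v = pr (pure_tensor K V [v])"
  by (simp add: koszul_e_def)

lemma pure_letter_closed: "v \<in> carrier V \<Longrightarrow> pure_tensor K V [v] \<in> carrier T"
  by (simp add: pure_letter q_closed lin_word_closed)

lemma pure_letter_hom: "(\<lambda>v. pure_tensor K V [v]) \<in> module_hom K V T"
  using letter_hom by (simp add: pure_tensor_eq)

lemma koszul_e_hom: "koszul_e K V R0 \<in> module_hom K V A"
  using module_hom_comp[OF pure_letter_hom pr_hom]
  by (auto simp: module_hom_def koszul_e_eq)

lemma koszul_W_small: "p < 2 \<Longrightarrow> koszul_W K V R0 p = tensor_power K V p"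
  by (simp add: koszul_W_def)

lemma koszul_W_large: assumes p: "2 \<le> p" shows "koszul_W K V R0 p = R0"
proof -
  \<comment> \<open>The tensor powers are nonempty, so the sets of products with zero equal
    \<open>R0\<close> and not the empty set.\<close>
  have "\<zero>\<^bsub>T\<^esub> \<in> tensor_power K V i" for i
    using submodule.zero_closed[OF tensor_power_submodule] .
  then have "{a \<otimes>\<^bsub>T\<^esub> b | a b. a \<in> tensor_power K V i \<and> b \<in> R0} = R0"
    and "{a \<otimes>\<^bsub>T\<^esub> b | a b. a \<in> R0 \<and> b \<in> tensor_power K V i} = R0" for i
    using tensor_power_subset[of i] by (auto simp: subset_iff) (metis TT.r_null TT.zero_closed)+
  then have "tensor_prod K V (tensor_prod K V (tensor_power K V i) R0) (tensor_power K V j) = R0" for i j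
    by (simp only: tensor_prod_def TT.scal.span_zero_set)
  \<comment> \<open>Indices with \<open>i + 2 + j = p\<close> exist because \<open>p\<close> is at
    least 2; an intersection over the empty family would be everything.\<close>
  then have "{tensor_prod K V (tensor_prod K V (tensor_power K V i) R0) (tensor_power K V j) | i j.
              i + 2 + j = p} = {R0}"
    using p le_Suc_ex[of 2 p] by auto (metis add.right_neutral)
  then show ?thesis using p by (simp add: koszul_W_def)
qed

lemma koszul_W_submodule: "submodule K (koszul_W K V R0 p) T"
  using tensor_power_submodule TT.scal.submodule_zero
  by (cases "p < 2") (simp_all add: koszul_W_small koszul_W_large)

lemma koszul_W_subset: "koszul_W K V R0 p \<subseteq> carrier T"
  using koszul_W_submodule by (rule submodule.subset)

section \<open>Existence of the one-sided multiplications of a cochain by vectors\<close>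

lemma cochainD:
  assumes "f \<in> carrier (koszul_cochains K V R0 p)"
  shows "f \<in> module_hom K (T\<lparr>carrier := koszul_W K V R0 p\<rparr>) A" "f \<in> extensional (koszul_W K V R0 p)"
  using assms by (simp_all add: koszul_cochains_def Hom_module_def)

text \<open>Unfolds the definite description once and for all: \<open>bilinear_extension\<close>
  applies with the removal of the last letter, transported to \<open>T\<close>, as
  \<open>D\<close>.\<close>

lemma right_mult:
  assumes f: "f \<in> carrier (koszul_cochains K V R0 p)"
  shows "right_mult K V R0 p f \<in> carrier (Hom_module K
      (T\<lparr>carrier := tensor_prod K V (koszul_W K V R0 p) (tensor_power K V 1)\<rparr>) A) \<and>
    (\<forall>w\<in>koszul_W K V R0 p. \<forall>x\<in>carrier V. right_mult K V R0 p f (w \<otimes>\<^bsub>T\<^esub> pure_tensor K V [x])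
        = f w \<otimes>\<^bsub>A\<^esub> koszul_e K V R0 x)"
proof -
  \<comment> \<open>The generators of the tensor product are brought into the form with explicit
    vectors, which is the set \<open>S\<close> of \<open>bilinear_extension\<close>.\<close>
  have eq: "{a \<otimes>\<^bsub>T\<^esub> b | a b. a \<in> koszul_W K V R0 p \<and> b \<in> tensor_power K V 1}
    = {w \<otimes>\<^bsub>T\<^esub> pure_tensor K V [x] | w x. w \<in> koszul_W K V R0 p \<and> x \<in> carrier V}"
    unfolding tensor_power_1 by blast
  show ?thesis
    unfolding right_mult_def tensor_prod_def eq
  proof (rule theI'[OF bilinear_extension[where D = "\<lambda>b t. q (rstrip b (qinv t))" and \<nu> = "\<lambda>a x. a \<otimes>\<^bsub>A\<^esub> koszul_e K V R0 x"]])
    show "q (rstrip b (qinv (w \<otimes>\<^bsub>T\<^esub> pure_tensor K V [x]))) = coord x b \<odot>\<^bsub>T\<^esub> w"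
      if b: "b \<in> B" and w: "w \<in> koszul_W K V R0 p" and x: "x \<in> carrier V" for b w x
    proof -
      have w': "w \<in> carrier T" using w koszul_W_subset by blast
      have "w \<otimes>\<^bsub>T\<^esub> pure_tensor K V [x] = q (qinv w \<otimes>\<^bsub>G\<^esub> lin_word x)"
        using w' x by (simp add: q_mult qinv_closed lin_word_closed q_qinv pure_letter)
      then show ?thesis using w' x b
        by (simp add: qinv_q qinv_closed lin_word_closed rstrip_mult module_hom_smult[OF q_hom] q_qinv coord_closed)
    qed
  qed (use koszul_W_submodule koszul_W_subset cochainD(1)[OF f] pure_letter_closed koszul_e_hom in
      \<open>auto intro!: module_hom_comp[OF qinv_hom module_hom_comp[OF rstrip_hom q_hom]] AA.mult_right_hom
        module_hom_comp[OF koszul_e_hom AA.mult_left_hom] TT.scal.module_axioms AA.scal.module_axioms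
        simp: subset_iff module_hom_closed[THEN funcset_mem]\<close>)
qed

lemma left_mult:
  assumes f: "f \<in> carrier (koszul_cochains K V R0 p)"
  shows "left_mult K V R0 p f \<in> carrier (Hom_module K
      (T\<lparr>carrier := tensor_prod K V (tensor_power K V 1) (koszul_W K V R0 p)\<rparr>) A) \<and>
    (\<forall>x\<in>carrier V. \<forall>w\<in>koszul_W K V R0 p. left_mult K V R0 p f (pure_tensor K V [x] \<otimes>\<^bsub>T\<^esub> w)
        = koszul_e K V R0 x \<otimes>\<^bsub>A\<^esub> f w)"
proof -
  have eq: "{a \<otimes>\<^bsub>T\<^esub> b | a b. a \<in> tensor_power K V 1 \<and> b \<in> koszul_W K V R0 p}
    = {pure_tensor K V [x] \<otimes>\<^bsub>T\<^esub> w | w x. w \<in> koszul_W K V R0 p \<and> x \<in> carrier V}"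
    unfolding tensor_power_1 by blast
  \<comment> \<open>In \<open>bilinear_extension\<close> the element of \<open>W\<close> is
    quantified before the vector, here after it.\<close>
  have swap: "(\<forall>x\<in>carrier V. \<forall>w\<in>koszul_W K V R0 p. P x w) \<longleftrightarrow> (\<forall>w\<in>koszul_W K V R0 p. \<forall>x\<in>carrier V. P x w)" for P
    by blast
  show ?thesis
    unfolding left_mult_def tensor_prod_def eq swap
  proof (rule theI'[OF bilinear_extension[where D = "\<lambda>b t. q (lstrip b (qinv t))" and \<nu> = "\<lambda>a x. koszul_e K V R0 x \<otimes>\<^bsub>A\<^esub> a"]])
    show "q (lstrip b (qinv (pure_tensor K V [x] \<otimes>\<^bsub>T\<^esub> w))) = coord x b \<odot>\<^bsub>T\<^esub> w"
      if b: "b \<in> B" and w: "w \<in> koszul_W K V R0 p" and x: "x \<in> carrier V" for b w x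
    proof -
      have w': "w \<in> carrier T" using w koszul_W_subset by blast
      have "pure_tensor K V [x] \<otimes>\<^bsub>T\<^esub> w = q (lin_word x \<otimes>\<^bsub>G\<^esub> qinv w)"
        using w' x by (simp add: q_mult qinv_closed lin_word_closed q_qinv pure_letter)
      then show ?thesis using w' x b
        by (simp add: qinv_q qinv_closed lin_word_closed lstrip_mult module_hom_smult[OF q_hom] q_qinv coord_closed)
    qed
  qed (use koszul_W_submodule koszul_W_subset cochainD(1)[OF f] pure_letter_closed koszul_e_hom in
      \<open>auto intro!: module_hom_comp[OF qinv_hom module_hom_comp[OF lstrip_hom q_hom]] AA.mult_left_hom
        module_hom_comp[OF koszul_e_hom AA.mult_right_hom] TT.scal.module_axioms AA.scal.module_axioms
        simp: subset_iff module_hom_closed[THEN funcset_mem]\<close>)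
qed

end

section \<open>Higher Koszul cohomology of the tensor algebra\<close>

locale koszul_tensor = based_space K V B
  for K :: "('k, 'b) ring_scheme" and V :: "('k, 'v, 'c) module_scheme" and B :: "'v set" +
  assumes card_B: "2 \<le> card B"
begin

section \<open>\<open>A\<close> as the free algebra on a basis\<close>

abbreviation "C \<equiv> koszul_cochains K V R0"
abbreviation "b_K \<equiv> koszul_b K V R0"
abbreviation "W \<equiv> koszul_W K V R0"
abbreviation "e_K \<equiv> koszul_e K V R0"
abbreviation "A_comp \<equiv> quadratic_component K V R0"

text \<open>With \<open>gam\<close> as its inverse, this is the algebra isomorphism between
  \<open>G\<close> and \<open>A\<close>; it carries coefficient arguments on words to the values of
  cochains.\<close>

definition alpha :: "('v list \<Rightarrow> 'k) \<Rightarrow> ('k, 'v) tensor set" where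
  "alpha g = pr (q g)"

definition gam :: "('k, 'v) tensor set \<Rightarrow> 'v list \<Rightarrow> 'k" where
  "gam a = qinv (the_inv_into (carrier T) pr a)"

lemma alpha_hom: "alpha \<in> module_hom K G A"
  unfolding alpha_def by (rule module_hom_comp[OF q_hom pr_hom])

lemma gam_hom: "gam \<in> module_hom K A G"
  unfolding gam_def
  by (rule module_hom_comp[OF module_hom_the_inv_into[OF TT.scal.module_axioms pr_hom pr_bij] qinv_hom])

lemma alpha_closed: "g \<in> carrier G \<Longrightarrow> alpha g \<in> carrier A"
  using module_hom_closed[OF alpha_hom] by blast

lemma gam_closed: "a \<in> carrier A \<Longrightarrow> gam a \<in> carrier G"
  using module_hom_closed[OF gam_hom] by blast

lemma gam_alpha: "g \<in> carrier G \<Longrightarrow> gam (alpha g) = g"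
  using pr_bij by (simp add: gam_def alpha_def the_inv_into_f_f bij_betw_def q_closed qinv_q)

lemma alpha_gam:
  assumes "a \<in> carrier A" shows "alpha (gam a) = a"
proof -
  have "the_inv_into (carrier T) pr a \<in> carrier T"
    using pr_bij assms the_inv_into_into[of pr "carrier T" a "carrier T"] by (simp add: bij_betw_def)
  then show ?thesis
    using f_the_inv_into_f_bij_betw[OF pr_bij, of a] assms by (simp add: gam_def alpha_def q_qinv)
qed

lemma alpha_mult: "g \<in> carrier G \<Longrightarrow> h \<in> carrier G \<Longrightarrow> alpha (g \<otimes>\<^bsub>G\<^esub> h) = alpha g \<otimes>\<^bsub>A\<^esub> alpha h"
  by (simp add: alpha_def q_mult pr_mult q_closed)

lemma alpha_one: "alpha \<one>\<^bsub>G\<^esub> = \<one>\<^bsub>A\<^esub>"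
  by (simp add: alpha_def one_T[symmetric] pr_one)

lemma alpha_inject: "g \<in> carrier G \<Longrightarrow> h \<in> carrier G \<Longrightarrow> alpha g = alpha h \<Longrightarrow> g = h"
  by (metis gam_alpha)

lemma alpha_zero: "alpha \<zero>\<^bsub>G\<^esub> = \<zero>\<^bsub>A\<^esub>"
  using mod_hom.f0_is_0[of K G A alpha] alpha_hom GG.scal.module_axioms AA.scal.module_axioms
  by (simp add: mod_hom_def mod_hom_axioms_def)

lemma e_K_alpha: "v \<in> carrier V \<Longrightarrow> e_K v = alpha (lin_word v)"
  by (simp add: koszul_e_eq pure_letter alpha_def)

lemma e_K_closed: "v \<in> carrier V \<Longrightarrow> e_K v \<in> carrier A"
  by (simp add: e_K_alpha alpha_closed lin_word_closed)

lemma e_K_inject: "v \<in> carrier V \<Longrightarrow> w \<in> carrier V \<Longrightarrow> e_K v = e_K w \<Longrightarrow> v = w"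
  using alpha_inject lin_word_closed lin_word_inject by (simp add: e_K_alpha)

lemma A_comp_eq: "A_comp m = alpha ` homog m"
  by (simp add: quadratic_component_def tensor_power_eq alpha_def image_image)

section \<open>The centre of \<open>A\<close>\<close>

lemma commuting_letters:
  assumes h: "h \<in> carrier G" and comm: "\<And>b. b \<in> B \<Longrightarrow> h \<otimes>\<^bsub>G\<^esub> word K [b] = word K [b] \<otimes>\<^bsub>G\<^esub> h"
  shows "h \<in> homog 0"
proof -
  have "h w = \<zero>\<^bsub>K\<^esub>" if w: "w = x # u" for w x u
  proof -
    have "\<not> B \<subseteq> {x}" using card_B card_mono[of "{x}" B] by auto
    then obtain b where b: "b \<in> B" "b \<noteq> x" by blast
    have "h w = (h \<otimes>\<^bsub>G\<^esub> word K [b]) (w @ [b])" using h by (simp add: conv_letter_G)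
    also have "\<dots> = (word K [b] \<otimes>\<^bsub>G\<^esub> h) (w @ [b])" using comm b by simp
    also have "\<dots> = \<zero>\<^bsub>K\<^esub>" using w b h by (simp add: letter_conv_G)
    finally show ?thesis .
  qed
  then show ?thesis using h by (auto simp: homog_def) (metis neq_Nil_conv)
qed

text \<open>Commuting with vectors is what the cocycle condition in degree 0 gives. After transport
  to \<open>G\<close> it becomes commuting with the letters, and an element of degree 0 is a
  multiple of one.\<close>

lemma center_scalar:
  assumes a: "a \<in> carrier A" and comm: "\<And>v. v \<in> carrier V \<Longrightarrow> a \<otimes>\<^bsub>A\<^esub> e_K v = e_K v \<otimes>\<^bsub>A\<^esub> a"
  shows "\<exists>c\<in>carrier K. a = c \<odot>\<^bsub>A\<^esub> \<one>\<^bsub>A\<^esub>"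
proof -
  have "gam a \<otimes>\<^bsub>G\<^esub> word K [b] = word K [b] \<otimes>\<^bsub>G\<^esub> gam a" if b: "b \<in> B" for b
  proof (rule alpha_inject)
    have w: "word K [b] \<in> carrier G" using b by (intro R.word_mem) simp
    then show "gam a \<otimes>\<^bsub>G\<^esub> word K [b] \<in> carrier G" "word K [b] \<otimes>\<^bsub>G\<^esub> gam a \<in> carrier G"
      using gam_closed[OF a] by auto
    show "alpha (gam a \<otimes>\<^bsub>G\<^esub> word K [b]) = alpha (word K [b] \<otimes>\<^bsub>G\<^esub> gam a)"
      using comm[OF B_closed[OF b]] w gam_closed[OF a] b B_closed
      by (simp add: alpha_mult alpha_gam[OF a] e_K_alpha lin_word_basis)
  qed
  then have "gam a \<in> homog 0" by (intro commuting_letters gam_closed a)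
  then obtain c where c: "c \<in> carrier K" "gam a = c \<odot>\<^bsub>G\<^esub> \<one>\<^bsub>G\<^esub>" by (auto simp: homog_0)
  then have "a = c \<odot>\<^bsub>A\<^esub> \<one>\<^bsub>A\<^esub>"
    using alpha_gam[OF a] module_hom_smult[OF alpha_hom, of c "\<one>\<^bsub>G\<^esub>"] by (simp add: alpha_one)
  then show ?thesis using c by blast
qed

text \<open>The coefficient of the empty word recovers the scalar, so \<open>K\<close> embeds in
  \<open>A\<close>.\<close>

lemma scalar_mult_one_inject:
  assumes "c \<in> carrier K" "c \<odot>\<^bsub>A\<^esub> \<one>\<^bsub>A\<^esub> = \<zero>\<^bsub>A\<^esub>"
  shows "c = \<zero>\<^bsub>K\<^esub>"
proof -
  have "alpha (c \<odot>\<^bsub>G\<^esub> \<one>\<^bsub>G\<^esub>) = alpha \<zero>\<^bsub>G\<^esub>"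
    using assms module_hom_smult[OF alpha_hom, of c "\<one>\<^bsub>G\<^esub>"] by (simp add: alpha_one alpha_zero)
  then have "c \<odot>\<^bsub>G\<^esub> \<one>\<^bsub>G\<^esub> = \<zero>\<^bsub>G\<^esub>" using assms by (intro alpha_inject) auto
  then show ?thesis using assms fun_cong[of _ _ "[]"] by (auto simp: free_algebra_simps word_def dest!: fun_cong[of _ _ "[]"])
qed

subsection \<open>Projections onto the homogeneous components\<close>

lemma zero_hom: "(\<lambda>x. \<zero>\<^bsub>G\<^esub>) \<in> module_hom K V G"
  by (simp add: module_hom_def)

text \<open>A product with a vector has one letter more in each of its words. So degree components
  shift by one, and nothing reaches degree 0; this shift is the source of the separation of
  weights.\<close>

lemma proj_mult_letter:
  assumes h: "h \<in> carrier G" and x: "x \<in> carrier V"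
  shows "proj (Suc n) (h \<otimes>\<^bsub>G\<^esub> lin_word x) = proj n h \<otimes>\<^bsub>G\<^esub> lin_word x"
    and "proj (Suc n) (lin_word x \<otimes>\<^bsub>G\<^esub> h) = lin_word x \<otimes>\<^bsub>G\<^esub> proj n h"
    and "proj 0 (h \<otimes>\<^bsub>G\<^esub> lin_word x) = \<zero>\<^bsub>G\<^esub>"
    and "proj 0 (lin_word x \<otimes>\<^bsub>G\<^esub> h) = \<zero>\<^bsub>G\<^esub>"
proof -
  note R = module_hom_comp[OF lin_word_hom module_hom_comp[OF GG.mult_left_hom[OF h] proj_hom]]
  note L = module_hom_comp[OF lin_word_hom module_hom_comp[OF GG.mult_right_hom[OF h] proj_hom]]
  note p = proj_closed[OF h]
  show "proj (Suc n) (h \<otimes>\<^bsub>G\<^esub> lin_word x) = proj n h \<otimes>\<^bsub>G\<^esub> lin_word x"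
    by (rule hom_eq_on_basis[OF GG.scal.module_axioms R module_hom_comp[OF lin_word_hom GG.mult_left_hom[OF p]] _ x])
      (auto simp: lin_word_basis conv_letter_G h p fun_eq_iff proj_def[of _ "_ \<otimes>\<^bsub>G\<^esub> _"], auto simp: proj_def)
  show "proj (Suc n) (lin_word x \<otimes>\<^bsub>G\<^esub> h) = lin_word x \<otimes>\<^bsub>G\<^esub> proj n h"
    by (rule hom_eq_on_basis[OF GG.scal.module_axioms L module_hom_comp[OF lin_word_hom GG.mult_right_hom[OF p]] _ x])
      (auto simp: lin_word_basis letter_conv_G h p fun_eq_iff proj_def[of _ "_ \<otimes>\<^bsub>G\<^esub> _"] split: list.splits, auto simp: proj_def)
  show "proj 0 (h \<otimes>\<^bsub>G\<^esub> lin_word x) = \<zero>\<^bsub>G\<^esub>"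
    by (rule hom_eq_on_basis[OF GG.scal.module_axioms R zero_hom _ x])
      (auto simp: lin_word_basis conv_letter_G h proj_def free_algebra_simps(3))
  show "proj 0 (lin_word x \<otimes>\<^bsub>G\<^esub> h) = \<zero>\<^bsub>G\<^esub>"
    by (rule hom_eq_on_basis[OF GG.scal.module_axioms L zero_hom _ x])
      (auto simp: lin_word_basis letter_conv_G h proj_def free_algebra_simps(3) fun_eq_iff)
qed

definition projA :: "nat \<Rightarrow> ('k, 'v) tensor set \<Rightarrow> ('k, 'v) tensor set" where
  "projA n a = alpha (proj n (gam a))"

lemma projA_hom: "projA n \<in> module_hom K A A"
  unfolding projA_def by (rule module_hom_comp[OF gam_hom module_hom_comp[OF proj_hom alpha_hom]])

lemma projA_mod_hom: "mod_hom K A A (projA n)"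
  using projA_hom AA.scal.module_axioms by (simp add: mod_hom_def mod_hom_axioms_def)

lemma projA_comp: "a \<in> carrier A \<Longrightarrow> projA n a \<in> A_comp n"
  by (simp add: projA_def A_comp_eq proj_homog gam_closed)

lemma A_comp_subset: "A_comp n \<subseteq> carrier A"
  by (auto simp: A_comp_eq homog_def alpha_closed)

lemma projA_closed: "a \<in> carrier A \<Longrightarrow> projA n a \<in> carrier A"
  using projA_comp A_comp_subset by blast

lemma projA_id: "a \<in> A_comp n \<Longrightarrow> projA n a = a"
  by (auto simp: A_comp_eq projA_def gam_alpha homog_def proj_id)

lemma projA_e: "v \<in> carrier V \<Longrightarrow> projA n (e_K v) = (if n = 1 then e_K v else \<zero>\<^bsub>A\<^esub>)"
  using lin_word_homog[of v]
  by (simp add: e_K_alpha projA_def gam_alpha lin_word_closed proj_id proj_other alpha_zero)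

lemma projA_mult:
  assumes a: "a \<in> carrier A" and v: "v \<in> carrier V"
  shows "projA (Suc n) (a \<otimes>\<^bsub>A\<^esub> e_K v) = projA n a \<otimes>\<^bsub>A\<^esub> e_K v"
    and "projA (Suc n) (e_K v \<otimes>\<^bsub>A\<^esub> a) = e_K v \<otimes>\<^bsub>A\<^esub> projA n a"
    and "projA 0 (a \<otimes>\<^bsub>A\<^esub> e_K v) = \<zero>\<^bsub>A\<^esub>"
    and "projA 0 (e_K v \<otimes>\<^bsub>A\<^esub> a) = \<zero>\<^bsub>A\<^esub>"
proof -
  have *: "a \<otimes>\<^bsub>A\<^esub> e_K v = alpha (gam a \<otimes>\<^bsub>G\<^esub> lin_word v)" "e_K v \<otimes>\<^bsub>A\<^esub> a = alpha (lin_word v \<otimes>\<^bsub>G\<^esub> gam a)"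
    using a v by (simp_all add: alpha_mult gam_closed lin_word_closed alpha_gam e_K_alpha)
  have "gam (a \<otimes>\<^bsub>A\<^esub> e_K v) = gam a \<otimes>\<^bsub>G\<^esub> lin_word v" "gam (e_K v \<otimes>\<^bsub>A\<^esub> a) = lin_word v \<otimes>\<^bsub>G\<^esub> gam a"
    unfolding * using a v by (simp_all add: gam_alpha gam_closed lin_word_closed)
  then show "projA (Suc n) (a \<otimes>\<^bsub>A\<^esub> e_K v) = projA n a \<otimes>\<^bsub>A\<^esub> e_K v"
    and "projA (Suc n) (e_K v \<otimes>\<^bsub>A\<^esub> a) = e_K v \<otimes>\<^bsub>A\<^esub> projA n a"
    and "projA 0 (a \<otimes>\<^bsub>A\<^esub> e_K v) = \<zero>\<^bsub>A\<^esub>"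
    and "projA 0 (e_K v \<otimes>\<^bsub>A\<^esub> a) = \<zero>\<^bsub>A\<^esub>"
    using a v
    by (simp_all add: projA_def gam_closed lin_word_closed proj_mult_letter alpha_mult proj_closed
        e_K_alpha alpha_zero)
qed

lemma A_comp_0: "A_comp 0 = {c \<odot>\<^bsub>A\<^esub> \<one>\<^bsub>A\<^esub> | c. c \<in> carrier K}"
  unfolding A_comp_eq homog_0
  by (auto simp: module_hom_smult[OF alpha_hom] alpha_one image_iff) (metis GG.one_closed alpha_hom alpha_one module_hom_smult)

lemma A_comp_1: "A_comp 1 = e_K ` carrier V"
  unfolding A_comp_eq homog_1 by (auto simp: e_K_alpha)

lemma A_comp_0_commutes:
  assumes "a \<in> A_comp 0" "x \<in> carrier A"
  shows "a \<otimes>\<^bsub>A\<^esub> x = x \<otimes>\<^bsub>A\<^esub> a"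
  using assms by (auto simp: A_comp_0 AA.smult_mult_left AA.smult_mult_right)

subsection \<open>The Koszul complex in low degrees\<close>

lemma W_0: "W 0 = {c \<odot>\<^bsub>T\<^esub> \<one>\<^bsub>T\<^esub> | c. c \<in> carrier K}"
  by (simp add: koszul_W_small tensor_power_0)

lemma W_1: "W 1 = {pure_tensor K V [v] | v. v \<in> carrier V}"
  using koszul_W_small[of 1] tensor_power_1 by simp

lemma pure_W_1: "v \<in> carrier V \<Longrightarrow> pure_tensor K V [v] \<in> W 1"
  unfolding W_1 by blast

lemma one_W_0: "\<one>\<^bsub>T\<^esub> \<in> W 0"
  unfolding W_0 by (force intro: exI[of _ "\<one>\<^bsub>K\<^esub>"])

lemma W_module: "module K (T\<lparr>carrier := W p\<rparr>)"
  by (rule TT.scal.submodule_is_module[OF koszul_W_submodule])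

lemma C_module: "module K (C p)"
  unfolding koszul_cochains_def by (rule Hom_module_module[OF W_module AA.scal.module_axioms])

sublocale CC: module K "C p" for p by (rule C_module)

lemma C_simps:
  "carrier (C p) = module_hom K (T\<lparr>carrier := W p\<rparr>) A \<inter> extensional (W p)"
  "\<zero>\<^bsub>C p\<^esub> = (\<lambda>x\<in>W p. \<zero>\<^bsub>A\<^esub>)"
  "f \<oplus>\<^bsub>C p\<^esub> g = (\<lambda>x\<in>W p. f x \<oplus>\<^bsub>A\<^esub> g x)"
  "c \<odot>\<^bsub>C p\<^esub> f = (\<lambda>x\<in>W p. c \<odot>\<^bsub>A\<^esub> f x)"
  by (simp_all add: koszul_cochains_def Hom_module_def)

lemma C_closed: "f \<in> carrier (C p) \<Longrightarrow> w \<in> W p \<Longrightarrow> f w \<in> carrier A"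
  by (auto simp: C_simps module_hom_def)

text \<open>Values on vectors suffice, since \<open>W 1\<close> consists of vectors and cochains are
  fixed outside their domain.\<close>

lemma C1_eqI:
  assumes "f \<in> carrier (C 1)" "g \<in> carrier (C 1)"
    and "\<And>v. v \<in> carrier V \<Longrightarrow> f (pure_tensor K V [v]) = g (pure_tensor K V [v])"
  shows "f = g"
proof (rule extensionalityI[of _ "W 1"])
  show "f w = g w" if "w \<in> W 1" for w
    using that assms(3) unfolding W_1 by blast
qed (use assms in \<open>simp_all add: C_simps(1)\<close>)

lemma restrict_C: "f \<in> module_hom K T A \<Longrightarrow> (\<lambda>w\<in>W p. f w) \<in> carrier (C p)"
  using koszul_W_subset[of p] submodule.m_closed[OF koszul_W_submodule[of p]]
    submodule.smult_closed[OF koszul_W_submodule[of p]]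
  by (auto simp: C_simps(1) module_hom_def subset_iff)

section \<open>Inner derivations and the fundamental cochain\<close>

definition ad :: "('k, 'v) tensor set \<Rightarrow> ('k, 'v) tensor \<Rightarrow> ('k, 'v) tensor set" where
  "ad a = (\<lambda>w\<in>W 1. a \<otimes>\<^bsub>A\<^esub> pr w \<ominus>\<^bsub>A\<^esub> pr w \<otimes>\<^bsub>A\<^esub> a)"

text \<open>The fundamental cochain as an element of \<open>C 1\<close>: \<open>koszul_e\<close> has
  domain \<open>V\<close>, whereas cochains live on the copy \<open>W 1\<close> of \<open>V\<close>
  inside \<open>T\<close>.\<close>

definition e_C :: "('k, 'v) tensor \<Rightarrow> ('k, 'v) tensor set" where
  "e_C = (\<lambda>w\<in>W 1. pr w)"

lemma minus_hom:
  assumes "f \<in> module_hom K M A" "g \<in> module_hom K M A"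
  shows "(\<lambda>x. f x \<ominus>\<^bsub>A\<^esub> g x) \<in> module_hom K M A"
  using assms
  by (auto simp: module_hom_def Pi_iff AA.minus_eq AA.minus_add AA.a_ac AA.scal.smult_r_distr AA.scal.smult_r_minus)

lemma ad_closed: "a \<in> carrier A \<Longrightarrow> ad a \<in> carrier (C 1)"
  unfolding ad_def
  by (intro restrict_C minus_hom module_hom_comp[OF pr_hom AA.mult_left_hom] module_hom_comp[OF pr_hom AA.mult_right_hom])

lemma e_C_closed: "e_C \<in> carrier (C 1)"
  unfolding e_C_def by (rule restrict_C[OF pr_hom])

lemma ad_pure: "v \<in> carrier V \<Longrightarrow> ad a (pure_tensor K V [v]) = a \<otimes>\<^bsub>A\<^esub> e_K v \<ominus>\<^bsub>A\<^esub> e_K v \<otimes>\<^bsub>A\<^esub> a"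
  by (simp add: ad_def pure_W_1[simplified] koszul_e_eq)

lemma e_C_pure: "v \<in> carrier V \<Longrightarrow> e_C (pure_tensor K V [v]) = e_K v"
  by (simp add: e_C_def pure_W_1[simplified] koszul_e_eq)

lemma C1_add_pure: "v \<in> carrier V \<Longrightarrow> (f \<oplus>\<^bsub>C 1\<^esub> g) (pure_tensor K V [v]) = f (pure_tensor K V [v]) \<oplus>\<^bsub>A\<^esub> g (pure_tensor K V [v])"
  by (simp only: C_simps(3) pure_W_1 restrict_apply if_True)

lemma C1_smult_pure: "v \<in> carrier V \<Longrightarrow> (c \<odot>\<^bsub>C 1\<^esub> g) (pure_tensor K V [v]) = c \<odot>\<^bsub>A\<^esub> g (pure_tensor K V [v])"
  by (simp only: C_simps(4) pure_W_1 restrict_apply if_True)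

lemma C1_zero_pure: "v \<in> carrier V \<Longrightarrow> \<zero>\<^bsub>C 1\<^esub> (pure_tensor K V [v]) = \<zero>\<^bsub>A\<^esub>"
  by (simp only: C_simps(2) pure_W_1 restrict_apply if_True)

lemma minus_a_ac:
  assumes "x \<in> carrier A" "y \<in> carrier A" "z \<in> carrier A" "t \<in> carrier A"
  shows "(x \<oplus>\<^bsub>A\<^esub> y) \<ominus>\<^bsub>A\<^esub> (z \<oplus>\<^bsub>A\<^esub> t) = (x \<ominus>\<^bsub>A\<^esub> z) \<oplus>\<^bsub>A\<^esub> (y \<ominus>\<^bsub>A\<^esub> t)"
  using assms by (simp add: AA.minus_eq AA.minus_add AA.a_ac)

lemma ad_hom: "ad \<in> module_hom K A (C 1)"
proof -
  have "ad (a \<oplus>\<^bsub>A\<^esub> a') = ad a \<oplus>\<^bsub>C 1\<^esub> ad a'" if a: "a \<in> carrier A" "a' \<in> carrier A" for a a'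
    using a by (intro C1_eqI ad_closed CC.M.a_closed AA.a_closed)
      (simp_all only: C1_add_pure ad_pure AA.l_distr AA.r_distr e_K_closed minus_a_ac AA.m_closed)
  moreover have "ad (c \<odot>\<^bsub>A\<^esub> a) = c \<odot>\<^bsub>C 1\<^esub> ad a" if c: "c \<in> carrier K" "a \<in> carrier A" for c a
    using c by (intro C1_eqI ad_closed CC.smult_closed AA.scal.smult_closed)
      (simp_all only: C1_smult_pure ad_pure AA.smult_mult_left AA.smult_mult_right e_K_closed AA.m_closed
        AA.minus_eq AA.scal.smult_r_distr AA.scal.smult_r_minus AA.a_inv_closed)
  ultimately show ?thesis by (auto simp: module_hom_def ad_closed[simplified])
qed

section \<open>The differentials in degree zero\<close>

lemma right_mult_apply:
  assumes "f \<in> carrier (C p)" "w \<in> W p" "x \<in> carrier V"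
  shows "right_mult K V R0 p f (w \<otimes>\<^bsub>T\<^esub> pure_tensor K V [x]) = f w \<otimes>\<^bsub>A\<^esub> e_K x"
  using right_mult[OF assms(1)] assms by blast

lemma left_mult_apply:
  assumes "f \<in> carrier (C p)" "w \<in> W p" "x \<in> carrier V"
  shows "left_mult K V R0 p f (pure_tensor K V [x] \<otimes>\<^bsub>T\<^esub> w) = e_K x \<otimes>\<^bsub>A\<^esub> f w"
  using left_mult[OF assms(1)] assms by blast

text \<open>A vector is the product of itself with the unit of \<open>T\<close>, which spans
  \<open>W 0\<close>; a cochain of degree 0 thus enters only through its value at one.\<close>

lemma left_mult_0:
  assumes f: "f \<in> carrier (C 0)" and v: "v \<in> carrier V"
  shows "left_mult K V R0 0 f (pure_tensor K V [v]) = e_K v \<otimes>\<^bsub>A\<^esub> f \<one>\<^bsub>T\<^esub>"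
  using left_mult_apply[OF f one_W_0 v] v by (simp add: pure_letter_closed)

lemma right_mult_0:
  assumes f: "f \<in> carrier (C 0)" and v: "v \<in> carrier V"
  shows "right_mult K V R0 0 f (pure_tensor K V [v]) = f \<one>\<^bsub>T\<^esub> \<otimes>\<^bsub>A\<^esub> e_K v"
  using right_mult_apply[OF f one_W_0 v] v by (simp add: pure_letter_closed)

lemma koszul_b_0:
  assumes f: "f \<in> carrier (C 0)" shows "b_K 0 f = ad (f \<one>\<^bsub>T\<^esub>)"
proof (rule extensionalityI[of _ "W 1"])
  show "b_K 0 f x = ad (f \<one>\<^bsub>T\<^esub>) x" if x: "x \<in> W 1" for x
  proof -
    obtain v where v: "x = pure_tensor K V [v]" "v \<in> carrier V" using x unfolding W_1 by blast
    then show ?thesis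
      using x C_closed[OF f one_W_0] e_K_closed[OF v(2)]
      by (simp add: koszul_b_def left_mult_0[OF f] right_mult_0[OF f] ad_pure)
  qed
qed (simp_all add: koszul_b_def ad_def)

lemma cup_e_0:
  assumes f: "f \<in> carrier (C 0)"
  shows "cup_e K V R0 0 f = (\<lambda>w\<in>W 1. pr w \<otimes>\<^bsub>A\<^esub> f \<one>\<^bsub>T\<^esub>)"
proof (rule extensionalityI[of _ "W 1"])
  show "cup_e K V R0 0 f x = (\<lambda>w\<in>W 1. pr w \<otimes>\<^bsub>A\<^esub> f \<one>\<^bsub>T\<^esub>) x" if x: "x \<in> W 1" for x
  proof -
    obtain v where v: "x = pure_tensor K V [v]" "v \<in> carrier V" using x unfolding W_1 by blast
    then show ?thesis
      using x C_closed[OF f one_W_0] e_K_closed[OF v(2)] koszul_e_eq[OF v(2)]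
      by (simp add: cup_e_def left_mult_0[OF f])
  qed
qed (simp_all add: cup_e_def)

lemma cochain_0_exists:
  assumes a: "a \<in> carrier A"
  shows "\<exists>f\<in>carrier (C 0). f \<one>\<^bsub>T\<^esub> = a"
proof -
  \<comment> \<open>The coefficient of the empty word is the coordinate with respect to one, so this
    map sends one to \<open>a\<close>.\<close>
  let ?f = "\<lambda>t. (qinv t) [] \<odot>\<^bsub>A\<^esub> a"
  have K: "qinv t [] \<in> carrier K" if "t \<in> carrier T" for t
    using R.free_algebra_carrierD(1)[OF qinv_closed[OF that]] .
  have "?f \<in> module_hom K T A"
    using a K by (auto simp: module_hom_def module_hom_add[OF qinv_hom] module_hom_smult[OF qinv_hom]
        free_algebra_simps(4,5) AA.scal.smult_l_distr AA.scal.smult_assoc1)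
  then have "(\<lambda>w\<in>W 0. ?f w) \<in> carrier (C 0)" by (rule restrict_C)
  moreover have "(\<lambda>w\<in>W 0. ?f w) \<one>\<^bsub>T\<^esub> = a"
    using a one_W_0 qinv_q[OF GG.one_closed] by (simp add: one_T) (simp add: free_algebra_simps(2) word_def)
  ultimately show ?thesis by blast
qed

lemma cochain_0_eqI:
  assumes f: "f \<in> carrier (C 0)" and "f \<one>\<^bsub>T\<^esub> = \<zero>\<^bsub>A\<^esub>"
  shows "f = \<zero>\<^bsub>C 0\<^esub>"
proof (rule extensionalityI[of _ "W 0"])
  show "f x = \<zero>\<^bsub>C 0\<^esub> x" if x: "x \<in> W 0" for x
  proof -
    obtain c where c: "x = c \<odot>\<^bsub>T\<^esub> \<one>\<^bsub>T\<^esub>" "c \<in> carrier K" using x unfolding W_0 by blast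
    then have "f x = c \<odot>\<^bsub>A\<^esub> f \<one>\<^bsub>T\<^esub>" using f one_W_0 by (auto simp: C_simps(1) module_hom_def)
    then show ?thesis using assms c x by (simp add: C_simps(2))
  qed
qed (use f in \<open>auto simp: C_simps(1,2)\<close>)

section \<open>Vanishing above degree one\<close>

lemma C_large: assumes "2 \<le> p" shows "carrier (C p) = {\<zero>\<^bsub>C p\<^esub>}"
proof -
  have "f = \<zero>\<^bsub>C p\<^esub>" if f: "f \<in> carrier (C p)" for f
  proof (rule extensionalityI[of _ "W p"])
    have "mod_hom K (T\<lparr>carrier := W p\<rparr>) A f"
      using f W_module AA.scal.module_axioms by (simp add: C_simps(1) mod_hom_def mod_hom_axioms_def)
    then have "f \<zero>\<^bsub>T\<^esub> = \<zero>\<^bsub>A\<^esub>" using mod_hom.f0_is_0 by fastforce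
    then show "f x = \<zero>\<^bsub>C p\<^esub> x" if "x \<in> W p" for x
      using that assms by (simp add: C_simps(2) koszul_W_large)
  qed (use f in \<open>auto simp: C_simps(1,2)\<close>)
  then show ?thesis using CC.M.zero_closed[of p] by blast
qed

lemma mult_zero:
  assumes p: "1 \<le> p" and f: "f \<in> carrier (C p)"
  shows "right_mult K V R0 p f \<zero>\<^bsub>T\<^esub> = \<zero>\<^bsub>A\<^esub>" "left_mult K V R0 p f \<zero>\<^bsub>T\<^esub> = \<zero>\<^bsub>A\<^esub>"
proof -
  have z: "\<zero>\<^bsub>T\<^esub> \<in> W p" using submodule.zero_closed[OF koszul_W_submodule] .
  have v: "\<zero>\<^bsub>V\<^esub> \<in> carrier V" by simp
  have e: "e_K \<zero>\<^bsub>V\<^esub> = \<zero>\<^bsub>A\<^esub>"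
    using mod_hom.f0_is_0[of K V A e_K] koszul_e_hom module_axioms AA.scal.module_axioms
    by (simp add: mod_hom_def mod_hom_axioms_def)
  \<comment> \<open>The zero tensor is written as a product, so that the defining equations of the
    two multiplications apply to it.\<close>
  have t: "\<zero>\<^bsub>T\<^esub> \<otimes>\<^bsub>T\<^esub> pure_tensor K V [\<zero>\<^bsub>V\<^esub>] = \<zero>\<^bsub>T\<^esub>" "pure_tensor K V [\<zero>\<^bsub>V\<^esub>] \<otimes>\<^bsub>T\<^esub> \<zero>\<^bsub>T\<^esub> = \<zero>\<^bsub>T\<^esub>"
    using pure_letter_closed[OF v] by simp_all
  show "right_mult K V R0 p f \<zero>\<^bsub>T\<^esub> = \<zero>\<^bsub>A\<^esub>"
    using right_mult_apply[OF f z v] C_closed[OF f z] e t by simp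
  show "left_mult K V R0 p f \<zero>\<^bsub>T\<^esub> = \<zero>\<^bsub>A\<^esub>"
    using left_mult_apply[OF f z v] C_closed[OF f z] e t by simp
qed

lemma sign_closed: "(\<ominus>\<^bsub>K\<^esub> \<one>\<^bsub>K\<^esub>) [^]\<^bsub>K\<^esub> (p::nat) \<in> carrier K"
  by simp

text \<open>The target cochains live on \<open>W (Suc p)\<close>, which is zero since
  \<open>Suc p\<close> is at least 2; only the value at the zero tensor matters.\<close>

lemma b_cup_large:
  assumes p: "1 \<le> p" and f: "f \<in> carrier (C p)"
  shows "b_K p f = \<zero>\<^bsub>C (Suc p)\<^esub>" "cup_e K V R0 p f = \<zero>\<^bsub>C (Suc p)\<^esub>"
  using p mult_zero[OF p f] sign_closed[of p]
  by (auto simp: koszul_b_def cup_e_def C_simps(2) koszul_W_large restrict_def fun_eq_iff AA.minus_eq AA.r_neg)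

end

context koszul_tensor
begin

subsection \<open>Koszul cohomology\<close>

abbreviation "cob \<equiv> coboundaries C b_K"
abbreviation "H \<equiv> HK K V R0"
abbreviation "dH \<equiv> HK_diff K V R0"

lemma ad_mod_hom: "mod_hom K A (C 1) ad"
  using ad_hom AA.scal.module_axioms C_module by (simp add: mod_hom_def mod_hom_axioms_def)

lemma cob_1: "cob 1 = ad ` carrier A"
proof -
  have "cob 1 = b_K 0 ` carrier (C 0)" by (simp add: coboundaries_def)
  also have "\<dots> = (\<lambda>f. ad (f \<one>\<^bsub>T\<^esub>)) ` carrier (C 0)" by (intro image_cong refl koszul_b_0)
  also have "\<dots> = ad ` carrier A"
    using cochain_0_exists C_closed[OF _ one_W_0] by (auto simp: image_iff)
  finally show ?thesis .
qed

lemma cob_large: assumes "2 \<le> p" shows "cob p = {\<zero>\<^bsub>C p\<^esub>}"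
proof -
  obtain q where p: "p = Suc q" "1 \<le> q" using assms by (cases p) auto
  have "cob p = b_K q ` carrier (C q)" by (simp add: coboundaries_def p)
  also have "\<dots> = (\<lambda>_. \<zero>\<^bsub>C p\<^esub>) ` carrier (C q)"
    using b_cup_large(1)[OF p(2)] by (intro image_cong refl) (simp add: p)
  also have "\<dots> = {\<zero>\<^bsub>C p\<^esub>}" using CC.M.zero_closed[of q] by blast
  finally show ?thesis .
qed

lemma cob_submodule: assumes "1 \<le> p" shows "submodule K (cob p) (C p)"
proof (cases "p = 1")
  case True
  show ?thesis
    unfolding True cob_1 using mod_hom.im_is_submodule[OF ad_mod_hom] by (simp add: mod_hom.im_def[OF ad_mod_hom])
next
  case False
  then have "2 \<le> p" using assms by simp
  then show ?thesis using CC.submodule_zero by (simp add: cob_large)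
qed

lemma cob_module_submodule: "1 \<le> p \<Longrightarrow> module_submodule K (C p) (cob p)"
  using cob_submodule C_module by (simp add: module_submodule_def)

lemma cocycles_C: "1 \<le> p \<Longrightarrow> cocycles C b_K p = carrier (C p)"
  using b_cup_large(1) by (auto simp: cocycles_def)

lemma HK_eq: "1 \<le> p \<Longrightarrow> H p = quot_module (C p) (cob p)"
  by (simp add: HK_def cohomology_def cocycles_C)

lemma H_zero: "\<zero>\<^bsub>H p\<^esub> = cob p"
  by (simp add: HK_def cohomology_def quot_module_def)

lemma H_carrier: "1 \<le> p \<Longrightarrow> carrier (H p) = (\<lambda>f. cob p +>\<^bsub>C p\<^esub> f) ` carrier (C p)"
  by (simp add: HK_eq module_submodule.quot_module_carrier[OF cob_module_submodule])

lemma H_module: "1 \<le> p \<Longrightarrow> module K (H p)"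
  by (simp add: HK_eq module_submodule.quot_module_module[OF cob_module_submodule])

lemma H_large: assumes "2 \<le> p" shows "carrier (H p) = {\<zero>\<^bsub>H p\<^esub>}"
proof -
  have "carrier (H p) = {cob p +>\<^bsub>C p\<^esub> \<zero>\<^bsub>C p\<^esub>}"
    using assms H_carrier[of p] C_large[of p] by simp
  then show ?thesis
    using assms module_submodule.coset_eq_self_iff[OF cob_module_submodule, of p "\<zero>\<^bsub>C p\<^esub>"]
    by (simp add: H_zero cob_large)
qed

text \<open>\<open>HK_diff\<close> is a union over the representatives in \<open>X\<close>. Each of
  them contributes the zero class, and \<open>X\<close> is nonempty, so the union is that
  class.\<close>

lemma dH_large:
  assumes p: "1 \<le> p" and X: "X \<in> carrier (H p)"
  shows "dH p X = \<zero>\<^bsub>H (Suc p)\<^esub>"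
proof -
  interpret N: module_submodule K "C p" "cob p" using p by (rule cob_module_submodule)
  interpret N': module_submodule K "C (Suc p)" "cob (Suc p)" by (rule cob_module_submodule) simp
  obtain f where f: "f \<in> carrier (C p)" "X = cob p +>\<^bsub>C p\<^esub> f" using X p by (auto simp: H_carrier)
  have "X \<subseteq> carrier (C p)" using f N.S.subset CC.M.a_r_coset_subset_G by blast
  then have "cohomology_class C b_K (Suc p) (cup_e K V R0 p g) = cob (Suc p)" if "g \<in> X" for g
    using that b_cup_large(2)[OF p, of g] N'.coset_eq_self_iff[OF CC.M.zero_closed] N'.S.zero_closed
    by (auto simp: cohomology_class_def)
  moreover have "X \<noteq> {}" using f N.a_rcos_self by blast
  ultimately show ?thesis by (simp add: HK_diff_def H_zero)
qed

lemma coset_singleton_zero: "f \<in> carrier (C p) \<Longrightarrow> {\<zero>\<^bsub>C p\<^esub>} +>\<^bsub>C p\<^esub> f = {f}"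
  by (simp add: a_r_coset_def')

text \<open>Nothing bounds in degree 0, so a class there is a singleton and can be identified with
  its cocycle.\<close>

lemma H_0_carrier: "carrier (H 0) = (\<lambda>f. {f}) ` cocycles C b_K 0"
proof -
  have "carrier (H 0) = (\<lambda>f. {\<zero>\<^bsub>C 0\<^esub>} +>\<^bsub>C 0\<^esub> f) ` cocycles C b_K 0"
    by (simp add: HK_def cohomology_def coboundaries_def quot_module_carrier_update)
  also have "\<dots> = (\<lambda>f. {f}) ` cocycles C b_K 0"
    by (intro image_cong refl coset_singleton_zero) (simp add: cocycles_def)
  finally show ?thesis .
qed

lemma dH_0: "dH 0 {f} = cob 1 +>\<^bsub>C 1\<^esub> cup_e K V R0 0 f"
  by (simp add: HK_diff_def cohomology_class_def)

lemma cup_e_scalar: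
  assumes f: "f \<in> carrier (C 0)" and c: "c \<in> carrier K" "f \<one>\<^bsub>T\<^esub> = c \<odot>\<^bsub>A\<^esub> \<one>\<^bsub>A\<^esub>"
  shows "cup_e K V R0 0 f = c \<odot>\<^bsub>C 1\<^esub> e_C"
  unfolding cup_e_0[OF f] C_simps(4)
proof (rule restrict_ext)
  fix w assume w: "w \<in> W 1"
  then have "pr w \<in> carrier A" using koszul_W_subset pr_closed by blast
  then show "pr w \<otimes>\<^bsub>A\<^esub> f \<one>\<^bsub>T\<^esub> = c \<odot>\<^bsub>A\<^esub> e_C w"
    using w c by (simp only: e_C_def restrict_apply if_True AA.smult_mult_right AA.one_closed AA.r_one)
qed

lemma cocycle_0_scalar:
  assumes "f \<in> cocycles C b_K 0" shows "\<exists>c\<in>carrier K. f \<one>\<^bsub>T\<^esub> = c \<odot>\<^bsub>A\<^esub> \<one>\<^bsub>A\<^esub>"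
proof -
  have f: "f \<in> carrier (C 0)" and z: "ad (f \<one>\<^bsub>T\<^esub>) = \<zero>\<^bsub>C 1\<^esub>"
    using assms koszul_b_0[of f] by (auto simp: cocycles_def)
  have a: "f \<one>\<^bsub>T\<^esub> \<in> carrier A" by (rule C_closed[OF f one_W_0])
  show ?thesis
  proof (rule center_scalar[OF a])
    fix v assume v: "v \<in> carrier V"
    have "f \<one>\<^bsub>T\<^esub> \<otimes>\<^bsub>A\<^esub> e_K v \<ominus>\<^bsub>A\<^esub> e_K v \<otimes>\<^bsub>A\<^esub> f \<one>\<^bsub>T\<^esub> = \<zero>\<^bsub>A\<^esub>"
      using ad_pure[OF v] C1_zero_pure[OF v] z by metis
    then show "f \<one>\<^bsub>T\<^esub> \<otimes>\<^bsub>A\<^esub> e_K v = e_K v \<otimes>\<^bsub>A\<^esub> f \<one>\<^bsub>T\<^esub>"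
      using AA.minus_eq_zero_iff a e_K_closed[OF v] by simp
  qed
qed

lemma ad_scalar:
  assumes "c \<in> carrier K" shows "ad (c \<odot>\<^bsub>A\<^esub> \<one>\<^bsub>A\<^esub>) = \<zero>\<^bsub>C 1\<^esub>"
proof (rule C1_eqI)
  fix v assume v: "v \<in> carrier V"
  then show "ad (c \<odot>\<^bsub>A\<^esub> \<one>\<^bsub>A\<^esub>) (pure_tensor K V [v]) = \<zero>\<^bsub>C 1\<^esub> (pure_tensor K V [v])"
    unfolding ad_pure[OF v] C1_zero_pure[OF v]
    using assms e_K_closed[OF v]
    by (simp add: AA.smult_mult_left AA.smult_mult_right AA.minus_eq_zero_iff)
qed (use assms ad_closed CC.M.zero_closed in auto)

text \<open>Cocycles of degree 0 correspond to central elements, that is to scalars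
  \<open>c\<close>, and the cup product with e_A turns \<open>c\<close> into \<open>c\<close> times
  the fundamental cochain.\<close>

lemma cob_H_1: "coboundaries H dH 1 = (\<lambda>c. cob 1 +>\<^bsub>C 1\<^esub> (c \<odot>\<^bsub>C 1\<^esub> e_C)) ` carrier K"
proof -
  have "coboundaries H dH 1 = (\<lambda>f. dH 0 {f}) ` cocycles C b_K 0"
    by (simp add: coboundaries_def H_0_carrier image_image)
  also have "\<dots> = (\<lambda>f. cob 1 +>\<^bsub>C 1\<^esub> cup_e K V R0 0 f) ` cocycles C b_K 0"
    by (simp only: dH_0)
  also have "\<dots> = (\<lambda>c. cob 1 +>\<^bsub>C 1\<^esub> (c \<odot>\<^bsub>C 1\<^esub> e_C)) ` carrier K"
  proof
    show "(\<lambda>f. cob 1 +>\<^bsub>C 1\<^esub> cup_e K V R0 0 f) ` cocycles C b_K 0 \<subseteq> (\<lambda>c. cob 1 +>\<^bsub>C 1\<^esub> (c \<odot>\<^bsub>C 1\<^esub> e_C)) ` carrier K"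
    proof (rule image_subsetI)
      fix f assume f: "f \<in> cocycles C b_K 0"
      obtain c where "c \<in> carrier K" "f \<one>\<^bsub>T\<^esub> = c \<odot>\<^bsub>A\<^esub> \<one>\<^bsub>A\<^esub>" using cocycle_0_scalar[OF f] by blast
      moreover have "f \<in> carrier (C 0)" using f by (simp add: cocycles_def)
      ultimately show "cob 1 +>\<^bsub>C 1\<^esub> cup_e K V R0 0 f \<in> (\<lambda>c. cob 1 +>\<^bsub>C 1\<^esub> (c \<odot>\<^bsub>C 1\<^esub> e_C)) ` carrier K"
        using cup_e_scalar[of f c] by (intro image_eqI[of _ _ c]) simp_all
    qed
    show "(\<lambda>c. cob 1 +>\<^bsub>C 1\<^esub> (c \<odot>\<^bsub>C 1\<^esub> e_C)) ` carrier K \<subseteq> (\<lambda>f. cob 1 +>\<^bsub>C 1\<^esub> cup_e K V R0 0 f) ` cocycles C b_K 0"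
    proof (rule image_subsetI)
      fix c assume c: "c \<in> carrier K"
      then obtain f where f: "f \<in> carrier (C 0)" "f \<one>\<^bsub>T\<^esub> = c \<odot>\<^bsub>A\<^esub> \<one>\<^bsub>A\<^esub>"
        using cochain_0_exists[of "c \<odot>\<^bsub>A\<^esub> \<one>\<^bsub>A\<^esub>"] by auto
      then have "f \<in> cocycles C b_K 0"
        using koszul_b_0[of f] ad_scalar[OF c] by (simp add: cocycles_def)
      then show "cob 1 +>\<^bsub>C 1\<^esub> (c \<odot>\<^bsub>C 1\<^esub> e_C) \<in> (\<lambda>f. cob 1 +>\<^bsub>C 1\<^esub> cup_e K V R0 0 f) ` cocycles C b_K 0"
        using cup_e_scalar[OF f(1) c f(2)] by (intro image_eqI[of _ _ f]) simp_all
    qed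
  qed
  finally show ?thesis .
qed

subsection \<open>Higher Koszul cohomology\<close>

text \<open>Phrased for a raw record with an idempotent \<open>Z\<close>, so that it can be used on
  \<open>H p\<close> directly, including \<open>p = 0\<close>.\<close>

lemma quot_trivial:
  assumes "Z \<oplus>\<^bsub>M\<^esub> Z = Z"
  shows "carrier (quot_module (M\<lparr>carrier := {Z}\<rparr>) {Z}) = {{Z}}"
  using assms by (simp add: quot_module_def A_RCOSETS_def' a_r_coset_def')

text \<open>Outside degree 1 the coboundaries are zero, so the zero class is the singleton of the
  zero cochain.\<close>

lemma H_zero_add: assumes "p \<noteq> 1" shows "\<zero>\<^bsub>H p\<^esub> \<oplus>\<^bsub>H p\<^esub> \<zero>\<^bsub>H p\<^esub> = \<zero>\<^bsub>H p\<^esub>"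
proof -
  have "cob p = {\<zero>\<^bsub>C p\<^esub>}"
    using assms cob_large[of p] by (cases "p = 0") (auto simp: coboundaries_def)
  moreover have "set_add (C p) {\<zero>\<^bsub>C p\<^esub>} {\<zero>\<^bsub>C p\<^esub>} = {\<zero>\<^bsub>C p\<^esub>}"
    by (simp add: set_add_def')
  moreover have "add (H p) = set_add (C p)"
    by (simp add: HK_def cohomology_def quot_module_def set_add_def' fun_eq_iff)
  ultimately show ?thesis by (simp only: H_zero)
qed

text \<open>This is the injectivity of the differential on scalars; comparing the two sides at one
  basis vector is enough.\<close>

lemma e_not_zero:
  assumes c: "c \<in> carrier K" and z: "c \<odot>\<^bsub>C 1\<^esub> e_C \<in> cob 1"
  shows "c = \<zero>\<^bsub>K\<^esub>"
proof -
  obtain a where a: "a \<in> carrier A" "c \<odot>\<^bsub>C 1\<^esub> e_C = ad a" using z unfolding cob_1 by blast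
  have "B \<noteq> {}" using card_B by auto
  then obtain b where b: "b \<in> B" by blast
  note bV = B_closed[OF b]
  have "c \<odot>\<^bsub>A\<^esub> e_K b = a \<otimes>\<^bsub>A\<^esub> e_K b \<ominus>\<^bsub>A\<^esub> e_K b \<otimes>\<^bsub>A\<^esub> a"
    using fun_cong[OF a(2), of "pure_tensor K V [b]"]
    by (simp only: C1_smult_pure[OF bV] ad_pure[OF bV] e_C_pure[OF bV])
  \<comment> \<open>In weight 1 only the degree 0 part of \<open>a\<close> survives in the
    commutator, and that part is a scalar, so the right side becomes zero.\<close>
  then have "projA 1 (c \<odot>\<^bsub>A\<^esub> e_K b) = projA 1 (a \<otimes>\<^bsub>A\<^esub> e_K b \<ominus>\<^bsub>A\<^esub> e_K b \<otimes>\<^bsub>A\<^esub> a)" by simp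
  then have "c \<odot>\<^bsub>A\<^esub> e_K b = projA 0 a \<otimes>\<^bsub>A\<^esub> e_K b \<ominus>\<^bsub>A\<^esub> e_K b \<otimes>\<^bsub>A\<^esub> projA 0 a"
    using a c bV e_K_closed[OF bV] projA_mult(1,2)[of a b 0]
    by (simp add: module_hom_smult[OF projA_hom] projA_e mod_hom.f_minus[OF projA_mod_hom])
  also have "\<dots> = \<zero>\<^bsub>A\<^esub>"
    using A_comp_0_commutes[OF projA_comp[OF a(1)] e_K_closed[OF bV]] projA_closed[OF a(1)] e_K_closed[OF bV]
    by (simp add: AA.minus_eq_zero_iff)
  finally have "alpha (c \<odot>\<^bsub>G\<^esub> lin_word b) = alpha \<zero>\<^bsub>G\<^esub>"
    using c bV by (simp add: module_hom_smult[OF alpha_hom] lin_word_closed e_K_alpha alpha_zero)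
  then have "c \<odot>\<^bsub>G\<^esub> lin_word b = \<zero>\<^bsub>G\<^esub>" using c bV by (intro alpha_inject) (auto simp: lin_word_closed)
  \<comment> \<open>The coefficient of the one-letter word \<open>[b]\<close> is \<open>c\<close>
    itself.\<close>
  then have "(c \<odot>\<^bsub>G\<^esub> lin_word b) [b] = \<zero>\<^bsub>K\<^esub>" by (simp add: free_algebra_simps(3))
  then show ?thesis using c b by (simp add: free_algebra_simps(5) lin_word_basis word_def)
qed

lemma cocycles_H_0: "cocycles H dH 0 = {\<zero>\<^bsub>H 0\<^esub>}"
proof
  interpret N: module_submodule K "C 1" "cob 1" by (rule cob_module_submodule) simp
  have z0: "\<zero>\<^bsub>H 0\<^esub> = {\<zero>\<^bsub>C 0\<^esub>}" by (simp add: H_zero coboundaries_def)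
  show "cocycles H dH 0 \<subseteq> {\<zero>\<^bsub>H 0\<^esub>}"
  proof
    fix X assume X: "X \<in> cocycles H dH 0"
    then obtain f where f: "X = {f}" "f \<in> cocycles C b_K 0"
      by (auto simp: cocycles_def[of H] H_0_carrier)
    then have fc: "f \<in> carrier (C 0)" by (simp add: cocycles_def)
    obtain c where c: "c \<in> carrier K" "f \<one>\<^bsub>T\<^esub> = c \<odot>\<^bsub>A\<^esub> \<one>\<^bsub>A\<^esub>" using cocycle_0_scalar f by blast
    have "cob 1 +>\<^bsub>C 1\<^esub> (c \<odot>\<^bsub>C 1\<^esub> e_C) = cob 1"
      using X f(1) dH_0[of f] cup_e_scalar[OF fc c] by (simp add: cocycles_def[of H] H_zero)
    then have "c \<odot>\<^bsub>C 1\<^esub> e_C \<in> cob 1"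
      using N.coset_eq_self_iff[of "c \<odot>\<^bsub>C 1\<^esub> e_C"] CC.smult_closed[OF c(1) e_C_closed] by blast
    then have "f \<one>\<^bsub>T\<^esub> = \<zero>\<^bsub>A\<^esub>" using e_not_zero[OF c(1)] c(2) by simp
    then show "X \<in> {\<zero>\<^bsub>H 0\<^esub>}" using cochain_0_eqI[OF fc] by (simp add: f(1) z0)
  qed
  \<comment> \<open>For the reverse inclusion, the zero cochain is checked directly to be a cocycle
    for both differentials, as the cochain whose value at one is the scalar zero.\<close>
  have z: "\<zero>\<^bsub>C 0\<^esub> \<in> carrier (C 0)" by simp
  have z1: "\<zero>\<^bsub>C 0\<^esub> \<one>\<^bsub>T\<^esub> = \<zero>\<^bsub>K\<^esub> \<odot>\<^bsub>A\<^esub> \<one>\<^bsub>A\<^esub>"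
    using one_W_0 by (simp add: C_simps(2))
  have "b_K 0 \<zero>\<^bsub>C 0\<^esub> = \<zero>\<^bsub>C 1\<^esub>"
    by (simp only: koszul_b_0[OF z] z1 ad_scalar R.zero_closed)
  then have "\<zero>\<^bsub>C 0\<^esub> \<in> cocycles C b_K 0" by (simp add: cocycles_def)
  moreover have "dH 0 {\<zero>\<^bsub>C 0\<^esub>} = \<zero>\<^bsub>H 1\<^esub>"
  proof -
    have "\<zero>\<^bsub>K\<^esub> \<odot>\<^bsub>C 1\<^esub> e_C = \<zero>\<^bsub>C 1\<^esub>" using e_C_closed by simp
    then show ?thesis
      using dH_0[of "\<zero>\<^bsub>C 0\<^esub>"] cup_e_scalar[OF z R.zero_closed z1] N.coset_eq_self_iff[OF CC.M.zero_closed] N.S.zero_closed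
      by (simp add: H_zero)
  qed
  ultimately show "{\<zero>\<^bsub>H 0\<^esub>} \<subseteq> cocycles H dH 0"
    by (simp add: cocycles_def[of H] H_0_carrier z0)
qed

theorem HKhi_0: "carrier (HKhi K V R0 0) = {\<zero>\<^bsub>HKhi K V R0 0\<^esub>}"
proof -
  have "HKhi K V R0 0 = quot_module ((H 0)\<lparr>carrier := {\<zero>\<^bsub>H 0\<^esub>}\<rparr>) {\<zero>\<^bsub>H 0\<^esub>}"
    by (simp add: HKhi_def cohomology_def cocycles_H_0) (simp add: coboundaries_def)
  then show ?thesis
    using quot_trivial[OF H_zero_add[of 0]] by (simp add: quot_module_def)
qed

theorem HKhi_large:
  assumes p: "2 \<le> p" shows "carrier (HKhi K V R0 p) = {\<zero>\<^bsub>HKhi K V R0 p\<^esub>}"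
proof -
  obtain q where q: "p = Suc q" "1 \<le> q" using p by (cases p) auto
  interpret q: module K "H q" using q by (intro H_module)
  have "cocycles H dH p = {\<zero>\<^bsub>H p\<^esub>}"
    using dH_large[of p "\<zero>\<^bsub>H p\<^esub>"] p by (auto simp: cocycles_def H_large)
  moreover have "coboundaries H dH p = {\<zero>\<^bsub>H p\<^esub>}"
  proof -
    have "coboundaries H dH p = dH q ` carrier (H q)" by (simp add: coboundaries_def q)
    also have "\<dots> = (\<lambda>_. \<zero>\<^bsub>H p\<^esub>) ` carrier (H q)"
      using dH_large[OF q(2)] by (intro image_cong refl) (simp add: q)
    also have "\<dots> = {\<zero>\<^bsub>H p\<^esub>}" using q.M.zero_closed by blast
    finally show ?thesis .
  qed
  ultimately have "HKhi K V R0 p = quot_module ((H p)\<lparr>carrier := {\<zero>\<^bsub>H p\<^esub>}\<rparr>) {\<zero>\<^bsub>H p\<^esub>}"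
    by (simp add: HKhi_def cohomology_def)
  then show ?thesis
    using quot_trivial[OF H_zero_add[of p]] p by (simp add: quot_module_def)
qed

section \<open>Degree one of the higher cohomology\<close>

abbreviation "cobH \<equiv> coboundaries H dH 1"

lemma H_1: "H 1 = quot_module (C 1) (cob 1)"
  by (rule HK_eq) simp

lemma class_hom: "(\<lambda>f. cob 1 +>\<^bsub>C 1\<^esub> f) \<in> module_hom K (C 1) (H 1)"
  unfolding H_1 by (rule mod_hom.f_hom[OF module_submodule.coset_mod_hom[OF cob_module_submodule]]) simp

text \<open>Regarding \<open>K\<close> as a module makes \<open>cobH\<close> the image of a linear
  map, and so a submodule of \<open>H 1\<close>.\<close>

lemma class_e_hom: "(\<lambda>c. cob 1 +>\<^bsub>C 1\<^esub> (c \<odot>\<^bsub>C 1\<^esub> e_C)) \<in> module_hom K (base_module K) (H 1)"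
  by (rule module_hom_comp[OF _ class_hom])
    (auto simp: module_hom_def base_module_def CC.smult_l_distr[OF _ _ e_C_closed]
      CC.smult_assoc1[OF _ _ e_C_closed] CC.smult_closed[OF _ e_C_closed] simp del: One_nat_def)

lemma cobH_module_submodule: "module_submodule K (H 1) cobH"
proof -
  have "mod_hom K (base_module K) (H 1) (\<lambda>c. cob 1 +>\<^bsub>C 1\<^esub> (c \<odot>\<^bsub>C 1\<^esub> e_C))"
    using class_e_hom R.base_module_module H_module[of 1] by (simp add: mod_hom_def mod_hom_axioms_def)
  from mod_hom.im_is_submodule[OF this]
  have "submodule K cobH (H 1)"
    unfolding mod_hom.im_def[OF \<open>mod_hom K (base_module K) (H 1) _\<close>] cob_H_1 by (simp add: base_module_def)
  then show ?thesis using H_module[of 1] by (simp add: module_submodule_def)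
qed

lemma cocycles_H_1: "cocycles H dH 1 = carrier (H 1)"
  using dH_large[of 1] by (auto simp: cocycles_def)

lemma HKhi_1: "HKhi K V R0 1 = quot_module (H 1) cobH"
  unfolding HKhi_def cohomology_def cocycles_H_1 by simp

lemma HKhi_1_module: "module K (HKhi K V R0 1)"
  unfolding HKhi_1 by (rule module_submodule.quot_module_module[OF cobH_module_submodule])

definition Q :: "(('k, 'v) tensor \<Rightarrow> ('k, 'v) tensor set) \<Rightarrow> (('k, 'v) tensor \<Rightarrow> ('k, 'v) tensor set) set set" where
  "Q f = cobH +>\<^bsub>H 1\<^esub> (cob 1 +>\<^bsub>C 1\<^esub> f)"

lemma Q_hom: "Q \<in> module_hom K (C 1) (HKhi K V R0 1)"
  unfolding Q_def HKhi_1
  by (rule module_hom_comp[OF class_hom mod_hom.f_hom[OF module_submodule.coset_mod_hom[OF cobH_module_submodule]]])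

text \<open>The passage from double cosets to an equation in \<open>A\<close>: every boundary
  condition used later is this formula, stated with values on vectors only.\<close>

lemma Q_zero_iff:
  assumes f: "f \<in> carrier (C 1)"
  shows "Q f = \<zero>\<^bsub>HKhi K V R0 1\<^esub> \<longleftrightarrow>
    (\<exists>c\<in>carrier K. \<exists>a\<in>carrier A. \<forall>v\<in>carrier V.
      f (pure_tensor K V [v]) = c \<odot>\<^bsub>A\<^esub> e_K v \<oplus>\<^bsub>A\<^esub> (a \<otimes>\<^bsub>A\<^esub> e_K v \<ominus>\<^bsub>A\<^esub> e_K v \<otimes>\<^bsub>A\<^esub> a))"
proof -
  interpret N: module_submodule K "C 1" "cob 1" by (rule cob_module_submodule) simp
  interpret NH: module_submodule K "H 1" cobH by (rule cobH_module_submodule)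
  have "cob 1 +>\<^bsub>C 1\<^esub> f \<in> carrier (H 1)" using module_hom_closed[OF class_hom] f by blast
  then have "Q f = \<zero>\<^bsub>HKhi K V R0 1\<^esub> \<longleftrightarrow> cob 1 +>\<^bsub>C 1\<^esub> f \<in> cobH"
    unfolding Q_def HKhi_1 NH.quot_module_zero by (rule NH.coset_eq_self_iff)
  \<comment> \<open>The outer quotient asks for a class of some \<open>c\<close> times the
    fundamental cochain; equality of the inner cosets asks that the difference be a
    coboundary.\<close>
  also have "\<dots> \<longleftrightarrow> (\<exists>c\<in>carrier K. f \<ominus>\<^bsub>C 1\<^esub> (c \<odot>\<^bsub>C 1\<^esub> e_C) \<in> cob 1)"
    unfolding cob_H_1 image_iff
    by (intro bex_cong refl N.coset_eq_iff f CC.smult_closed e_C_closed)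
  also have "\<dots> \<longleftrightarrow> (\<exists>c\<in>carrier K. \<exists>a\<in>carrier A. f = c \<odot>\<^bsub>C 1\<^esub> e_C \<oplus>\<^bsub>C 1\<^esub> ad a)"
  proof (intro bex_cong refl)
    fix c assume c: "c \<in> carrier K"
    let ?e = "c \<odot>\<^bsub>C 1\<^esub> e_C"
    have e: "?e \<in> carrier (C 1)" by (rule CC.smult_closed[OF c e_C_closed])
    have "f \<ominus>\<^bsub>C 1\<^esub> ?e = g \<longleftrightarrow> f = ?e \<oplus>\<^bsub>C 1\<^esub> g" if "g \<in> carrier (C 1)" for g
      using f e that by (metis CC.M.add.inv_closed CC.M.add.m_closed CC.M.add.m_comm CC.M.minus_eq CC.M.r_neg2 CC.M.r_neg1 )
    then show "f \<ominus>\<^bsub>C 1\<^esub> ?e \<in> cob 1 \<longleftrightarrow> (\<exists>a\<in>carrier A. f = ?e \<oplus>\<^bsub>C 1\<^esub> ad a)"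
      unfolding cob_1 image_iff by (intro bex_cong refl) (simp only: ad_closed)
  qed
  also have "\<dots> \<longleftrightarrow> (\<exists>c\<in>carrier K. \<exists>a\<in>carrier A. \<forall>v\<in>carrier V.
      f (pure_tensor K V [v]) = c \<odot>\<^bsub>A\<^esub> e_K v \<oplus>\<^bsub>A\<^esub> (a \<otimes>\<^bsub>A\<^esub> e_K v \<ominus>\<^bsub>A\<^esub> e_K v \<otimes>\<^bsub>A\<^esub> a))"
  proof (intro bex_cong refl)
    fix c a assume ca: "c \<in> carrier K" "a \<in> carrier A"
    have g: "c \<odot>\<^bsub>C 1\<^esub> e_C \<oplus>\<^bsub>C 1\<^esub> ad a \<in> carrier (C 1)"
      by (intro CC.M.a_closed CC.smult_closed ca e_C_closed ad_closed)
    have p: "(c \<odot>\<^bsub>C 1\<^esub> e_C \<oplus>\<^bsub>C 1\<^esub> ad a) (pure_tensor K V [v])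
        = c \<odot>\<^bsub>A\<^esub> e_K v \<oplus>\<^bsub>A\<^esub> (a \<otimes>\<^bsub>A\<^esub> e_K v \<ominus>\<^bsub>A\<^esub> e_K v \<otimes>\<^bsub>A\<^esub> a)" if "v \<in> carrier V" for v
      using that by (simp only: C1_add_pure C1_smult_pure e_C_pure ad_pure)
    show "f = c \<odot>\<^bsub>C 1\<^esub> e_C \<oplus>\<^bsub>C 1\<^esub> ad a \<longleftrightarrow> (\<forall>v\<in>carrier V.
      f (pure_tensor K V [v]) = c \<odot>\<^bsub>A\<^esub> e_K v \<oplus>\<^bsub>A\<^esub> (a \<otimes>\<^bsub>A\<^esub> e_K v \<ominus>\<^bsub>A\<^esub> e_K v \<otimes>\<^bsub>A\<^esub> a))"
      using p C1_eqI[OF f g] by metis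
  qed
  finally show ?thesis .
qed

text \<open>Every cochain of degree 1 and every class in \<open>H 1\<close> is a cocycle, so both
  restrictions to cocycles disappear.\<close>

lemma HKhi_part_1:
  "HKhi_part K V R0 1 m = (HKhi K V R0 1)\<lparr>carrier := Q ` {f \<in> carrier (C 1). f ` W 1 \<subseteq> A_comp m}\<rparr>"
proof -
  have "carrier (HK_part K V R0 1 m) = (\<lambda>f. cob 1 +>\<^bsub>C 1\<^esub> f) ` {f \<in> carrier (C 1). f ` W 1 \<subseteq> A_comp m}"
  proof -
    have "cocycles C b_K 1 \<inter> {f \<in> carrier (C 1). f ` W 1 \<subseteq> A_comp m} = {f \<in> carrier (C 1). f ` W 1 \<subseteq> A_comp m}"
      using cocycles_C[of 1] by auto
    then show ?thesis by (simp add: HK_part_def cohomology_part_def cohomology_class_def del: One_nat_def)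
  qed
  moreover have "\<dots> \<subseteq> carrier (H 1)" using module_hom_closed[OF class_hom] by blast
  ultimately have "cocycles H dH 1 \<inter> carrier (HK_part K V R0 1 m)
      = (\<lambda>f. cob 1 +>\<^bsub>C 1\<^esub> f) ` {f \<in> carrier (C 1). f ` W 1 \<subseteq> A_comp m}"
    unfolding cocycles_H_1 by auto
  then show ?thesis
    by (simp add: HKhi_part_def cohomology_part_def HKhi_def cohomology_class_def Q_def image_image del: One_nat_def)
qed

section \<open>Cochains of fixed weight as linear maps on \<open>V\<close>\<close>

definition unpure :: "('k, 'v) tensor \<Rightarrow> 'v" where
  "unpure = the_inv_into (carrier V) (\<lambda>v. pure_tensor K V [v])"

lemma pure_bij: "bij_betw (\<lambda>v. pure_tensor K V [v]) (carrier V) (W 1)"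
proof -
  have "inj_on (\<lambda>v. pure_tensor K V [v]) (carrier V)"
  proof
    fix v w assume vw: "v \<in> carrier V" "w \<in> carrier V" "pure_tensor K V [v] = pure_tensor K V [w]"
    then have "e_K v = e_K w" by (simp add: koszul_e_eq)
    then show "v = w" using e_K_inject vw by blast
  qed
  then show ?thesis unfolding bij_betw_def W_1 by auto
qed

lemma unpure_pure: "v \<in> carrier V \<Longrightarrow> unpure (pure_tensor K V [v]) = v"
  unfolding unpure_def by (rule the_inv_into_f_f[OF bij_betw_imp_inj_on[OF pure_bij]])

lemma unpure_hom: "unpure \<in> module_hom K (T\<lparr>carrier := W 1\<rparr>) V"
  unfolding unpure_def
proof (rule module_hom_the_inv_into[OF module_axioms])
  show "(\<lambda>v. pure_tensor K V [v]) \<in> module_hom K V (T\<lparr>carrier := W 1\<rparr>)"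
    using pure_letter_hom pure_W_1 by (auto simp: module_hom_def)
qed (use pure_bij in simp)

text \<open>A cochain of weight \<open>m\<close> is a linear map from \<open>V\<close> to any model \<open>S\<close> of the component \<open>A_m\<close>.\<close>

lemma HKhi_part_1_model:
  fixes S :: "('k, 's, 't) module_scheme"
  assumes S: "module K S" and s: "s \<in> module_hom K S A" and inj: "inj_on s (carrier S)"
    and im: "s ` carrier S = A_comp m"
  defines "U \<equiv> Hom_module K V S"
  defines "J \<equiv> (\<lambda>u. \<lambda>w\<in>W 1. s (u (unpure w)))"
  shows "mod_hom K U (HKhi K V R0 1) (\<lambda>u. Q (J u))"
    and "HKhi_part K V R0 1 m = (HKhi K V R0 1)\<lparr>carrier := (\<lambda>u. Q (J u)) ` carrier U\<rparr>"
    and "\<And>u. u \<in> carrier U \<Longrightarrow> Q (J u) = \<zero>\<^bsub>HKhi K V R0 1\<^esub> \<longleftrightarrow>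
      (\<exists>c\<in>carrier K. \<exists>a\<in>carrier A. \<forall>v\<in>carrier V.
        s (u v) = c \<odot>\<^bsub>A\<^esub> e_K v \<oplus>\<^bsub>A\<^esub> (a \<otimes>\<^bsub>A\<^esub> e_K v \<ominus>\<^bsub>A\<^esub> e_K v \<otimes>\<^bsub>A\<^esub> a))"
proof -
  have U: "module K U" unfolding U_def by (rule Hom_module_module[OF module_axioms S])
  have Ucl: "u v \<in> carrier S" if "u \<in> carrier U" "v \<in> carrier V" for u v
    using that by (auto simp: U_def Hom_module_def module_hom_def)
  have un: "unpure w \<in> carrier V" if "w \<in> W 1" for w
    using that module_hom_closed[OF unpure_hom] by auto
  have Jc: "J u \<in> carrier (C 1)" if u: "u \<in> carrier U" for u
  proof -
    have "(\<lambda>w. s (u (unpure w))) \<in> module_hom K (T\<lparr>carrier := W 1\<rparr>) A"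
      using u by (intro module_hom_comp[OF unpure_hom module_hom_comp[OF _ s]]) (simp add: U_def Hom_module_def)
    then show ?thesis
      using submodule.m_closed[OF koszul_W_submodule] submodule.smult_closed[OF koszul_W_submodule]
      by (auto simp: C_simps(1) J_def module_hom_def simp del: One_nat_def)
  qed
  have Jp: "J u (pure_tensor K V [v]) = s (u v)" if "v \<in> carrier V" for u v
    using that pure_W_1[OF that] by (simp add: J_def unpure_pure del: One_nat_def)
  have J: "J \<in> module_hom K U (C 1)"
  proof -
    interpret U: module K U by (rule U)
    have "J (u \<oplus>\<^bsub>U\<^esub> u') = J u \<oplus>\<^bsub>C 1\<^esub> J u'" if u: "u \<in> carrier U" "u' \<in> carrier U" for u u'
    proof (rule C1_eqI)
      fix v assume v: "v \<in> carrier V"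
      have "(u \<oplus>\<^bsub>U\<^esub> u') v = u v \<oplus>\<^bsub>S\<^esub> u' v" using v by (simp add: U_def Hom_module_def)
      then show "J (u \<oplus>\<^bsub>U\<^esub> u') (pure_tensor K V [v]) = (J u \<oplus>\<^bsub>C 1\<^esub> J u') (pure_tensor K V [v])"
        unfolding C1_add_pure[OF v] Jp[OF v] using module_hom_add[OF s] Ucl u v by metis
    qed (use u Jc in \<open>auto simp del: One_nat_def\<close>)
    moreover have "J (c \<odot>\<^bsub>U\<^esub> u) = c \<odot>\<^bsub>C 1\<^esub> J u" if u: "c \<in> carrier K" "u \<in> carrier U" for c u
    proof (rule C1_eqI)
      fix v assume v: "v \<in> carrier V"
      have "(c \<odot>\<^bsub>U\<^esub> u) v = c \<odot>\<^bsub>S\<^esub> u v" using v by (simp add: U_def Hom_module_def)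
      then show "J (c \<odot>\<^bsub>U\<^esub> u) (pure_tensor K V [v]) = (c \<odot>\<^bsub>C 1\<^esub> J u) (pure_tensor K V [v])"
        unfolding C1_smult_pure[OF v] Jp[OF v] using module_hom_smult[OF s] Ucl u v by metis
    qed (use u Jc in \<open>auto simp del: One_nat_def\<close>)
    ultimately show ?thesis using Jc by (auto simp: module_hom_def simp del: One_nat_def)
  qed
  show "mod_hom K U (HKhi K V R0 1) (\<lambda>u. Q (J u))"
    using module_hom_comp[OF J Q_hom] U HKhi_1_module by (simp add: mod_hom_def mod_hom_axioms_def)
  \<comment> \<open>The models \<open>J u\<close> are exactly the cochains of weight
    \<open>m\<close>; a cochain is recovered by composing its values on vectors with the inverse of
    \<open>s\<close>.\<close>
  have "J ` carrier U = {f \<in> carrier (C 1). f ` W 1 \<subseteq> A_comp m}"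
  proof
    have "J u w \<in> A_comp m" if "u \<in> carrier U" "w \<in> W 1" for u w
      using that Ucl un im by (auto simp: J_def simp del: One_nat_def)
    then show "J ` carrier U \<subseteq> {f \<in> carrier (C 1). f ` W 1 \<subseteq> A_comp m}" using Jc by blast
    show "{f \<in> carrier (C 1). f ` W 1 \<subseteq> A_comp m} \<subseteq> J ` carrier U"
    proof
      fix f assume "f \<in> {f \<in> carrier (C 1). f ` W 1 \<subseteq> A_comp m}"
      then have f: "f \<in> carrier (C 1)" "f ` W 1 \<subseteq> A_comp m" by blast+
      have b: "bij_betw s (carrier S) (A_comp m)" using inj im by (simp add: bij_betw_def)
      \<comment> \<open>The codomain is cut down to the component so that \<open>s\<close> becomes a
        bijection with a linear inverse.\<close>
      have s': "s \<in> module_hom K S (A\<lparr>carrier := A_comp m\<rparr>)"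
        using s im by (auto simp: module_hom_def)
      note si = module_hom_the_inv_into[OF S s', simplified, OF b]
      let ?u = "\<lambda>v\<in>carrier V. the_inv_into (carrier S) s (f (pure_tensor K V [v]))"
      have fh: "(\<lambda>v. f (pure_tensor K V [v])) \<in> module_hom K V (A\<lparr>carrier := A_comp m\<rparr>)"
      proof -
        have "(\<lambda>v. pure_tensor K V [v]) \<in> module_hom K V (T\<lparr>carrier := W 1\<rparr>)"
          using pure_letter_hom pure_W_1 by (auto simp: module_hom_def simp del: One_nat_def)
        moreover have "f \<in> module_hom K (T\<lparr>carrier := W 1\<rparr>) (A\<lparr>carrier := A_comp m\<rparr>)"
          using f by (auto simp: C_simps(1) module_hom_def simp del: One_nat_def)
        ultimately show ?thesis by (rule module_hom_comp)
      qed
      have "?u \<in> carrier U"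
        using module_hom_comp[OF fh si] by (auto simp: U_def Hom_module_def module_hom_def)
      moreover have "J ?u = f"
      proof (rule C1_eqI[OF Jc[OF \<open>?u \<in> carrier U\<close>] f(1)])
        fix v assume v: "v \<in> carrier V"
        have "f (pure_tensor K V [v]) \<in> A_comp m" using f(2) pure_W_1[OF v] by blast
        then show "J ?u (pure_tensor K V [v]) = f (pure_tensor K V [v])"
          using f_the_inv_into_f_bij_betw[OF b] v by (simp add: Jp)
      qed
      ultimately show "f \<in> J ` carrier U" by (intro image_eqI[of f J ?u]) simp_all
    qed
  qed
  then show "HKhi_part K V R0 1 m = (HKhi K V R0 1)\<lparr>carrier := (\<lambda>u. Q (J u)) ` carrier U\<rparr>"
    by (simp only: HKhi_part_1 image_image[of Q J, symmetric])
  show "Q (J u) = \<zero>\<^bsub>HKhi K V R0 1\<^esub> \<longleftrightarrow>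
      (\<exists>c\<in>carrier K. \<exists>a\<in>carrier A. \<forall>v\<in>carrier V.
        s (u v) = c \<odot>\<^bsub>A\<^esub> e_K v \<oplus>\<^bsub>A\<^esub> (a \<otimes>\<^bsub>A\<^esub> e_K v \<ominus>\<^bsub>A\<^esub> e_K v \<otimes>\<^bsub>A\<^esub> a))" if "u \<in> carrier U" for u
    using Q_zero_iff[OF Jc[OF that]] by (simp add: Jp)
qed

text \<open>The unknown \<open>a\<close> of \<open>Q_zero_iff\<close> need not be homogeneous.
  Taking components of a boundary replaces it by its part of degree n, one below the weight, and
  shows which of the two kinds of boundary occur in each weight.\<close>

lemma projA_boundary:
  assumes c: "c \<in> carrier K" and a: "a \<in> carrier A" and v: "v \<in> carrier V"
  shows "projA 0 (c \<odot>\<^bsub>A\<^esub> e_K v \<oplus>\<^bsub>A\<^esub> (a \<otimes>\<^bsub>A\<^esub> e_K v \<ominus>\<^bsub>A\<^esub> e_K v \<otimes>\<^bsub>A\<^esub> a)) = \<zero>\<^bsub>A\<^esub>"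
    and "projA (Suc n) (c \<odot>\<^bsub>A\<^esub> e_K v \<oplus>\<^bsub>A\<^esub> (a \<otimes>\<^bsub>A\<^esub> e_K v \<ominus>\<^bsub>A\<^esub> e_K v \<otimes>\<^bsub>A\<^esub> a))
      = (if n = 0 then c \<odot>\<^bsub>A\<^esub> e_K v else projA n a \<otimes>\<^bsub>A\<^esub> e_K v \<ominus>\<^bsub>A\<^esub> e_K v \<otimes>\<^bsub>A\<^esub> projA n a)"
proof -
  note e = e_K_closed[OF v]
  have lin: "projA i (c \<odot>\<^bsub>A\<^esub> e_K v \<oplus>\<^bsub>A\<^esub> (a \<otimes>\<^bsub>A\<^esub> e_K v \<ominus>\<^bsub>A\<^esub> e_K v \<otimes>\<^bsub>A\<^esub> a))
    = c \<odot>\<^bsub>A\<^esub> projA i (e_K v) \<oplus>\<^bsub>A\<^esub> (projA i (a \<otimes>\<^bsub>A\<^esub> e_K v) \<ominus>\<^bsub>A\<^esub> projA i (e_K v \<otimes>\<^bsub>A\<^esub> a))" for i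
    using c a e module_hom_add[OF projA_hom, of "c \<odot>\<^bsub>A\<^esub> e_K v" "a \<otimes>\<^bsub>A\<^esub> e_K v \<ominus>\<^bsub>A\<^esub> e_K v \<otimes>\<^bsub>A\<^esub> a" i]
    by (simp add: module_hom_smult[OF projA_hom] mod_hom.f_minus[OF projA_mod_hom])
  show "projA 0 (c \<odot>\<^bsub>A\<^esub> e_K v \<oplus>\<^bsub>A\<^esub> (a \<otimes>\<^bsub>A\<^esub> e_K v \<ominus>\<^bsub>A\<^esub> e_K v \<otimes>\<^bsub>A\<^esub> a)) = \<zero>\<^bsub>A\<^esub>"
    unfolding lin using c a v by (simp add: projA_mult projA_e AA.minus_eq AA.r_neg)
  have "projA 0 a \<otimes>\<^bsub>A\<^esub> e_K v = e_K v \<otimes>\<^bsub>A\<^esub> projA 0 a"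
    by (rule A_comp_0_commutes[OF projA_comp[OF a] e])
  then show "projA (Suc n) (c \<odot>\<^bsub>A\<^esub> e_K v \<oplus>\<^bsub>A\<^esub> (a \<otimes>\<^bsub>A\<^esub> e_K v \<ominus>\<^bsub>A\<^esub> e_K v \<otimes>\<^bsub>A\<^esub> a))
      = (if n = 0 then c \<odot>\<^bsub>A\<^esub> e_K v else projA n a \<otimes>\<^bsub>A\<^esub> e_K v \<ominus>\<^bsub>A\<^esub> e_K v \<otimes>\<^bsub>A\<^esub> projA n a)"
    unfolding lin using c a v e projA_closed[OF a]
    by (auto simp: projA_mult projA_e AA.minus_eq AA.r_neg)
qed

section \<open>The weights zero, one, and at least two\<close>

theorem HKhi_part_1_0: "lin_iso K (HKhi_part K V R0 1 0) (Hom_module K V (base_module K))"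
proof -
  let ?S = "base_module K" let ?s = "\<lambda>c. c \<odot>\<^bsub>A\<^esub> \<one>\<^bsub>A\<^esub>"
  have s: "?s \<in> module_hom K ?S A"
    by (auto simp: module_hom_def base_module_def AA.scal.smult_l_distr AA.scal.smult_assoc1)
  interpret s: mod_hom K ?S A ?s
    using s R.base_module_module AA.scal.module_axioms by (simp add: mod_hom_def mod_hom_axioms_def)
  have inj: "inj_on ?s (carrier ?S)"
  proof
    fix c d assume cd: "c \<in> carrier ?S" "d \<in> carrier ?S" "?s c = ?s d"
    have S: "carrier ?S = carrier K" "\<zero>\<^bsub>?S\<^esub> = \<zero>\<^bsub>K\<^esub>" by (simp_all add: base_module_def)
    have "?s (c \<ominus>\<^bsub>?S\<^esub> d) = \<zero>\<^bsub>A\<^esub>" by (rule iffD1[OF s.eq_iff_diff_ker cd(3)]) (rule cd)+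
    moreover have "c \<ominus>\<^bsub>?S\<^esub> d \<in> carrier K" using s.M.M.minus_closed[OF cd(1,2)] by (simp only: S)
    ultimately have "c \<ominus>\<^bsub>?S\<^esub> d = \<zero>\<^bsub>?S\<^esub>" unfolding S by (intro scalar_mult_one_inject)
    then show "c = d" using abelian_group.minus_eq_zero_iff[OF s.M.M.abelian_group_axioms] cd by blast
  qed
  have im: "?s ` carrier ?S = A_comp 0" by (auto simp: A_comp_0 base_module_def)
  note m = HKhi_part_1_model[OF R.base_module_module s inj im]
  let ?U = "Hom_module K V ?S"
  interpret U: module K ?U by (rule Hom_module_module[OF module_axioms R.base_module_module])
  show ?thesis
    unfolding m(2)
  proof (rule mod_hom.lin_iso_image[OF m(1)])
    have *: "u = \<zero>\<^bsub>?U\<^esub>" if u: "u \<in> carrier ?U"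
      and ex: "\<exists>c\<in>carrier K. \<exists>a\<in>carrier A. \<forall>v\<in>carrier V. ?s (u v) = c \<odot>\<^bsub>A\<^esub> e_K v \<oplus>\<^bsub>A\<^esub> (a \<otimes>\<^bsub>A\<^esub> e_K v \<ominus>\<^bsub>A\<^esub> e_K v \<otimes>\<^bsub>A\<^esub> a)" for u
    proof -
      obtain c a where ca: "c \<in> carrier K" "a \<in> carrier A"
        "\<And>v. v \<in> carrier V \<Longrightarrow> ?s (u v) = c \<odot>\<^bsub>A\<^esub> e_K v \<oplus>\<^bsub>A\<^esub> (a \<otimes>\<^bsub>A\<^esub> e_K v \<ominus>\<^bsub>A\<^esub> e_K v \<otimes>\<^bsub>A\<^esub> a)"
        using ex by blast
      have "u v = \<zero>\<^bsub>K\<^esub>" if v: "v \<in> carrier V" for v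
      proof -
        have uv: "u v \<in> carrier K" using u v by (auto simp: Hom_module_def module_hom_def base_module_def)
        \<comment> \<open>The left side has weight 0 and a boundary has no component there, so
          \<open>u\<close> vanishes and the kernel is zero.\<close>
        have "?s (u v) = projA 0 (?s (u v))" using im uv by (intro projA_id[symmetric]) (auto simp: base_module_def)
        also have "\<dots> = \<zero>\<^bsub>A\<^esub>" using ca v projA_boundary(1) by simp
        finally show ?thesis using scalar_mult_one_inject uv by blast
      qed
      then show ?thesis using u
        by (intro extensionalityI[of _ "carrier V"]) (auto simp: Hom_module_def base_module_def)
    qed
    show "{u \<in> carrier ?U. Q (\<lambda>w\<in>W 1. ?s (u (unpure w))) = \<zero>\<^bsub>HKhi K V R0 1\<^esub>} = {\<zero>\<^bsub>?U\<^esub>}"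
    proof (intro equalityI subsetI)
      fix u assume "u \<in> {u \<in> carrier ?U. Q (\<lambda>w\<in>W 1. ?s (u (unpure w))) = \<zero>\<^bsub>HKhi K V R0 1\<^esub>}"
      then have u: "u \<in> carrier ?U" and Q: "Q (\<lambda>w\<in>W 1. ?s (u (unpure w))) = \<zero>\<^bsub>HKhi K V R0 1\<^esub>" by blast+
      show "u \<in> {\<zero>\<^bsub>?U\<^esub>}" using *[OF u iffD1[OF m(3)[OF u] Q]] by (simp only: singleton_iff)
    next
      fix u assume "u \<in> {\<zero>\<^bsub>?U\<^esub>}"
      then have "u = \<zero>\<^bsub>?U\<^esub>" by (simp only: singleton_iff)
      then show "u \<in> {u \<in> carrier ?U. Q (\<lambda>w\<in>W 1. ?s (u (unpure w))) = \<zero>\<^bsub>HKhi K V R0 1\<^esub>}"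
        using mod_hom.f0_is_0[OF m(1)] U.M.zero_closed by (simp only: mem_Collect_eq simp_thms)
    qed
  qed
qed

text \<open>The model of the component of degree one is \<open>V\<close>, embedded by
  \<open>e_K\<close>, and the kernel of the map to cohomology is the set of scalar maps.\<close>

theorem HKhi_part_1_1:
  "lin_iso K (HKhi_part K V R0 1 1) (quot_module (Hom_module K V V) (scalar_maps K V))"
proof -
  have inj: "inj_on e_K (carrier V)" using e_K_inject by (auto simp: inj_on_def)
  note m = HKhi_part_1_model[OF module_axioms koszul_e_hom inj A_comp_1[symmetric]]
  let ?U = "Hom_module K V V"
  have "{u \<in> carrier ?U. Q (\<lambda>w\<in>W 1. e_K (u (unpure w))) = \<zero>\<^bsub>HKhi K V R0 1\<^esub>} = scalar_maps K V"
  proof (intro equalityI subsetI)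
    fix u assume "u \<in> {u \<in> carrier ?U. Q (\<lambda>w\<in>W 1. e_K (u (unpure w))) = \<zero>\<^bsub>HKhi K V R0 1\<^esub>}"
    then have u: "u \<in> carrier ?U" and Q: "Q (\<lambda>w\<in>W 1. e_K (u (unpure w))) = \<zero>\<^bsub>HKhi K V R0 1\<^esub>" by blast+
    obtain c a where ca: "c \<in> carrier K" "a \<in> carrier A"
      "\<And>v. v \<in> carrier V \<Longrightarrow> e_K (u v) = c \<odot>\<^bsub>A\<^esub> e_K v \<oplus>\<^bsub>A\<^esub> (a \<otimes>\<^bsub>A\<^esub> e_K v \<ominus>\<^bsub>A\<^esub> e_K v \<otimes>\<^bsub>A\<^esub> a)"
      using iffD1[OF m(3)[OF u] Q] by blast
    have "u v = c \<odot>\<^bsub>V\<^esub> v" if v: "v \<in> carrier V" for v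
    proof (rule e_K_inject)
      show uv: "u v \<in> carrier V" using u v by (auto simp: Hom_module_def module_hom_def)
      \<comment> \<open>The projection fixes the left side and deletes the commutator on the right,
        leaving the multiple of e_A.\<close>
      have "e_K (u v) = projA 1 (e_K (u v))" using projA_e[OF uv, of 1] by simp
      also have "\<dots> = c \<odot>\<^bsub>A\<^esub> e_K v" using ca v projA_boundary(2)[of c a v 0] by simp
      also have "\<dots> = e_K (c \<odot>\<^bsub>V\<^esub> v)" using module_hom_smult[OF koszul_e_hom] ca v by simp
      finally show "e_K (u v) = e_K (c \<odot>\<^bsub>V\<^esub> v)" .
    qed (use ca v in simp)
    then have "u = c \<odot>\<^bsub>?U\<^esub> (\<lambda>v\<in>carrier V. v)"
      using u by (intro extensionalityI[of _ "carrier V"]) (auto simp: Hom_module_def)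
    then show "u \<in> scalar_maps K V" using ca by (auto simp: scalar_maps_def)
  next
    fix u assume "u \<in> scalar_maps K V"
    then obtain c where c: "c \<in> carrier K" "u = c \<odot>\<^bsub>?U\<^esub> (\<lambda>v\<in>carrier V. v)" by (auto simp: scalar_maps_def)
    then have uv: "u = (\<lambda>v\<in>carrier V. c \<odot>\<^bsub>V\<^esub> v)" by (auto simp: Hom_module_def fun_eq_iff)
    have u: "u \<in> carrier ?U"
      unfolding uv using c
      by (auto simp: Hom_module_def module_hom_def smult_r_distr smult_assoc1[symmetric] R.m_comm)
    have "Q (\<lambda>w\<in>W 1. e_K (u (unpure w))) = \<zero>\<^bsub>HKhi K V R0 1\<^esub>"
      unfolding m(3)[OF u] unfolding uv using c(1)
      \<comment> \<open>A scalar map is a boundary with commutator part zero.\<close>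
      by (intro bexI[of _ c] bexI[of _ "\<zero>\<^bsub>A\<^esub>"] ballI)
        (simp_all add: module_hom_smult[OF koszul_e_hom] e_K_closed AA.minus_eq)
    then show "u \<in> {u \<in> carrier ?U. Q (\<lambda>w\<in>W 1. e_K (u (unpure w))) = \<zero>\<^bsub>HKhi K V R0 1\<^esub>}" using u by blast
  qed
  then show ?thesis
    unfolding m(2) using mod_hom.lin_iso_image_quot_ker[OF m(1)] by simp
qed

theorem HKhi_part_1_m:
  assumes m2: "2 \<le> m"
  shows "lin_iso K (HKhi_part K V R0 1 m)
    (quot_module (Hom_module K V (T\<lparr>carrier := tensor_power K V m\<rparr>)) (commutator_maps K V (m - 1)))"
proof -
  \<comment> \<open>That \<open>n\<close> is nonzero selects the branch of
    \<open>projA_boundary\<close> with the commutator; this is where \<open>m \<ge> 2\<close> is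
    used.\<close>
  obtain n where n: "m = Suc n" "n \<noteq> 0" using m2 by (cases m) auto
  let ?S = "T\<lparr>carrier := tensor_power K V m\<rparr>"
  have S: "module K ?S" by (rule TT.scal.submodule_is_module[OF tensor_power_submodule])
  have s: "pr \<in> module_hom K ?S A"
    using pr_hom tensor_power_subset by (auto simp: module_hom_def subset_iff)
  have prinj: "inj_on pr (carrier T)" using pr_bij by (simp add: bij_betw_def)
  have inj: "inj_on pr (carrier ?S)"
    using inj_on_subset[OF prinj tensor_power_subset] by simp
  have im: "pr ` carrier ?S = A_comp m" by (simp add: quadratic_component_def)
  note M = HKhi_part_1_model[OF S s inj im]
  let ?U = "Hom_module K V ?S"
  have prmod: "mod_hom K T A pr"
    using pr_hom TT.scal.module_axioms AA.scal.module_axioms by (simp add: mod_hom_def mod_hom_axioms_def)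
  let ?comm = "\<lambda>t v. t \<otimes>\<^bsub>T\<^esub> pure_tensor K V [v] \<ominus>\<^bsub>T\<^esub> pure_tensor K V [v] \<otimes>\<^bsub>T\<^esub> t"
  have pr_comm: "pr (?comm t v) = pr t \<otimes>\<^bsub>A\<^esub> e_K v \<ominus>\<^bsub>A\<^esub> e_K v \<otimes>\<^bsub>A\<^esub> pr t"
    if "t \<in> carrier T" "v \<in> carrier V" for t v
    using that pure_letter_closed[OF that(2)]
    by (simp add: mod_hom.f_minus[OF prmod] pr_mult koszul_e_eq)
  have "{u \<in> carrier ?U. Q (\<lambda>w\<in>W 1. pr (u (unpure w))) = \<zero>\<^bsub>HKhi K V R0 1\<^esub>} = commutator_maps K V n"
  proof (intro equalityI subsetI)
    fix u assume "u \<in> {u \<in> carrier ?U. Q (\<lambda>w\<in>W 1. pr (u (unpure w))) = \<zero>\<^bsub>HKhi K V R0 1\<^esub>}"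
    then have u: "u \<in> carrier ?U" and Q: "Q (\<lambda>w\<in>W 1. pr (u (unpure w))) = \<zero>\<^bsub>HKhi K V R0 1\<^esub>" by blast+
    obtain c a where ca: "c \<in> carrier K" "a \<in> carrier A"
      "\<And>v. v \<in> carrier V \<Longrightarrow> pr (u v) = c \<odot>\<^bsub>A\<^esub> e_K v \<oplus>\<^bsub>A\<^esub> (a \<otimes>\<^bsub>A\<^esub> e_K v \<ominus>\<^bsub>A\<^esub> e_K v \<otimes>\<^bsub>A\<^esub> a)"
      using iffD1[OF M(3)[OF u] Q] by blast
    \<comment> \<open>The degree n part of \<open>a\<close> is lifted from \<open>A\<close> to
      \<open>T\<close>, where the commutator maps are defined.\<close>
    obtain t where t: "t \<in> tensor_power K V n" "projA n a = pr t"
      using projA_comp[OF ca(2), of n] by (auto simp: quadratic_component_def)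
    then have tT: "t \<in> carrier T" using tensor_power_subset by blast
    have "u v = ?comm t v" if v: "v \<in> carrier V" for v
    proof (rule inj_onD[OF prinj])
      have uv: "u v \<in> tensor_power K V m" using u v by (auto simp: Hom_module_def module_hom_def)
      then show "u v \<in> carrier T" using tensor_power_subset by blast
      show "?comm t v \<in> carrier T" using tT pure_letter_closed[OF v] by simp
      have "pr (u v) = projA m (pr (u v))"
        using uv by (intro projA_id[symmetric]) (simp add: quadratic_component_def)
      also have "\<dots> = projA n a \<otimes>\<^bsub>A\<^esub> e_K v \<ominus>\<^bsub>A\<^esub> e_K v \<otimes>\<^bsub>A\<^esub> projA n a"
        using ca v projA_boundary(2)[of c a v n] n by simp
      also have "\<dots> = pr (?comm t v)" using pr_comm[OF tT v] t by simp
      finally show "pr (u v) = pr (?comm t v)" .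
    qed
    then have "u = (\<lambda>v\<in>carrier V. ?comm t v)"
      using u by (intro extensionalityI[of _ "carrier V"]) (auto simp: Hom_module_def)
    then show "u \<in> commutator_maps K V n" using t by (auto simp: commutator_maps_def)
  next
    fix u assume "u \<in> commutator_maps K V n"
    then obtain t where t: "t \<in> tensor_power K V n" "u = (\<lambda>v\<in>carrier V. ?comm t v)"
      by (auto simp: commutator_maps_def)
    then have tT: "t \<in> carrier T" using tensor_power_subset by blast
    obtain g where g: "g \<in> homog n" "t = q g" using t by (auto simp: tensor_power_eq)
    have gG: "g \<in> carrier G" using g by (simp add: homog_def)
    \<comment> \<open>Products of a homogeneous tensor of degree n with a vector have degree
      \<open>m\<close> on either side, so the commutator map takes its values in the model.\<close>
    have mem: "?comm t v \<in> tensor_power K V m" if v: "v \<in> carrier V" for v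
    proof -
      interpret m: submodule K "tensor_power K V m" T by (rule tensor_power_submodule)
      interpret m: module_submodule K T "tensor_power K V m" by unfold_locales
      have "g \<otimes>\<^bsub>G\<^esub> lin_word v \<in> homog m" "lin_word v \<otimes>\<^bsub>G\<^esub> g \<in> homog m"
        using homog_mult[OF g(1) lin_word_homog[OF v]] homog_mult[OF lin_word_homog[OF v] g(1)] n by simp_all
      moreover have "t \<otimes>\<^bsub>T\<^esub> pure_tensor K V [v] = q (g \<otimes>\<^bsub>G\<^esub> lin_word v)"
        "pure_tensor K V [v] \<otimes>\<^bsub>T\<^esub> t = q (lin_word v \<otimes>\<^bsub>G\<^esub> g)"
        using g gG v by (simp_all add: q_mult lin_word_closed pure_letter)
      ultimately have "t \<otimes>\<^bsub>T\<^esub> pure_tensor K V [v] \<in> tensor_power K V m" "pure_tensor K V [v] \<otimes>\<^bsub>T\<^esub> t \<in> tensor_power K V m"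
        by (auto simp: tensor_power_eq)
      then show ?thesis unfolding TT.minus_eq by (intro m.m_closed m.minus_closed)
    qed
    have "(\<lambda>v. ?comm t v) \<in> module_hom K V T"
    proof -
      have "(\<lambda>v. t \<otimes>\<^bsub>T\<^esub> pure_tensor K V [v]) \<in> module_hom K V T" "(\<lambda>v. pure_tensor K V [v] \<otimes>\<^bsub>T\<^esub> t) \<in> module_hom K V T"
        by (intro module_hom_comp[OF pure_letter_hom TT.mult_left_hom[OF tT]] module_hom_comp[OF pure_letter_hom TT.mult_right_hom[OF tT]])+
      then show ?thesis
        by (auto simp: module_hom_def Pi_iff TT.minus_eq TT.minus_add TT.a_ac TT.scal.smult_r_distr TT.scal.smult_r_minus)
    qed
    then have u: "u \<in> carrier ?U"
      using mem by (auto simp: t(2) Hom_module_def module_hom_def)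
    have "Q (\<lambda>w\<in>W 1. pr (u (unpure w))) = \<zero>\<^bsub>HKhi K V R0 1\<^esub>"
      unfolding M(3)[OF u] using tT
      \<comment> \<open>A commutator map is a boundary with no multiple of e_A, the element of
        \<open>A\<close> being the image of \<open>t\<close>.\<close>
      by (intro bexI[of _ "\<zero>\<^bsub>K\<^esub>"] bexI[of _ "pr t"] ballI)
        (simp_all add: t(2) pr_comm e_K_closed pr_closed)
    then show "u \<in> {u \<in> carrier ?U. Q (\<lambda>w\<in>W 1. pr (u (unpure w))) = \<zero>\<^bsub>HKhi K V R0 1\<^esub>}" using u by blast
  qed
  then show ?thesis
    unfolding M(2) using mod_hom.lin_iso_image_quot_ker[OF M(1)] n by simp
qed

end

theorem proposition7p4:
  fixes K :: "('k, 'b) ring_scheme" and V :: "('k, 'v, 'c) module_scheme"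
    and R :: "('k, 'v) tensor set"
  assumes "vectorspace K V"
    and "vectorspace.fin_dim K V"
    and "2 \<le> vectorspace.dim K V"
    and "R = {\<zero>\<^bsub>tensor_algebra K V\<^esub>}"
  shows "carrier (HKhi K V R 0) = {\<zero>\<^bsub>HKhi K V R 0\<^esub>} \<and>
    lin_iso K (HKhi_part K V R 1 0) (Hom_module K V (base_module K)) \<and>
    lin_iso K (HKhi_part K V R 1 1) (quot_module (Hom_module K V V) (scalar_maps K V)) \<and>
    (\<forall>m\<ge>2. lin_iso K (HKhi_part K V R 1 m)
       (quot_module (Hom_module K V ((tensor_algebra K V)\<lparr>carrier := tensor_power K V m\<rparr>))
          (commutator_maps K V (m - 1)))) \<and>
    (\<forall>p\<ge>2. carrier (HKhi K V R p) = {\<zero>\<^bsub>HKhi K V R p\<^esub>})"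
proof -
  interpret vectorspace K V by fact
  \<comment> \<open>The choice of a basis turns the bound on the dimension into one on
    \<open>card B\<close>, the form in which it provides a second letter.\<close>
  obtain B where B: "finite B" "basis B" using finite_basis_exists assms(2) by blast
  then have "2 \<le> card B" using assms(3) dim_basis by simp
  then interpret koszul_tensor K V B using B by unfold_locales
  show ?thesis
    unfolding assms(4)
    using HKhi_0 HKhi_part_1_0 HKhi_part_1_1 HKhi_part_1_m HKhi_large by blast
qed

end
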